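(* Let $d\ge 1$ and let $m_n$ denote the infinitely wide and deep network classifier $$m_n(x)=\lim_{L\to\infty}\operatorname{sign}\Big(y\,\big(K_n^{(L)}\big)^{-1}K^{(L)}(X,x)\Big)$$ corresponding to the activation function $$\phi(x)=\begin{cases}\dfrac{1}{12\sqrt{70}}\,h_7(x)+\dfrac{1}{\sqrt{2}}\,x & \text{if } d=1,\\[2mm] \dfrac{1}{2^{d/4}}\Big(\dfrac{x^3-3x}{\sqrt{6}}\Big)+\sqrt{1-\dfrac{2}{2^{d/2}}}\,\Big(\dfrac{x^2-1}{\sqrt{2}}\Big)+\dfrac{1}{2^{d/4}}\,x & \text{if } d\ge 2,\end{cases}$$ where $h_7$ is the $7$th probabilist's Hermite polynomial, $h_7(x)=x^7-21x^5+105x^3-105x$. Then $m_n$ is Bayes optimal: whenever the $n$ training examples are drawn i.i.d. from a distribution of $(x,y)$ on $\mathcal{S}_+^{d}\times\{-1,1\}$ whose marginal on $\mathcal{S}_+^{d}$ has a density, then for almost all $x\in\mathcal{S}_+^{d}$ and every $\epsilon>0$, $$\lim_{n\to\infty}\mathbb{P}_X\Big(\Big|m_n(x)-\operatorname*{argmax}_{\tilde{y}\in\{-1,1\}}\mathbb{P}(y=\tilde{y}\mid x)\Big|>\epsilon\Big)=0,$$ where the probability is over the training sample.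
   Context: $\mathcal{S}_+^{d}$ is the intersection of the unit sphere $\mathcal{S}^d\subset\mathbb{R}^{d+1}$ with the non-negative orthant; densities are with respect to surface measure. "Almost all $x$" is with respect to the marginal distribution of $x$ (where $\mathbb{P}(y=\tilde y\mid x)$ is determined). If both labels maximize $\mathbb{P}(y=\tilde y\mid x)$, the absolute difference is read as the distance of $m_n(x)$ to the set of maximizers. Dual activation: $\check{\phi}:[-1,1]\to\mathbb{R}$, $\check{\phi}(z)=\mathbb{E}[\phi(u)\phi(v)]$ where $(u,v)$ is a centered Gaussian vector with covariance $\begin{pmatrix} 1 & z \\ z & 1 \end{pmatrix}$; $\check{\phi}'$ is its derivative. Write $\check{\phi}^{(0)}(z)=z$ and $\check{\phi}^{(L)}=\check{\phi}\circ\check{\phi}^{(L-1)}$. Neural Tangent Kernel (NTK) of the (infinitely wide, bias-free) fully connected network with $L$ hidden layers and activation $\phi$, on the unit sphere: $K^{(L)}(x,\tilde{x})=K^{(L)}(z)$ with $z=x^T\tilde{x}$, where $$K^{(0)}(z)=z,\qquad K^{(L)}(z)=\check{\phi}^{(L)}(z)+K^{(L-1)}(z)\,\check{\phi}'\big(\check{\phi}^{(L-1)}(z)\big).$$ Kernel machine notation: training inputs $X=[x^{(1)}|\dots|x^{(n)}]$ with $x^{(i)}\in\mathcal{S}_+^d$, labels $y=[y^{(1)},\dots,y^{(n)}]\in\{-1,1\}^{1\times n}$, $(K_n^{(L)})_{i,j}=K^{(L)}(x^{(i)},x^{(j)})$, and $K^{(L)}(X,x)\in\mathbb{R}^n$ with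 $i$-th entry $K^{(L)}(x^{(i)},x)$. *)

theory Defs
  imports "HOL-Probability.Probability" "Jordan_Normal_Form.Gauss_Jordan_Elimination"
begin

section \<open>Dual activation and neural tangent kernel\<close>

text \<open>The centred Gaussian vector \<open>(u, v)\<close> with covariance \<open>(1 z; z 1)\<close>, \<open>-1 \<le> z \<le> 1\<close>, realised as
  the image of a standard Gaussian under a square root of the covariance matrix.
  Lemma \<open>char_gauss_pair\<close> confirms that this is the intended law.\<close>

definition gauss_pair :: "real \<Rightarrow> (real \<times> real) measure" where
  "gauss_pair z =
     distr (std_normal_distribution \<Otimes>\<^sub>M std_normal_distribution) (borel \<Otimes>\<^sub>M borel)
       (\<lambda>(g, h). (g, z * g + sqrt (1 - z\<^sup>2) * h))"

lemma char_gauss_pair: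
  assumes "z \<in> {-1..1}"
  shows "(\<integral>(u, v). iexp (a * u + b * v) \<partial>gauss_pair z)
           = complex_of_real (exp (- (a\<^sup>2 + 2 * a * b * z + b\<^sup>2) / 2))"
proof -
  let ?N = "std_normal_distribution"
  interpret N: prob_space ?N
    by (rule prob_space_normal_density) simp
  interpret P: pair_prob_space ?N ?N ..
  define s where "s = sqrt (1 - z\<^sup>2)"
  have s2: "s\<^sup>2 = 1 - z\<^sup>2"
    using assms unfolding s_def by (simp add: abs_le_square_iff[symmetric] abs_square_le_1 abs_le_iff)
  have ch: "(\<integral>x. iexp (t * x) \<partial>?N) = complex_of_real (exp (- t\<^sup>2 / 2))" for t
    using fun_cong[OF char_std_normal_distribution, of t]
    unfolding char_def by (simp add: exp_of_real[symmetric])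
  have int: "integrable ?N (\<lambda>x. iexp (t * x))" for t
    by (rule N.integrable_const_bound[where B = 1]) auto
  have "(\<integral>(u, v). iexp (a * u + b * v) \<partial>gauss_pair z)
      = (\<integral>p. iexp ((a + b * z) * fst p) * iexp ((b * s) * snd p) \<partial>(?N \<Otimes>\<^sub>M ?N))"
    unfolding gauss_pair_def s_def[symmetric]
    by (subst integral_distr)
       (auto simp: case_prod_beta exp_add[symmetric] algebra_simps intro!: Bochner_Integration.integral_cong)
  also have "\<dots> = (\<integral>x. iexp ((a + b * z) * x) \<partial>?N) * (\<integral>y. iexp ((b * s) * y) \<partial>?N)"
    by (subst P.integral_fst'[symmetric])
       (auto intro!: P.integrable_const_bound[where B = 1] simp: norm_mult)
  also have "\<dots> = complex_of_real (exp (- (a + b * z)\<^sup>2 / 2) * exp (- (b * s)\<^sup>2 / 2))"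
    unfolding ch by simp
  also have "exp (- (a + b * z)\<^sup>2 / 2) * exp (- (b * s)\<^sup>2 / 2)
      = exp (- (a\<^sup>2 + 2 * a * b * z + b\<^sup>2) / 2)"
    unfolding exp_add[symmetric] power_mult_distrib s2
    by (rule arg_cong[where f = exp]) (simp add: field_simps power2_eq_square)
  finally show ?thesis .
qed

definition dual_act :: "(real \<Rightarrow> real) \<Rightarrow> real \<Rightarrow> real" where
  "dual_act \<phi> z = (\<integral>(u, v). \<phi> u * \<phi> v \<partial>gauss_pair z)"

text \<open>The derivative is taken within \<open>[-1, 1]\<close>, hence one-sided at the endpoints.\<close>

definition dual_act_deriv :: "(real \<Rightarrow> real) \<Rightarrow> real \<Rightarrow> real" where
  "dual_act_deriv \<phi> z = vector_derivative (dual_act \<phi>) (at z within {-1..1})"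

primrec ntk :: "(real \<Rightarrow> real) \<Rightarrow> nat \<Rightarrow> real \<Rightarrow> real" where
  "ntk \<phi> 0 z = z"
| "ntk \<phi> (Suc L) z =
     (dual_act \<phi> ^^ Suc L) z + ntk \<phi> L z * dual_act_deriv \<phi> ((dual_act \<phi> ^^ L) z)"

section \<open>Kernel machines and their infinite-depth limit\<close>

text \<open>A training sample of size \<open>n\<close> is a function \<open>S\<close> on \<open>{..<n}\<close> (examples are indexed from 0), with
  inputs \<open>fst (S i)\<close> and labels \<open>snd (S i)\<close>.\<close>

definition ntk_gram ::
    "(real \<Rightarrow> real) \<Rightarrow> nat \<Rightarrow> nat \<Rightarrow> (nat \<Rightarrow> 'a::real_inner \<times> real) \<Rightarrow> real mat" where
  "ntk_gram \<phi> L n S = mat n n (\<lambda>(i, j). ntk \<phi> L (inner (fst (S i)) (fst (S j))))"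

definition ntk_cross ::
    "(real \<Rightarrow> real) \<Rightarrow> nat \<Rightarrow> nat \<Rightarrow> (nat \<Rightarrow> 'a::real_inner \<times> real) \<Rightarrow> 'a \<Rightarrow> real Matrix.vec" where
  "ntk_cross \<phi> L n S x = Matrix.vec n (\<lambda>i. ntk \<phi> L (inner (fst (S i)) x))"

text \<open>If the Gram matrix is singular, which can happen for small \<open>L\<close>, the predictor is 0 by convention;
  only large \<open>L\<close> matter for the limit below.\<close>

definition ntk_predictor ::
    "(real \<Rightarrow> real) \<Rightarrow> nat \<Rightarrow> nat \<Rightarrow> (nat \<Rightarrow> 'a::real_inner \<times> real) \<Rightarrow> 'a \<Rightarrow> real" where
  "ntk_predictor \<phi> L n S x =
     (case mat_inverse (ntk_gram \<phi> L n S) of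
        Some B \<Rightarrow> scalar_prod (Matrix.vec n (\<lambda>i. snd (S i))) (B *\<^sub>v ntk_cross \<phi> L n S x)
      | None \<Rightarrow> 0)"

definition depth_seq ::
    "(real \<Rightarrow> real) \<Rightarrow> nat \<Rightarrow> (nat \<Rightarrow> 'a::real_inner \<times> real) \<Rightarrow> 'a \<Rightarrow> nat \<Rightarrow> real" where
  "depth_seq \<phi> n S x L = sgn (ntk_predictor \<phi> L n S x)"

text \<open>Meaningful only where \<open>convergent (depth_seq \<phi> n S x)\<close>.\<close>

definition deep_classifier ::
    "(real \<Rightarrow> real) \<Rightarrow> nat \<Rightarrow> (nat \<Rightarrow> 'a::real_inner \<times> real) \<Rightarrow> 'a \<Rightarrow> real" where
  "deep_classifier \<phi> n S x = lim (depth_seq \<phi> n S x)"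

section \<open>The activation function\<close>

definition hermite7 :: "real \<Rightarrow> real" where
  "hermite7 x = x ^ 7 - 21 * x ^ 5 + 105 * x ^ 3 - 105 * x"

definition bayes_act :: "nat \<Rightarrow> real \<Rightarrow> real" where
  "bayes_act d x =
     (if d = 1 then 1 / (12 * sqrt 70) * hermite7 x + 1 / sqrt 2 * x
      else 1 / 2 powr (real d / 4) * ((x ^ 3 - 3 * x) / sqrt 6)
         + sqrt (1 - 2 / 2 powr (real d / 2)) * ((x\<^sup>2 - 1) / sqrt 2)
         + 1 / 2 powr (real d / 4) * x)"

section \<open>Data distribution and Bayes optimality\<close>

definition orthant_sphere :: "(real ^ 'n) set" where
  "orthant_sphere = {x. norm x = 1 \<and> (\<forall>i. 0 \<le> x $ i)}"

text \<open>Surface measure on the unit sphere by polar coordinates: the surface area of \<open>A\<close> is the dimension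
  of the ambient space times the Lebesgue measure of the cone \<open>{r u | 0 < r \<le> 1, u \<in> A}\<close>.\<close>

definition sphere_surface :: "(real ^ 'n) measure" where
  "sphere_surface =
     scale_measure (of_nat CARD('n))
       (distr (restrict_space lborel (cball 0 1 - {0})) borel (\<lambda>x. x /\<^sub>R norm x))"

definition marginal :: "((real ^ 'n) \<times> real) measure \<Rightarrow> (real ^ 'n) measure" where
  "marginal D = distr D (restrict_space borel orthant_sphere) fst"

text \<open>\<open>\<eta> c x\<close> is a version of \<open>P(y = c | x)\<close>: conditional expectation given the \<open>\<sigma>\<close>-algebra generated by
  the input, factored through the input.\<close>

definition is_label_prob ::
    "((real ^ 'n) \<times> real) measure \<Rightarrow> (real \<Rightarrow> real ^ 'n \<Rightarrow> real) \<Rightarrow> bool" where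
  "is_label_prob D \<eta> \<longleftrightarrow>
     (\<forall>c\<in>{-1, 1}. \<eta> c \<in> borel_measurable (restrict_space borel orthant_sphere) \<and>
       (AE w in D. real_cond_exp D (vimage_algebra (space D) fst (restrict_space borel orthant_sphere))
                     (indicator {w \<in> space D. snd w = c}) w = \<eta> c (fst w)))"

definition bayes_labels :: "(real \<Rightarrow> 'a \<Rightarrow> real) \<Rightarrow> 'a \<Rightarrow> real set" where
  "bayes_labels \<eta> x = {c. is_arg_max (\<lambda>c. \<eta> c x) (\<lambda>c. c \<in> {-1, 1}) c}"

text \<open>The law of \<open>n\<close> i.i.d. examples.\<close>

definition sample_law :: "nat \<Rightarrow> 'b measure \<Rightarrow> (nat \<Rightarrow> 'b) measure" where
  "sample_law n D = Pi\<^sub>M {..<n} (\<lambda>_. D)"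

text \<open>The event that the classifier is undefined at \<open>x\<close> or more than \<open>\<epsilon>\<close> away from the maximisers.
  When the maximiser \<open>c\<close> is unique, \<open>infdist m {c} = \<bar>m - c\<bar>\<close>.\<close>

definition error_event ::
    "(real \<Rightarrow> real) \<Rightarrow> nat \<Rightarrow> ('a::real_inner \<times> real) measure \<Rightarrow> (real \<Rightarrow> 'a \<Rightarrow> real)
       \<Rightarrow> 'a \<Rightarrow> real \<Rightarrow> (nat \<Rightarrow> 'a \<times> real) set" where
  "error_event \<phi> n D \<eta> x \<epsilon> =
     {S \<in> space (sample_law n D).
        \<not> convergent (depth_seq \<phi> n S x)
        \<or> infdist (deep_classifier \<phi> n S x) (bayes_labels \<eta> x) > \<epsilon>}"

end

theory Submission
  imports Defs "Jordan_Normal_Form.Determinant"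
begin

text \<open>On \<open>[0, 1]\<close> the dual activation is a polynomial \<open>F\<close> with an attracting fixed point 0, of multiplier
  \<open>a = F' 0 < 1\<close>, and a repelling fixed point 1, of multiplier \<open>b = F' 1 > 1\<close>. The renormalised iterates
  \<open>F ^^ L / a ^ L\<close> increase to a function \<open>psi\<close> on \<open>[0, 1)\<close>, and a Cesaro argument shows that the kernel at
  depth \<open>L\<close>, divided by \<open>L * a ^ L\<close>, has the same limit, whereas it stays at least 1 on the diagonal. Hence the
  normalised Gram matrix tends to the identity and the infinitely deep classifier is the sign of
  \<open>\<Sum>i. y\<^sub>i psi (x\<^sub>i \<bullet> x)\<close>. From \<open>psi (F z) = a * psi z\<close> one gets that \<open>psi z\<close> is comparable to
  \<open>(1 - z) powr (- \<gamma>)\<close> with \<open>b powr \<gamma> = 1 / a\<close>; the activation is chosen such that \<open>\<gamma> = d / 2\<close>, so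
  the weights are comparable to \<open>dist x\<^sub>i x\<close> to the power \<open>- d\<close>, as in the Hilbert kernel estimate.

  At a point \<open>x\<close> where spherical caps differentiate the law of the data, a weight \<open>W\<close> has tail
  \<open>P (W \<ge> t) = O(1 / t)\<close>, and the signed weight truncated at \<open>T\<close> has a mean of order at least \<open>ln T\<close>, with the sign of the
  Bayes decision. Truncating at \<open>T = n ln n\<close>, no weight exceeds \<open>T\<close> with probability
  \<open>1 - O(1 / ln n)\<close>, and Chebyshev's inequality shows that the sum has the right sign. Cap differentiation at
  almost every point follows from Lebesgue's differentiation theorem in the ambient space, applied to
  functions that are homogeneous of degree 0.\<close>

section \<open>Iterated dual activation and its renormalised limit\<close>

text \<open>The exponent \<open>\<gamma>\<close> is critical. With a smaller one the weights would
  have a finite mean, so examples at a fixed distance would keep a share in the decision; with a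
  larger one a few nearest examples would outweigh all others. At the critical value the mean just
  diverges, and the divergence comes from arbitrarily small caps, where the labels follow the local
  label probabilities. The condition \<open>b powr \<gamma> = 1 / a\<close> then fixes the
  activation. For d >= 2 the dual activation is a z^3 + (1 - 2 a) z^2 + a z with a = 2 powr (- d /
  2) and slope b = 2 at 1. For d = 1 its middle coefficient would be negative, hence (z^7 + z) / 2,
  with a = 1 / 2 and b = 4.

  A second obstacle is that the sign is discontinuous at 0: nothing guarantees a limit in depth
  where the score vanishes. Such ties are null events because \<open>psi\<close> is strictly
  increasing and the data law charges no level set of the inner product with x. The latter also
  keeps the inputs distinct, without which the normalised Gram matrix would not tend to the
  identity.\<close>

lemma cesaro_increments:
  fixes s :: "nat \<Rightarrow> real"
  assumes "(\<lambda>n. s (Suc n) - s n) \<longlonglongrightarrow> l"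
  shows "(\<lambda>n. s n / real n) \<longlonglongrightarrow> l"
proof (rule LIMSEQ_I)
  fix e :: real assume e: "e > 0"
  obtain N where N: "\<And>n. n \<ge> N \<Longrightarrow> \<bar>s (Suc n) - s n - l\<bar> < e / 2"
    using LIMSEQ_D[OF assms, of "e / 2"] e by auto
  define M where "M = \<bar>s N - l * N\<bar>"
  \<comment> \<open>Beyond \<open>N\<close> the distance of \<open>s\<close> to the linear sequence
    of slope \<open>l\<close> grows by at most \<open>e / 2\<close> per step. The error
    \<open>M\<close> already made at \<open>N\<close> disappears after division by a large
    n.\<close>
  have bd: "\<bar>s (N + k) - l * (N + k)\<bar> \<le> M + e / 2 * k" for k
  proof (induction k)
    case (Suc k)
    have eq: "s (N + Suc k) - l * (N + Suc k)
        = (s (N + k) - l * (N + k)) + (s (Suc (N + k)) - s (N + k) - l)"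
      by (simp add: algebra_simps)
    have "\<bar>s (N + Suc k) - l * (N + Suc k)\<bar> \<le> (M + e / 2 * k) + e / 2"
      unfolding eq using Suc.IH N[of "N + k"] abs_triangle_ineq[of "s (N + k) - l * (N + k)" "s (Suc (N + k)) - s (N + k) - l"]
      by linarith
    then show ?case by (simp add: algebra_simps add_divide_distrib)
  qed (simp add: M_def)
  obtain N2 :: nat where N2: "real N2 > 2 * M / e" using reals_Archimedean2 by blast
  show "\<exists>no. \<forall>n\<ge>no. norm (s n / real n - l) < e"
  proof (intro exI[of _ "max (N + 1) N2"] allI impI)
    fix n assume n: "max (N + 1) N2 \<le> n"
    then obtain k where k: "n = N + k" "n > 0" using le_Suc_ex by fastforce
    have "M < e / 2 * real n" using N2 n e by (simp add: field_simps) (smt (verit) mult_left_mono of_nat_le_iff max.bounded_iff)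
    moreover have "e / 2 * k \<le> e / 2 * n" using k e by simp
    ultimately have "\<bar>s n - l * n\<bar> < e * n" using bd[of k] unfolding k(1) of_nat_add by linarith
    moreover have "s n / n - l = (s n - l * n) / n" using k(2) by (simp add: diff_divide_distrib)
    ultimately show "norm (s n / real n - l) < e" using k(2) by (simp add: abs_divide pos_divide_less_eq)
  qed
qed

text \<open>\<open>\<Phi>\<close> is a coordinate that vanishes to first order at 1 and that \<open>F\<close> expands by a factor of at least \<open>b\<close>. It
  bounds the number of steps an orbit starting near 1 can spend above 1/2.\<close>

locale depth_map =
  fixes F q F' \<Phi> :: "real \<Rightarrow> real" and a b \<gamma> C \<theta> :: real
  assumes a: "0 < a" "a < 1" and b: "1 < b" and \<gamma>: "0 < \<gamma>" "b powr \<gamma> = 1 / a" and C: "0 \<le> C" and \<theta>: "0 < \<theta>"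
    and F_eq: "\<And>z. F z = z * q z"
    and q_mono: "\<And>x y. 0 \<le> x \<Longrightarrow> x \<le> y \<Longrightarrow> y \<le> 1 \<Longrightarrow> q x \<le> q y"
    and q_0: "q 0 = a" and q_1: "q 1 = 1"
    and q_less: "\<And>z. 0 \<le> z \<Longrightarrow> z < 1 \<Longrightarrow> q z < 1"
    and q_le: "\<And>z. 0 \<le> z \<Longrightarrow> z \<le> 1 \<Longrightarrow> q z \<le> a + C * z"
    and F'_ge: "\<And>z. 0 \<le> z \<Longrightarrow> z \<le> 1 \<Longrightarrow> a \<le> F' z"
    and F'_le: "\<And>z. 0 \<le> z \<Longrightarrow> z \<le> 1 \<Longrightarrow> F' z \<le> a + C * z"
    and F'_1: "F' 1 = b"
    and F_tangent: "\<And>z. 0 \<le> z \<Longrightarrow> z \<le> 1 \<Longrightarrow> 1 - b * (1 - z) \<le> F z"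
    and F_cont: "continuous_on {0..1} F"
    and \<Phi>_ge: "\<And>z. 0 < z \<Longrightarrow> z < 1 \<Longrightarrow> 1 - z \<le> \<Phi> z"
    and \<Phi>_step: "\<And>z. 0 < z \<Longrightarrow> z < 1 \<Longrightarrow> b * \<Phi> z \<le> \<Phi> (F z)"
    and \<Phi>_half: "\<And>z. 0 < z \<Longrightarrow> z < 1 \<Longrightarrow> \<theta> \<le> \<Phi> z \<Longrightarrow> z \<le> 1 / 2"
begin

section \<open>The linearising function at the attracting fixed point\<close>

definition renorm :: "nat \<Rightarrow> real \<Rightarrow> real" where
  "renorm k z = (F ^^ k) z / a ^ k"

text \<open>The Koenigs function of \<open>F\<close> at 0, a solution of Schroeder's equation. It is
  meaningful on [0, 1) only: at 1 the renormalised iterates are the powers of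
  \<open>1 / a\<close>.\<close>

definition psi :: "real \<Rightarrow> real" where
  "psi z = lim (\<lambda>k. renorm k z)"

lemma q_ge: "0 \<le> z \<Longrightarrow> z \<le> 1 \<Longrightarrow> a \<le> q z"
  using q_mono[of 0 z] q_0 by simp

lemma q_le1: "0 \<le> z \<Longrightarrow> z \<le> 1 \<Longrightarrow> q z \<le> 1"
  using q_mono[of z 1] q_1 by simp

lemma F_range: assumes "0 \<le> z" "z \<le> 1" shows "0 \<le> F z" "F z \<le> z"
proof -
  show "0 \<le> F z" using assms q_ge[OF assms] a by (simp add: F_eq)
  show "F z \<le> z" using assms mult_left_mono[OF q_le1[OF assms] assms(1)] by (simp add: F_eq)
qed

text \<open>One step of \<open>F\<close> shrinks distances by no more than the factor
  \<open>a\<close>, which the renormalisation undoes. The resulting lower Lipschitz bound survives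
  in the limit and makes \<open>psi\<close> injective, which later excludes ties.\<close>

lemma F_diff:
  assumes "0 \<le> x" "x \<le> y" "y \<le> 1"
  shows "a * (y - x) \<le> F y - F x"
proof -
  have "F y - F x = (y - x) * q y + x * (q y - q x)" by (simp add: F_eq algebra_simps)
  moreover have "a * (y - x) \<le> (y - x) * q y"
    using q_ge[of y] assms by (simp add: mult.commute mult_right_mono)
  moreover have "0 \<le> x * (q y - q x)" using q_mono assms by simp
  ultimately show ?thesis by simp
qed

lemma iter_range: "0 \<le> z \<Longrightarrow> z \<le> 1 \<Longrightarrow> 0 \<le> (F ^^ k) z \<and> (F ^^ k) z \<le> z"
  by (induction k) (use F_range in \<open>auto intro: order_trans\<close>)

lemma iter_range1: "0 \<le> z \<Longrightarrow> z \<le> 1 \<Longrightarrow> (F ^^ k) z \<le> 1"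
  using iter_range[of z k] by linarith

lemma iter_one: "(F ^^ k) 1 = 1"
  by (induction k) (auto simp: F_eq q_1)

lemma iter_zero: "(F ^^ k) 0 = 0"
  by (induction k) (auto simp: F_eq)

lemma iter_diff:
  assumes "0 \<le> x" "x \<le> y" "y \<le> 1"
  shows "a ^ k * (y - x) \<le> (F ^^ k) y - (F ^^ k) x"
proof (induction k)
  case (Suc k)
  have "(F ^^ k) x \<le> (F ^^ k) y" using Suc assms a by (smt (verit) zero_le_mult_iff zero_le_power)
  then have "a * ((F ^^ k) y - (F ^^ k) x) \<le> F ((F ^^ k) y) - F ((F ^^ k) x)"
    using assms iter_range[of x k] iter_range[of y k] by (intro F_diff) auto
  moreover have "a * (a ^ k * (y - x)) \<le> a * ((F ^^ k) y - (F ^^ k) x)"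
    using Suc a by (intro mult_left_mono) auto
  ultimately show ?case by (simp add: mult.assoc)
qed simp

lemma renorm_diff:
  assumes "0 \<le> x" "x \<le> y" "y \<le> 1"
  shows "y - x \<le> renorm k y - renorm k x"
  using iter_diff[OF assms, of k] a unfolding renorm_def diff_divide_distrib[symmetric]
  by (simp add: pos_le_divide_eq mult.commute)

lemma renorm_mono: assumes "0 \<le> z" "z \<le> 1" shows "renorm k z \<le> renorm (Suc k) z"
proof -
  have "a * (F ^^ k) z \<le> F ((F ^^ k) z)"
    using F_diff[of 0 "(F ^^ k) z"] iter_range[of z k] assms by (simp add: F_eq)
  then show ?thesis using a by (simp add: renorm_def field_simps)
qed

lemma renorm_incseq: "0 \<le> z \<Longrightarrow> z \<le> 1 \<Longrightarrow> incseq (\<lambda>k. renorm k z)"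
  by (rule incseq_SucI) (rule renorm_mono)

lemma renorm_nonneg: "0 \<le> z \<Longrightarrow> z \<le> 1 \<Longrightarrow> 0 \<le> renorm k z"
  using iter_range[of z k] a by (simp add: renorm_def)

text \<open>The orbit decreases, so by monotonicity of \<open>q\<close> every ratio of consecutive
  points is at most the first one. The rate is cruder than \<open>a\<close>, but it makes the
  corrections \<open>C * (F ^^ k) z\<close> summable.\<close>

lemma iter_geometric: assumes "0 \<le> z" "z < 1" shows "(F ^^ k) z \<le> q z ^ k"
proof (induction k)
  case 0 then show ?case using assms by simp
next
  case (Suc k)
  have r: "0 \<le> (F ^^ k) z" "(F ^^ k) z \<le> z" using iter_range[of z k] assms by auto
  have "F ((F ^^ k) z) \<le> (F ^^ k) z * q z"
    unfolding F_eq[of "(F ^^ k) z"] using r assms by (intro mult_left_mono q_mono) auto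
  also have "\<dots> \<le> q z ^ k * q z" using Suc q_ge[of z] assms a by (intro mult_right_mono) auto
  finally show ?case by (simp add: mult.commute)
qed

lemma geometric_sum_le:
  assumes "0 \<le> z" "z < 1"
  shows "(\<Sum>j<k. C / a * q z ^ j) \<le> C / a * (1 / (1 - q z))"
proof -
  have r: "0 < q z" "q z < 1" using q_ge[of z] q_less[of z] assms a by auto
  have "(\<Sum>j<k. q z ^ j) \<le> (\<Sum>j. q z ^ j)"
    using r by (intro sum_le_suminf summable_geometric) auto
  then show ?thesis unfolding sum_distrib_left[symmetric]
    using r C a by (intro mult_left_mono) (auto simp: suminf_geometric)
qed

text \<open>Step k multiplies \<open>renorm\<close> by at most 1 + (C / a) r^k with r =
  \<open>q z\<close>. Bounding each factor by an exponential turns the product into the exponential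
  of a geometric series.\<close>

lemma renorm_bound: assumes "0 \<le> z" "z < 1" shows "\<exists>B. \<forall>k. renorm k z \<le> B"
proof -
  let ?r = "q z"
  have r: "0 < ?r" "?r < 1" using q_ge[of z] q_less[of z] assms a by auto
  have "renorm k z \<le> exp (\<Sum>j<k. C / a * ?r ^ j)" for k
  proof (induction k)
    case 0 then show ?case using assms by (simp add: renorm_def)
  next
    case (Suc k)
    let ?y = "(F ^^ k) z"
    have y: "0 \<le> ?y" "?y \<le> z" "?y \<le> ?r ^ k" using iter_range[of z k] iter_geometric[of z k] assms by auto
    have "F ?y \<le> ?y * (a + C * ?y)"
      unfolding F_eq[of ?y] using y assms by (intro mult_left_mono q_le) auto
    also have "\<dots> \<le> ?y * (a * (1 + C / a * ?r ^ k))"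
      using y C a by (intro mult_left_mono) (auto simp: algebra_simps intro!: mult_left_mono)
    also have "\<dots> \<le> ?y * (a * exp (C / a * ?r ^ k))"
      using y a by (intro mult_left_mono exp_ge_add_one_self) auto
    finally have "renorm (Suc k) z \<le> ?y * (a * exp (C / a * ?r ^ k)) / a ^ Suc k"
      unfolding renorm_def funpow.simps(2) comp_def using a by (intro divide_right_mono) auto
    also have "\<dots> = renorm k z * exp (C / a * ?r ^ k)"
      using a by (simp add: renorm_def)
    also have "\<dots> \<le> exp (\<Sum>j<k. C / a * ?r ^ j) * exp (C / a * ?r ^ k)"
      using Suc by (intro mult_right_mono) auto
    finally show ?case by (simp add: exp_add)
  qed
  then show ?thesis using geometric_sum_le[OF assms] by (meson exp_le_cancel_iff order_trans)
qed

lemma renorm_lim: assumes "0 \<le> z" "z < 1" shows "(\<lambda>k. renorm k z) \<longlonglongrightarrow> psi z"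
proof -
  obtain B where "\<And>k. renorm k z \<le> B" using renorm_bound[OF assms] by auto
  then obtain L where "(\<lambda>k. renorm k z) \<longlonglongrightarrow> L"
    using incseq_convergent[OF renorm_incseq] assms by (metis less_imp_le)
  then show ?thesis unfolding psi_def by (simp add: limI)
qed

lemma renorm_le_psi: assumes "0 \<le> z" "z < 1" shows "renorm k z \<le> psi z"
  using incseq_le[OF renorm_incseq renorm_lim] assms by simp

lemma psi_diff:
  assumes "0 \<le> x" "x \<le> y" "y < 1"
  shows "y - x \<le> psi y - psi x"
proof (rule LIMSEQ_le_const)
  show "(\<lambda>k. renorm k y - renorm k x) \<longlonglongrightarrow> psi y - psi x"
    using assms by (intro tendsto_diff renorm_lim) auto
  show "\<exists>N. \<forall>n\<ge>N. y - x \<le> renorm n y - renorm n x" using renorm_diff assms by auto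
qed

lemma psi_mono: "0 \<le> x \<Longrightarrow> x \<le> y \<Longrightarrow> y < 1 \<Longrightarrow> psi x \<le> psi y"
  using psi_diff[of x y] by simp

lemma psi_inj: "0 \<le> x \<Longrightarrow> x < 1 \<Longrightarrow> 0 \<le> y \<Longrightarrow> y < 1 \<Longrightarrow> psi x = psi y \<Longrightarrow> x = y"
  using psi_diff[of x y] psi_diff[of y x] by linarith

lemma psi_zero: "psi 0 = 0"
  unfolding psi_def renorm_def by (simp add: iter_zero)

lemma psi_ge: "0 \<le> z \<Longrightarrow> z < 1 \<Longrightarrow> z \<le> psi z"
  using psi_diff[of 0 z] psi_zero by simp

lemma psi_iter:
  assumes "0 \<le> z" "z < 1"
  shows "psi ((F ^^ k) z) = a ^ k * psi z"
proof -
  have "(\<lambda>n. a ^ k * renorm (n + k) z) \<longlonglongrightarrow> a ^ k * psi z"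
    by (intro tendsto_mult_left LIMSEQ_ignore_initial_segment renorm_lim assms)
  moreover have "a ^ k * renorm (n + k) z = renorm n ((F ^^ k) z)" for n
    using a by (simp add: renorm_def funpow_add power_add)
  ultimately have "(\<lambda>n. renorm n ((F ^^ k) z)) \<longlonglongrightarrow> a ^ k * psi z" by simp
  then show ?thesis unfolding psi_def[of "(F ^^ k) z"] by (rule limI)
qed

lemma renorm_cont: "continuous_on {0..1} (renorm k)"
proof -
  have "continuous_on {0..1} (F ^^ k)"
  proof (induction k)
    case (Suc k)
    have "continuous_on ((F ^^ k) ` {0..1}) F"
      using iter_range iter_range1 by (intro continuous_on_subset[OF F_cont]) auto
    then show ?case using continuous_on_compose[OF Suc] by (simp add: comp_def)
  qed (simp add: id_def continuous_on_id)
  then show ?thesis unfolding renorm_def using a by (intro continuous_intros) auto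
qed

text \<open>A supremum of continuous functions is lower semicontinuous. Together with monotonicity
  this makes the superlevel sets of \<open>psi\<close> intervals that are open on the left, which is
  all that \<open>weight_superlevel\<close> needs.\<close>

lemma psi_lower_semicont:
  assumes "0 \<le> z" "z < 1" "t < psi z"
  shows "\<exists>\<delta>>0. \<forall>y. 0 \<le> y \<longrightarrow> y < 1 \<longrightarrow> \<bar>y - z\<bar> < \<delta> \<longrightarrow> t < psi y"
proof -
  obtain k where k: "t < renorm k z"
    using order_tendstoD(1)[OF renorm_lim[OF assms(1,2)] assms(3)] eventually_happens by force
  obtain \<delta> where \<delta>: "\<delta> > 0" "\<And>y. y \<in> {0..1} \<Longrightarrow> dist y z < \<delta> \<Longrightarrow> dist (renorm k y) (renorm k z) < renorm k z - t"
    using renorm_cont[of k, unfolded continuous_on_iff, rule_format, of z "renorm k z - t"] assms k by auto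
  show ?thesis
  proof (intro exI[of _ \<delta>] conjI allI impI \<delta>(1))
    fix y :: real assume y: "0 \<le> y" "y < 1" "\<bar>y - z\<bar> < \<delta>"
    then have "\<bar>renorm k y - renorm k z\<bar> < renorm k z - t"
      using \<delta>(2)[of y] by (simp add: dist_real_def)
    then show "t < psi y" using renorm_le_psi[of y k] y by linarith
  qed
qed

section \<open>Two-sided power bounds for the linearising function near 1\<close>

lemma inverse_a_power: "(1 / a) ^ k = (b ^ k) powr \<gamma>"
proof -
  have "(b ^ k) powr \<gamma> = (b powr \<gamma>) ^ k"
    using b by (induction k) (auto simp: powr_mult)
  then show ?thesis by (simp add: \<gamma>)
qed

text \<open>The tangent at 1 shows that k steps enlarge the distance to 1 by at most b^k, so the
  orbit is still at or above 1 / 2 for a number of steps k with b^k of order 1 / (1 - z).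
  Schroeder's equation converts these k steps into the factor a^(-k), which is b^k to the power
  \<open>\<gamma>\<close>.\<close>

lemma psi_lower:
  assumes "1 / 2 \<le> z" "z < 1"
  shows "psi (1 / 2) * (2 * b) powr (- \<gamma>) * (1 - z) powr (- \<gamma>) \<le> psi z"
proof -
  \<comment> \<open>This choice gives b^k (1 - z) <= 1 / 2 < b^(k + 1) (1 - z). The first half keeps
    the orbit above 1 / 2; the exponent k + 1 in the second is the source of the factor
    \<open>b\<close> in \<open>2 * b\<close>.\<close>
  define k where "k = (LEAST k. 1 / 2 < b ^ Suc k * (1 - z))"
  obtain k0 where "1 / (2 * (1 - z)) < b ^ k0" using real_arch_pow[OF b] by blast
  then have "1 / 2 < b ^ k0 * (1 - z)" using assms by (simp add: field_simps)
  also have "\<dots> \<le> b ^ Suc k0 * (1 - z)" using b assms by simp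
  finally have k: "1 / 2 < b ^ Suc k * (1 - z)" unfolding k_def by (rule LeastI)
  have kk: "b ^ k * (1 - z) \<le> 1 / 2"
  proof (cases k)
    case (Suc j)
    then have "\<not> 1 / 2 < b ^ Suc j * (1 - z)"
      using not_less_Least[of j "\<lambda>k. 1 / 2 < b ^ Suc k * (1 - z)"] unfolding k_def by linarith
    then show ?thesis using Suc by simp
  qed (use assms in simp)
  have it: "1 - b ^ j * (1 - z) \<le> (F ^^ j) z" for j
  proof (induction j)
    case (Suc j)
    have "1 - b * (1 - (F ^^ j) z) \<le> F ((F ^^ j) z)"
      using iter_range[of z j] assms by (intro F_tangent) auto
    moreover have "b * (1 - (F ^^ j) z) \<le> b * (b ^ j * (1 - z))"
      using Suc b by (intro mult_left_mono) auto
    ultimately show ?case by simp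
  qed simp
  have half: "1 / 2 \<le> (F ^^ k) z" using it[of k] kk by simp
  have "psi (1 / 2) \<le> psi ((F ^^ k) z)"
    using half iter_range[of z k] assms by (intro psi_mono) auto
  also have "\<dots> = a ^ k * psi z" using psi_iter assms by simp
  finally have 1: "(1 / a) ^ k * psi (1 / 2) \<le> psi z" using a by (simp add: field_simps)
  have "(2 * b) powr (- \<gamma>) * (1 - z) powr (- \<gamma>) = (2 * b * (1 - z)) powr (- \<gamma>)"
    using b assms by (simp add: powr_mult)
  also have "\<dots> = (1 / (2 * b * (1 - z))) powr \<gamma>"
    using b assms by (simp add: powr_minus_divide powr_divide)
  also have "\<dots> \<le> (b ^ k) powr \<gamma>"
    using k b assms \<gamma> by (intro powr_mono2) (auto simp: field_simps)
  also have "\<dots> = (1 / a) ^ k" by (simp add: inverse_a_power)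
  finally have 2: "(2 * b) powr (- \<gamma>) * (1 - z) powr (- \<gamma>) \<le> (1 / a) ^ k" .
  have "0 \<le> psi (1 / 2)" using psi_ge[of "1 / 2"] by simp
  from mult_left_mono[OF 2 this] 1 show ?thesis by (simp add: mult_ac)
qed

lemma psi_half_pos: "0 < psi (1 / 2)"
  using psi_ge[of "1 / 2"] by simp

lemma F_pos: "0 < z \<Longrightarrow> z < 1 \<Longrightarrow> 0 < F z"
  using q_ge[of z] a by (simp add: F_eq)

text \<open>Here the orbit must be shown to leave the neighbourhood of 1 fast enough, for which the
  tangent bound points the wrong way; \<open>\<Phi>\<close> replaces it. One step before the orbit
  first drops to 1 / 2 the value of \<open>\<Phi>\<close> is still below \<open>\<theta>\<close>, so
  b^(k - 1) (1 - z) < \<open>\<theta>\<close>. The summand 1 in the constant covers z <= 1 /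
  2.\<close>

lemma psi_upper:
  assumes "0 \<le> z" "z < 1"
  shows "psi z \<le> psi (1 / 2) * ((\<theta> * b) powr \<gamma> + 1) * (1 - z) powr (- \<gamma>)"
proof (cases "z \<le> 1 / 2")
  case True
  have "psi z \<le> psi (1 / 2)" using True assms by (intro psi_mono) auto
  moreover have "1 powr \<gamma> \<le> (1 / (1 - z)) powr \<gamma>"
    using assms \<gamma> by (intro powr_mono2) (auto simp: field_simps)
  then have "1 \<le> (1 - z) powr (- \<gamma>)" using assms by (simp add: powr_minus_divide powr_divide)
  ultimately show ?thesis using psi_half_pos
    by (smt (verit) mult_le_cancel_left1 mult_le_cancel_left2 powr_ge_zero mult.assoc mult_mono)
next
  case False
  then have z: "1 / 2 < z" "0 < z" by auto
  define k where "k = (LEAST k. (F ^^ k) z \<le> 1 / 2)"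
  have pos: "0 < (F ^^ j) z \<and> (F ^^ j) z < 1" for j
    by (induction j) (use z assms F_pos F_range(2) in \<open>auto intro: le_less_trans[OF F_range(2)]\<close>)
  have grow: "b ^ j * (1 - z) \<le> \<Phi> ((F ^^ j) z)" for j
  proof (induction j)
    case (Suc j)
    have "b * (b ^ j * (1 - z)) \<le> b * \<Phi> ((F ^^ j) z)" using Suc b by (intro mult_left_mono) auto
    also have "\<dots> \<le> \<Phi> (F ((F ^^ j) z))" using pos[of j] by (intro \<Phi>_step) auto
    finally show ?case by (simp add: mult.assoc)
  qed (use \<Phi>_ge z assms in simp)
  obtain k0 where "\<theta> / (1 - z) < b ^ k0" using real_arch_pow[OF b] by blast
  then have "\<theta> \<le> b ^ k0 * (1 - z)" using assms by (simp add: field_simps)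
  then have "(F ^^ k0) z \<le> 1 / 2" using grow[of k0] pos[of k0] by (intro \<Phi>_half) auto
  then have k: "(F ^^ k) z \<le> 1 / 2" unfolding k_def by (rule LeastI)
  then have "k \<noteq> 0" using z by (cases k) auto
  then obtain j where j: "k = Suc j" by (cases k) auto
  then have "\<not> (F ^^ j) z \<le> 1 / 2"
    using not_less_Least[of j "\<lambda>k. (F ^^ k) z \<le> 1 / 2"] unfolding k_def by linarith
  then have "\<Phi> ((F ^^ j) z) < \<theta>" using \<Phi>_half pos[of j] by (meson not_le)
  then have "b ^ j * (1 - z) < \<theta>" using grow[of j] by simp
  then have "b * (b ^ j * (1 - z)) < b * \<theta>" using b by (intro mult_strict_left_mono) auto
  then have "b ^ k * (1 - z) \<le> \<theta> * b" by (simp add: j mult_ac)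
  then have "b ^ k \<le> \<theta> * b / (1 - z)" using assms by (simp add: field_simps)
  then have "(b ^ k) powr \<gamma> \<le> (\<theta> * b / (1 - z)) powr \<gamma>"
    using b \<gamma> by (intro powr_mono2) auto
  also have "\<dots> = (\<theta> * b) powr \<gamma> * (1 - z) powr (- \<gamma>)"
    using assms b \<theta> by (simp add: powr_divide powr_minus_divide)
  also have "\<dots> \<le> ((\<theta> * b) powr \<gamma> + 1) * (1 - z) powr (- \<gamma>)" by (simp add: algebra_simps)
  finally have 1: "(1 / a) ^ k \<le> ((\<theta> * b) powr \<gamma> + 1) * (1 - z) powr (- \<gamma>)" by (simp add: inverse_a_power)
  have "a ^ k * psi z = psi ((F ^^ k) z)" using psi_iter assms by simp
  also have "\<dots> \<le> psi (1 / 2)" using k pos[of k] by (intro psi_mono) auto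
  finally have "psi z \<le> psi (1 / 2) * (1 / a) ^ k" using a by (simp add: field_simps)
  also have "\<dots> \<le> psi (1 / 2) * (((\<theta> * b) powr \<gamma> + 1) * (1 - z) powr (- \<gamma>))"
    using 1 psi_half_pos by (intro mult_left_mono) auto
  finally show ?thesis by (simp add: mult_ac)
qed

text \<open>After division by \<open>a ^ L\<close> the recursion adds a term tending to
  \<open>psi z\<close> and multiplies by 1 + \<open>\<delta> L\<close> with \<open>\<delta>\<close>
  geometrically small. The growth is therefore linear, the product
  \<open>\<kappa> L * \<delta> L\<close> vanishes, and the increments of \<open>\<kappa>\<close>
  tend to \<open>psi z\<close>.\<close>

lemma ntk_limit:
  assumes z: "0 \<le> z" "z < 1"
    and K: "K 0 = z" "\<And>L. K (Suc L) = (F ^^ Suc L) z + K L * F' ((F ^^ L) z)"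
  shows "(\<lambda>L. K L / (real L * a ^ L)) \<longlonglongrightarrow> psi z"
proof -
  let ?r = "q z"
  have r: "0 < ?r" "?r < 1" using q_ge[of z] q_less[of z] z a by auto
  define \<kappa> where "\<kappa> L = K L / a ^ L" for L
  define \<delta> where "\<delta> L = F' ((F ^^ L) z) / a - 1" for L
  have y: "0 \<le> (F ^^ k) z" "(F ^^ k) z \<le> 1" "(F ^^ k) z \<le> ?r ^ k" for k
    using iter_range[of z k] iter_geometric[of z k] z by auto
  have \<delta>0: "0 \<le> \<delta> L" for L using F'_ge[OF y(1,2)] a by (simp add: \<delta>_def field_simps)
  have \<delta>1: "\<delta> L \<le> C / a * ?r ^ L" for L
  proof -
    have "F' ((F ^^ L) z) \<le> a + C * ?r ^ L"
      using F'_le[OF y(1,2)[of L]] mult_left_mono[OF y(3)[of L] C] by linarith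
    then have "F' ((F ^^ L) z) / a \<le> (a + C * ?r ^ L) / a" using a by (intro divide_right_mono) auto
    then show ?thesis using a by (simp add: \<delta>_def add_divide_distrib)
  qed
  have rec: "\<kappa> (Suc L) = renorm (Suc L) z + \<kappa> L * (1 + \<delta> L)" for L
    using a by (simp add: \<kappa>_def K renorm_def \<delta>_def add_divide_distrib)
  have \<kappa>0: "0 \<le> \<kappa> L" for L
  proof (induction L)
    case (Suc L)
    show ?case unfolding rec using Suc \<delta>0[of L] renorm_nonneg[of z "Suc L"] z
      by (intro add_nonneg_nonneg mult_nonneg_nonneg) auto
  qed (use z K in \<open>simp add: \<kappa>_def\<close>)
  define E where "E L = exp (\<Sum>j<L. C / a * ?r ^ j)" for L
  have E1: "1 \<le> E L" for L unfolding E_def using C a r by (auto intro!: sum_nonneg)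
  \<comment> \<open>Only linear growth matters here: a linear sequence times the geometric bound on
    \<open>\<delta>\<close> tends to 0.\<close>
  have up: "\<kappa> L \<le> (1 + psi z) * (1 + real L) * E L" for L
  proof (induction L)
    case 0
    show ?case using psi_ge[of z] z K by (simp add: \<kappa>_def E_def)
  next
    case (Suc L)
    have p: "0 \<le> psi z" using psi_ge[OF z] z by simp
    have ES: "E (Suc L) = E L * exp (C / a * ?r ^ L)" by (simp add: E_def exp_add)
    have "1 + \<delta> L \<le> exp (C / a * ?r ^ L)"
      using \<delta>1[of L] exp_ge_add_one_self[of "C / a * ?r ^ L"] by linarith
    then have "\<kappa> L * (1 + \<delta> L) \<le> ((1 + psi z) * (1 + real L) * E L) * exp (C / a * ?r ^ L)"
      using Suc \<kappa>0[of L] \<delta>0[of L] p E1[of L] by (intro mult_mono) auto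
    also have "\<dots> = (1 + psi z) * (1 + real L) * E (Suc L)" by (simp add: ES)
    finally have 1: "\<kappa> L * (1 + \<delta> L) \<le> (1 + psi z) * (1 + real L) * E (Suc L)" .
    have "(1 + psi z) * 1 \<le> (1 + psi z) * E (Suc L)" using p E1[of "Suc L"] by (intro mult_left_mono) auto
    then have "renorm (Suc L) z \<le> (1 + psi z) * E (Suc L)" using renorm_le_psi[OF z, of "Suc L"] by simp
    then show ?case unfolding rec using 1 by (simp add: algebra_simps)
  qed
  define B where "B = exp (C / a * (1 / (1 - ?r)))"
  have EB: "E L \<le> B" for L
    unfolding E_def B_def using geometric_sum_le[OF z] by simp
  have lin: "(\<lambda>L. (1 + real L) * ?r ^ L) \<longlonglongrightarrow> 0"
  proof -
    have "(\<lambda>L. ?r ^ L + real L * ?r ^ L) \<longlonglongrightarrow> 0 + 0"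
      using r by (intro tendsto_add LIMSEQ_power_zero powser_times_n_limit_0) auto
    then show ?thesis by (simp add: algebra_simps)
  qed
  have "(\<lambda>L. \<kappa> L * \<delta> L) \<longlonglongrightarrow> 0"
  proof (rule tendsto_sandwich[OF always_eventually always_eventually tendsto_const])
    show "\<forall>L. 0 \<le> \<kappa> L * \<delta> L" using \<kappa>0 \<delta>0 by simp
    show "(\<lambda>L. ((1 + psi z) * B * C / a) * ((1 + real L) * ?r ^ L)) \<longlonglongrightarrow> 0"
      using tendsto_mult_left[OF lin, of "(1 + psi z) * B * C / a"] by simp
    show "\<forall>L. \<kappa> L * \<delta> L \<le> ((1 + psi z) * B * C / a) * ((1 + real L) * ?r ^ L)"
    proof
      fix L
      have p: "0 \<le> psi z" using psi_ge[OF z] z by simp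
      have "(1 + psi z) * (1 + real L) * E L \<le> (1 + psi z) * (1 + real L) * B"
        using p EB[of L] by (intro mult_left_mono) auto
      then have "\<kappa> L \<le> (1 + psi z) * (1 + real L) * B" using up[of L] by linarith
      then have "\<kappa> L * \<delta> L \<le> ((1 + psi z) * (1 + real L) * B) * (C / a * ?r ^ L)"
        using \<delta>1[of L] \<delta>0[of L] \<kappa>0[of L] by (intro mult_mono) auto
      then show "\<kappa> L * \<delta> L \<le> ((1 + psi z) * B * C / a) * ((1 + real L) * ?r ^ L)"
        by (simp add: mult_ac)
    qed
  qed
  then have "(\<lambda>L. renorm (Suc L) z + \<kappa> L * \<delta> L) \<longlonglongrightarrow> psi z + 0"
    using renorm_lim[OF z] by (intro tendsto_add LIMSEQ_Suc) auto
  then have "(\<lambda>L. \<kappa> (Suc L) - \<kappa> L) \<longlonglongrightarrow> psi z" unfolding rec by (simp add: algebra_simps)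
  from cesaro_increments[OF this] show ?thesis by (simp add: \<kappa>_def mult.commute)
qed

text \<open>The fixed point 1 is repelling, so the diagonal does not decay. Together with the decay
  off the diagonal, this bound suffices to normalise the Gram matrix by its diagonal.\<close>

lemma ntk_diagonal:
  assumes K: "K 0 = 1" "\<And>L. K (Suc L) = (F ^^ Suc L) 1 + K L * F' ((F ^^ L) 1)"
  shows "1 \<le> K L"
proof (induction L)
  case (Suc L)
  then have "0 \<le> K L * b" using b by simp
  then show ?case by (simp only: K iter_one F'_1)
qed (simp add: K)

end

section \<open>The dual activation of the Bayes activation\<close>

text \<open>For even \<open>k\<close> this is the double factorial (k - 1)!!.\<close>

definition gauss_moment :: "nat \<Rightarrow> real" where
  "gauss_moment k = (if even k then fact k / (2 ^ (k div 2) * fact (k div 2)) else 0)"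

lemma std_normal_has_moment:
  "has_bochner_integral std_normal_distribution (\<lambda>x. x ^ k) (gauss_moment k)"
proof -
  have "has_bochner_integral lborel (\<lambda>x. std_normal_density x *\<^sub>R x ^ k) (gauss_moment k)"
    using std_normal_moment_even[of "k div 2"] std_normal_moment_odd[of "k div 2"]
    by (auto simp: gauss_moment_def elim!: evenE oddE)
  then show ?thesis by (subst has_bochner_integral_density) auto
qed

lemma std_normal_integrable_power [simp]: "integrable std_normal_distribution (\<lambda>x. x ^ k)"
  and std_normal_integral_power: "(\<integral>x. x ^ k \<partial>std_normal_distribution) = gauss_moment k"
  using std_normal_has_moment[of k]
  by (auto intro: integrable.intros dest: has_bochner_integral_integral_eq)

lemma gauss_moment_rec:
  "gauss_moment 0 = 1" "gauss_moment (Suc 0) = 0"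
  "gauss_moment (Suc (Suc k)) = (real k + 1) * gauss_moment k"
proof -
  show "gauss_moment (Suc (Suc k)) = (real k + 1) * gauss_moment k"
  proof (cases "even k")
    case True
    then obtain m where k: "k = 2 * m" by (elim evenE)
    have "gauss_moment (Suc (Suc k)) = ((2 * (real m + 1)) * ((real k + 1) * fact k)) / ((2 * (real m + 1)) * (2 ^ m * fact m))"
      by (simp add: gauss_moment_def k algebra_simps)
    also have "\<dots> = (real k + 1) * fact k / (2 ^ m * fact m)"
      by (rule mult_divide_mult_cancel_left) simp
    finally show ?thesis by (simp add: gauss_moment_def k)
  qed (simp add: gauss_moment_def)
qed (simp_all add: gauss_moment_def)

text \<open>The k-th moment of A + s G for a standard normal G. In the application A is the
  conditional mean z g and s the conditional standard deviation of the second Gaussian coordinate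
  given the first.\<close>

definition shifted_moment :: "real \<Rightarrow> real \<Rightarrow> nat \<Rightarrow> real" where
  "shifted_moment A s k = (\<Sum>j\<le>k. of_nat (k choose j) * A ^ (k - j) * s ^ j * gauss_moment j)"

lemma shifted_moment_unit: "shifted_moment 0 1 k = gauss_moment k"
proof -
  have "shifted_moment 0 1 k = (\<Sum>j\<le>k. if j = k then gauss_moment k else 0)"
    unfolding shifted_moment_def by (intro sum.cong) auto
  then show ?thesis by simp
qed

lemma affine_power: "(A + s * x) ^ k = (\<Sum>j\<le>k. of_nat (k choose j) * A ^ (k - j) * s ^ j * x ^ j)" for x :: real
  by (subst add.commute, subst binomial_ring) (simp add: power_mult_distrib mult_ac)

lemma std_normal_affine_power:
  "integrable std_normal_distribution (\<lambda>x. (A + s * x) ^ k)"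
  "(\<integral>x. (A + s * x) ^ k \<partial>std_normal_distribution) = shifted_moment A s k"
  unfolding affine_power by (auto simp: shifted_moment_def std_normal_integral_power)

lemma std_normal_affine_integrable_poly:
  "integrable std_normal_distribution (\<lambda>x. (A + s * x) ^ k * poly p (A + s * x))"
proof (induction p arbitrary: k)
  case (pCons c p)
  have "(\<lambda>x. (A + s * x) ^ k * poly (pCons c p) (A + s * x))
      = (\<lambda>x. c * (A + s * x) ^ k + (A + s * x) ^ Suc k * poly p (A + s * x))"
    by (auto simp: algebra_simps)
  then show ?case using pCons.IH[of "Suc k"] std_normal_affine_power(1)[of A s k]
    by (simp del: power_Suc)
qed simp

text \<open>The extra power \<open>k\<close> allows the coefficients to be peeled off one by one, in
  the manner of Horner's scheme: each removed coefficient raises \<open>k\<close> by one.\<close>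

definition affine_poly_moment :: "real \<Rightarrow> real \<Rightarrow> nat \<Rightarrow> real poly \<Rightarrow> real" where
  "affine_poly_moment A s k p = (\<integral>x. (A + s * x) ^ k * poly p (A + s * x) \<partial>std_normal_distribution)"

lemma affine_poly_moment_0: "affine_poly_moment A s k 0 = 0"
  by (simp add: affine_poly_moment_def)

lemma affine_poly_moment_pCons:
  "affine_poly_moment A s k (pCons c p) = c * shifted_moment A s k + affine_poly_moment A s (Suc k) p"
proof -
  have "(\<lambda>x. (A + s * x) ^ k * poly (pCons c p) (A + s * x))
      = (\<lambda>x. c * (A + s * x) ^ k + (A + s * x) ^ Suc k * poly p (A + s * x))"
    by (auto simp: algebra_simps)
  then show ?thesis
    using std_normal_affine_integrable_poly[of A s "Suc k" p] std_normal_affine_power[of A s k]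
    by (simp add: affine_poly_moment_def del: power_Suc)
qed

lemma std_normal_pair_integrable:
  "integrable (std_normal_distribution \<Otimes>\<^sub>M std_normal_distribution)
     (\<lambda>(g, h). poly p g * poly q (z * g + s * h))"
proof -
  let ?N = std_normal_distribution
  interpret N: prob_space ?N by (rule prob_space_normal_density) simp
  interpret P: pair_prob_space ?N ?N ..
  have mono: "integrable (?N \<Otimes>\<^sub>M ?N) (\<lambda>(g, h). g ^ i * h ^ j)" for i j
  proof (rule P.Fubini_integrable)
    have "integrable ?N (\<lambda>g. norm (g ^ i) * (\<integral>h. norm (h ^ j) \<partial>?N))"
      by (intro integrable_mult_left integrable_norm) simp
    then show "integrable ?N (\<lambda>g. \<integral>h. norm (case (g, h) of (g, h) \<Rightarrow> g ^ i * h ^ j) \<partial>?N)"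
      by (simp add: abs_mult)
  qed (auto simp: case_prod_beta intro!: AE_I2 integrable_mult_right)
  have "(\<lambda>(g, h). poly p g * poly q (z * g + s * h)) =
     (\<lambda>w. \<Sum>i\<le>degree p. \<Sum>j\<le>degree q. \<Sum>k\<le>j.
        (coeff p i * coeff q j * of_nat (j choose k) * z ^ (j - k) * s ^ k) *
          (case w of (g, h) \<Rightarrow> g ^ (i + (j - k)) * h ^ k))"
    unfolding poly_altdef sum_product
    by (auto simp: fun_eq_iff affine_power sum_distrib_left power_mult_distrib power_add mult_ac simp del: Nat.add_diff_assoc intro!: sum.cong)
  then show ?thesis using mono by (auto intro!: Bochner_Integration.integrable_sum integrable_mult_right)
qed

text \<open>Condition on the first coordinate: \<open>r\<close> is the conditional expectation of
  the activation at the second one. For the Hermite polynomial of degree k it is z^k times that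
  polynomial, so a dual activation has the squared coefficients in the normalised Hermite basis as
  its power series coefficients.\<close>

lemma dual_act_poly:
  assumes z: "z \<in> {-1..1}" and \<phi>: "\<And>x. \<phi> x = poly p x"
    and inner: "\<And>g. affine_poly_moment (z * g) (sqrt (1 - z\<^sup>2)) 0 p = poly r g"
  shows "dual_act \<phi> z = affine_poly_moment 0 1 0 (p * r)"
proof -
  let ?N = std_normal_distribution
  interpret N: prob_space ?N by (rule prob_space_normal_density) simp
  interpret P: pair_prob_space ?N ?N ..
  let ?s = "sqrt (1 - z\<^sup>2)"
  have [measurable]: "poly p \<in> borel_measurable borel"
    by (intro borel_measurable_continuous_onI continuous_intros)
  have "dual_act \<phi> z = (\<integral>(g, h). poly p g * poly p (z * g + ?s * h) \<partial>(?N \<Otimes>\<^sub>M ?N))"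
    unfolding dual_act_def gauss_pair_def \<phi> by (subst integral_distr) (auto intro!: Bochner_Integration.integral_cong)
  also have "\<dots> = (\<integral>g. (\<integral>h. poly p g * poly p (z * g + ?s * h) \<partial>?N) \<partial>?N)"
    using P.integral_fst'[OF std_normal_pair_integrable[of p p z ?s]] by simp
  also have "\<dots> = (\<integral>g. poly p g * poly r g \<partial>?N)" using inner by (simp add: affine_poly_moment_def)
  finally show ?thesis by (simp add: affine_poly_moment_def)
qed

text \<open>Odd Gaussian moments vanish, so only even powers of \<open>s\<close> survive and the
  square root in \<open>gauss_pair\<close> disappears in favour of t = 1 - z^2.\<close>

lemma shifted_moments:
  assumes "s\<^sup>2 = t"
  shows "shifted_moment A s 0 = 1" "shifted_moment A s (Suc 0) = A"
    "shifted_moment A s (Suc (Suc 0)) = A\<^sup>2 + t"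
    "shifted_moment A s (Suc (Suc (Suc 0))) = A ^ 3 + 3 * A * t"
    "shifted_moment A s (Suc (Suc (Suc (Suc (Suc 0))))) = A ^ 5 + 10 * A ^ 3 * t + 15 * A * t\<^sup>2"
    "shifted_moment A s (Suc (Suc (Suc (Suc (Suc (Suc (Suc 0))))))) = A ^ 7 + 21 * A ^ 5 * t + 105 * A ^ 3 * t\<^sup>2 + 105 * A * t ^ 3"
  unfolding assms[symmetric]
  by (simp_all add: shifted_moment_def gauss_moment_rec atMost_Suc eval_nat_numeral algebra_simps)

section \<open>Closed forms of the two dual activations\<close>

lemma dual_act_bayes_one:
  assumes z: "z \<in> {-1..1}"
  shows "dual_act (bayes_act 1) z = (z ^ 7 + z) / 2"
proof -
  define \<alpha> \<beta> where "\<alpha> = 1 / (12 * sqrt 70)" and "\<beta> = 1 / sqrt 2"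
  define t where "t = 1 - z\<^sup>2"
  \<comment> \<open>The coefficients of \<alpha> h_7 + \<beta> h_1. In \<open>?r\<close> the h_7
    part carries the factor z^7 and the h_1 part the factor z.\<close>
  let ?p = "[:0, \<beta> - 105 * \<alpha>, 0, 105 * \<alpha>, 0, - 21 * \<alpha>, 0, \<alpha>:]"
  let ?r = "[:0, \<beta> * z - 105 * \<alpha> * z ^ 7, 0, 105 * \<alpha> * z ^ 7, 0, - 21 * \<alpha> * z ^ 7, 0, \<alpha> * z ^ 7:]"
  have t: "(sqrt (1 - z\<^sup>2))\<^sup>2 = t"
    using z unfolding t_def by (simp add: abs_square_le_1 abs_le_iff)
  have "dual_act (bayes_act 1) z = affine_poly_moment 0 1 0 (?p * ?r)"
  proof (rule dual_act_poly[OF z])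
    show "bayes_act 1 x = poly ?p x" for x
      by (simp add: bayes_act_def hermite7_def \<alpha>_def[symmetric] \<beta>_def[symmetric] eval_nat_numeral algebra_simps)
  next
    fix g
    have "affine_poly_moment (z * g) (sqrt (1 - z\<^sup>2)) 0 ?p = (\<beta> - 105 * \<alpha>) * (z * g) + 105 * \<alpha> * ((z * g) ^ 3 + 3 * (z * g) * t)
        - 21 * \<alpha> * ((z * g) ^ 5 + 10 * (z * g) ^ 3 * t + 15 * (z * g) * t\<^sup>2)
        + \<alpha> * ((z * g) ^ 7 + 21 * (z * g) ^ 5 * t + 105 * (z * g) ^ 3 * t\<^sup>2 + 105 * (z * g) * t ^ 3)"
      by (simp add: affine_poly_moment_pCons affine_poly_moment_0 shifted_moments[OF t])
    also have "\<dots> = poly ?r g"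
      unfolding t_def by (simp add: eval_nat_numeral algebra_simps)
    finally show "affine_poly_moment (z * g) (sqrt (1 - z\<^sup>2)) 0 ?p = poly ?r g" .
  qed
  \<comment> \<open>5040 = 7! is the squared Gaussian norm of h_7. Since 12 sqrt 70 is the square
    root of 2 * 7!, both Hermite components end up with weight 1 / 2.\<close>
  also have "\<dots> = 5040 * \<alpha>\<^sup>2 * z ^ 7 + \<beta>\<^sup>2 * z"
    by (simp add: affine_poly_moment_pCons affine_poly_moment_0 shifted_moment_unit gauss_moment_rec power2_eq_square algebra_simps)
  also have "\<dots> = (z ^ 7 + z) / 2"
    by (simp add: \<alpha>_def \<beta>_def power_divide power_mult_distrib)
  finally show ?thesis .
qed

lemma dual_act_bayes_ge_two:
  assumes z: "z \<in> {-1..1}" and d: "2 \<le> d" and a: "a = 1 / 2 powr (real d / 2)"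
  shows "dual_act (bayes_act d) z = a * z ^ 3 + (1 - 2 * a) * z\<^sup>2 + a * z"
proof -
  define \<alpha> \<beta> \<delta> where "\<alpha> = 1 / 2 powr (real d / 4) / sqrt 6" and "\<beta> = sqrt (1 - 2 / 2 powr (real d / 2)) / sqrt 2"
    and "\<delta> = 1 / 2 powr (real d / 4)"
  define t where "t = 1 - z\<^sup>2"
  have dd: "(2 powr (real d / 4))\<^sup>2 = 2 powr (real d / 2)"
    by (simp add: powr_add[symmetric] power2_eq_square)
  \<comment> \<open>This is where d >= 2 enters: the coefficient 1 - 2 a under the square root is
    non-negative, and it is 0 for d = 2.\<close>
  have "2 powr 1 \<le> 2 powr (real d / 2)" using d by (intro powr_mono) auto
  then have a2: "2 * a \<le> 1" by (simp add: a field_simps)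
  \<comment> \<open>6 = 3! and 2 = 2! are the squared Gaussian norms of h_3 and h_2.\<close>
  have coeffs: "6 * \<alpha>\<^sup>2 = a" "2 * \<beta>\<^sup>2 = 1 - 2 * a" "\<delta>\<^sup>2 = a"
    using a2 dd by (auto simp: \<alpha>_def \<beta>_def \<delta>_def power_divide power_mult_distrib a)
  let ?p = "[:- \<beta>, \<delta> - 3 * \<alpha>, \<beta>, \<alpha>:]"
  let ?r = "[:- \<beta> * z\<^sup>2, \<delta> * z - 3 * \<alpha> * z ^ 3, \<beta> * z\<^sup>2, \<alpha> * z ^ 3:]"
  have t: "(sqrt (1 - z\<^sup>2))\<^sup>2 = t"
    using z unfolding t_def by (simp add: abs_square_le_1 abs_le_iff)
  have "dual_act (bayes_act d) z = affine_poly_moment 0 1 0 (?p * ?r)"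
  proof (rule dual_act_poly[OF z])
    fix x
    have "bayes_act d x = \<alpha> * (x ^ 3 - 3 * x) + \<beta> * (x\<^sup>2 - 1) + \<delta> * x"
      using d by (simp add: bayes_act_def \<alpha>_def \<beta>_def \<delta>_def)
    then show "bayes_act d x = poly ?p x"
      by (simp add: eval_nat_numeral algebra_simps)
  next
    fix g
    have "affine_poly_moment (z * g) (sqrt (1 - z\<^sup>2)) 0 ?p = - \<beta> + (\<delta> - 3 * \<alpha>) * (z * g) + \<beta> * ((z * g)\<^sup>2 + t) + \<alpha> * ((z * g) ^ 3 + 3 * (z * g) * t)"
      by (simp add: affine_poly_moment_pCons affine_poly_moment_0 shifted_moments[OF t])
    also have "\<dots> = poly ?r g"
      unfolding t_def by (simp add: eval_nat_numeral algebra_simps)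
    finally show "affine_poly_moment (z * g) (sqrt (1 - z\<^sup>2)) 0 ?p = poly ?r g" .
  qed
  also have "\<dots> = 6 * \<alpha>\<^sup>2 * z ^ 3 + 2 * \<beta>\<^sup>2 * z\<^sup>2 + \<delta>\<^sup>2 * z"
    by (simp add: affine_poly_moment_pCons affine_poly_moment_0 shifted_moment_unit gauss_moment_rec power2_eq_square algebra_simps)
  finally show ?thesis unfolding coeffs .
qed

section \<open>The polynomials satisfy the depth-map conditions\<close>

lemma dual_act_deriv_eq:
  assumes "\<And>z. z \<in> {-1..1} \<Longrightarrow> dual_act \<phi> z = F z" and "(F has_real_derivative D) (at z)" and "z \<in> {-1..1}"
  shows "dual_act_deriv \<phi> z = D"
proof -
  have "(F has_vector_derivative D) (at z within {-1..1})"
    using assms(2) by (simp add: has_real_derivative_iff_has_vector_derivative has_vector_derivative_at_within)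
  then have "(dual_act \<phi> has_vector_derivative D) (at z within {-1..1})"
    by (rule has_vector_derivative_transform[OF assms(3), rotated -1]) (use assms in auto)
  then show ?thesis unfolding dual_act_deriv_def
    using assms(3) by (intro vector_derivative_within_cbox[of "-1" 1, unfolded cbox_interval]) auto
qed

text \<open>\<open>\<Phi>\<close> is 1 / z^2 - 1 and \<open>\<theta>\<close> = 3 its value at 1 / 2.
  The expansion by 4 is tight to first order at 1, so the inequality to be shown has a double zero
  there.\<close>

lemma depth_map_bayes_one:
  "depth_map (\<lambda>z. (z ^ 7 + z) / 2) (\<lambda>z. (z ^ 6 + 1) / 2) (\<lambda>z. (7 * z ^ 6 + 1) / 2)
     (\<lambda>z. (1 - z\<^sup>2) / z\<^sup>2) (1 / 2) 4 (1 / 2) 4 3"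
proof
  show "(4::real) powr (1 / 2) = 1 / (1 / 2)" by (simp add: powr_half_sqrt)
  show "(z ^ 7 + z) / 2 = z * ((z ^ 6 + 1) / 2)" for z :: real
    by (simp add: eval_nat_numeral algebra_simps)
  show "(x ^ 6 + 1) / 2 \<le> (y ^ 6 + 1) / (2::real)" if "0 \<le> x" "x \<le> y" for x y :: real
    using power_mono[OF that(2,1), of 6] by simp
  show "(z ^ 6 + 1) / 2 < (1::real)" if "0 \<le> z" "z < 1" for z :: real
    using that power_Suc_less_one[of z 5] by (cases "z = 0") (auto simp: eval_nat_numeral)
  have p6: "z ^ 6 \<le> z" if "0 \<le> z" "z \<le> 1" for z :: real
    using that power_decreasing[of 1 6 z] by simp
  show "(z ^ 6 + 1) / 2 \<le> 1 / 2 + 4 * z" if "0 \<le> z" "z \<le> 1" for z :: real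
    using p6[OF that] that by simp
  show "(7 * z ^ 6 + 1) / 2 \<le> 1 / 2 + 4 * z" if "0 \<le> z" "z \<le> 1" for z :: real
    using p6[OF that] that by simp
  show "1 - 4 * (1 - z) \<le> (z ^ 7 + z) / 2" if "0 \<le> z" "z \<le> 1" for z :: real
  proof -
    have "1 + real 7 * (z - 1) \<le> (1 + (z - 1)) ^ 7" using that by (intro Bernoulli_inequality) auto
    then show ?thesis by simp
  qed
  show "1 - z \<le> (1 - z\<^sup>2) / z\<^sup>2" if "0 < z" "z < 1" for z :: real
  proof -
    have "(1 - z) * z\<^sup>2 \<le> (1 - z) * 1" using that by (intro mult_left_mono) (auto simp: power_le_one)
    also have "\<dots> \<le> (1 - z) * (1 + z)" using that by (intro mult_left_mono) auto
    finally have "(1 - z) * z\<^sup>2 \<le> 1 - z\<^sup>2" by (simp add: power2_eq_square algebra_simps)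
    then show ?thesis using that by (subst pos_le_divide_eq) auto
  qed
  show "4 * ((1 - z\<^sup>2) / z\<^sup>2) \<le> (1 - ((z ^ 7 + z) / 2)\<^sup>2) / ((z ^ 7 + z) / 2)\<^sup>2" if z: "0 < z" "z < 1" for z :: real
  proof -
    define s where "s = z\<^sup>2"
    have s: "0 < s" using z by (simp add: s_def)
    have z6: "z ^ 6 = s ^ 3" unfolding s_def by (simp flip: power_mult)
    have F: "(z ^ 7 + z) / 2 = z * (1 + s ^ 3) / 2"
      unfolding z6[symmetric] by (simp add: eval_nat_numeral algebra_simps)
    have F2: "((z ^ 7 + z) / 2)\<^sup>2 = s * (1 + s ^ 3)\<^sup>2 / 4"
      unfolding F power_divide power_mult_distrib s_def by simp
    \<comment> \<open>In s = z^2 the claim becomes polynomial. The square (1 - s)^2 is the expected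
      double zero, and the cofactor has positive coefficients.\<close>
    have "0 \<le> s / 4 * (1 - s)\<^sup>2 * (3 + 6 * s + s\<^sup>2 + 2 * s ^ 3 + 3 * s ^ 4)"
      using s by (intro mult_nonneg_nonneg add_nonneg_nonneg) auto
    also have "\<dots> = 1 - (1 + s ^ 3)\<^sup>2 * (1 - 3 * s / 4)"
      by (simp add: eval_nat_numeral field_simps)
    finally have key: "(1 + s ^ 3)\<^sup>2 * (1 - 3 * s / 4) \<le> 1" by simp
    define u where "u = (1 + s ^ 3)\<^sup>2"
    have "0 < 1 + s ^ 3" using s by (intro add_pos_pos) auto
    then have u: "0 < u" by (simp add: u_def)
    have "u * (4 * (1 - s)) \<le> 4 - s * u"
      using key by (simp add: u_def[symmetric] algebra_simps)
    then have "4 * (1 - s) / s \<le> (4 - s * u) / (s * u)"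
      using s u by (simp add: divide_simps mult_ac)
    also have "\<dots> = (1 - s * u / 4) / (s * u / 4)" using s u by (simp add: field_simps)
    finally show ?thesis by (simp add: F2 u_def s_def)
  qed
  show "z \<le> 1 / 2" if "0 < z" "3 \<le> (1 - z\<^sup>2) / z\<^sup>2" for z :: real
  proof -
    have "3 * z\<^sup>2 \<le> 1 - z\<^sup>2" using that by (simp add: pos_le_divide_eq)
    then have "z\<^sup>2 \<le> (1 / 2)\<^sup>2" by (simp add: power2_eq_square)
    then show ?thesis by (rule power2_le_imp_le) simp
  qed
qed (auto intro!: continuous_intros)

text \<open>Here 1 / z - 1 serves as the expanding coordinate, and its value at 1 / 2 is
  \<open>\<theta>\<close> = 1. Both the tangent inequality and the expansion by 2 reduce to (1 -
  z)^2 times a non-negative factor.\<close>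

lemma depth_map_bayes_ge_two:
  assumes d: "2 \<le> d" and a_def: "a = 1 / 2 powr (real d / 2)"
  shows "depth_map (\<lambda>z. a * z ^ 3 + (1 - 2 * a) * z\<^sup>2 + a * z) (\<lambda>z. a * z\<^sup>2 + (1 - 2 * a) * z + a)
     (\<lambda>z. 3 * a * z\<^sup>2 + 2 * (1 - 2 * a) * z + a) (\<lambda>z. (1 - z) / z) a 2 (real d / 2) 4 1"
proof -
  have "2 powr 1 \<le> 2 powr (real d / 2)" using d by (intro powr_mono) auto
  then have a: "0 < a" "2 * a \<le> 1" by (auto simp: a_def field_simps)
  have z2: "z\<^sup>2 \<le> z" if "0 \<le> z" "z \<le> 1" for z :: real
    using that power_decreasing[of 1 2 z] by simp
  have q_eq: "1 - (a * z\<^sup>2 + (1 - 2 * a) * z + a) = (1 - z) * (1 - a * (1 - z))" for z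
    by (simp add: power2_eq_square algebra_simps)
  show ?thesis
  proof
    show "0 < a" "a < 1" "(2::real) powr (real d / 2) = 1 / a" "0 < real d / 2" using a d by (auto simp: a_def)
    show "a * z ^ 3 + (1 - 2 * a) * z\<^sup>2 + a * z = z * (a * z\<^sup>2 + (1 - 2 * a) * z + a)" for z
      by (simp add: eval_nat_numeral algebra_simps)
    show "a * x\<^sup>2 + (1 - 2 * a) * x + a \<le> a * y\<^sup>2 + (1 - 2 * a) * y + a" if "0 \<le> x" "x \<le> y" for x y
      using a that by (intro add_mono mult_left_mono power_mono) auto
    show "a * z\<^sup>2 + (1 - 2 * a) * z + a < 1" if "0 \<le> z" "z < 1" for z
    proof -
      have "a * (1 - z) \<le> a * 1" using a that by (intro mult_left_mono) auto
      then have "a * (1 - z) < 1" using a by linarith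
      then have "0 < (1 - z) * (1 - a * (1 - z))" using that by (intro mult_pos_pos) auto
      then show ?thesis using q_eq[of z] by linarith
    qed
    show "a * z\<^sup>2 + (1 - 2 * a) * z + a \<le> a + 4 * z" if "0 \<le> z" "z \<le> 1" for z
    proof -
      have "a * z\<^sup>2 \<le> 1 * z" "(1 - 2 * a) * z \<le> 1 * z" using a that z2[OF that] by (intro mult_mono; simp)+
      then show ?thesis using that by simp
    qed
    show "a \<le> 3 * a * z\<^sup>2 + 2 * (1 - 2 * a) * z + a" if "0 \<le> z" for z using a that by simp
    show "3 * a * z\<^sup>2 + 2 * (1 - 2 * a) * z + a \<le> a + 4 * z" if "0 \<le> z" "z \<le> 1" for z
    proof -
      have "(3 * a) * z\<^sup>2 \<le> 2 * z" "(2 * (1 - 2 * a)) * z \<le> 2 * z"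
        using a that z2[OF that] by (intro mult_mono; simp)+
      then show ?thesis by simp
    qed
    show "1 - 2 * (1 - z) \<le> a * z ^ 3 + (1 - 2 * a) * z\<^sup>2 + a * z" if "0 \<le> z" "z \<le> 1" for z
    proof -
      have "0 \<le> (1 - z)\<^sup>2 * (1 + a * z)" using a that by simp
      moreover have "a * z ^ 3 + (1 - 2 * a) * z\<^sup>2 + a * z - (1 - 2 * (1 - z)) = (1 - z)\<^sup>2 * (1 + a * z)"
        by (simp add: eval_nat_numeral algebra_simps)
      ultimately show ?thesis by linarith
    qed
    show "1 - z \<le> (1 - z) / z" if "0 < z" "z < 1" for z :: real
      using that by (simp add: pos_le_divide_eq mult_le_cancel_left2)
    show "2 * ((1 - z) / z) \<le> (1 - (a * z ^ 3 + (1 - 2 * a) * z\<^sup>2 + a * z)) / (a * z ^ 3 + (1 - 2 * a) * z\<^sup>2 + a * z)"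
      if z: "0 < z" "z < 1" for z
    proof -
      define Q where "Q = a * z\<^sup>2 + (1 - 2 * a) * z + a"
      have F: "a * z ^ 3 + (1 - 2 * a) * z\<^sup>2 + a * z = z * Q"
        by (simp add: Q_def eval_nat_numeral algebra_simps)
      have Q: "0 < Q" unfolding Q_def using a z by (intro add_nonneg_pos) auto
      \<comment> \<open>Again a double zero at 1; non-negativity of the cofactor rests on 2 a <=
        1.\<close>
      have "0 \<le> (1 - z)\<^sup>2 * (1 - 2 * a + a * z)" using a z by (intro mult_nonneg_nonneg) auto
      moreover have "(1 - z * Q) - 2 * Q * (1 - z) = (1 - z)\<^sup>2 * (1 - 2 * a + a * z)"
        by (simp add: Q_def power2_eq_square algebra_simps)
      ultimately have "2 * Q * (1 - z) \<le> 1 - z * Q" by linarith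
      then have "2 * (1 - z) / z \<le> (1 - z * Q) / (z * Q)"
        using z Q by (simp add: divide_simps mult_ac)
      then show ?thesis by (simp add: F)
    qed
    show "z \<le> 1 / 2" if "0 < z" "1 \<le> (1 - z) / z" for z :: real
      using that by (simp add: pos_le_divide_eq)
  qed (auto intro!: continuous_intros)
qed

lemma bayes_depth_map:
  assumes "1 \<le> d"
  obtains F q F' \<Phi> a b C \<theta> where "depth_map F q F' \<Phi> a b (real d / 2) C \<theta>"
    "\<And>z. z \<in> {-1..1} \<Longrightarrow> dual_act (bayes_act d) z = F z"
    "\<And>z. z \<in> {-1..1} \<Longrightarrow> dual_act_deriv (bayes_act d) z = F' z"
    "F \<in> borel_measurable borel" "F' \<in> borel_measurable borel"
proof (cases "d = 1")
  case True
  show ?thesis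
  proof (rule that)
    show "depth_map (\<lambda>z. (z ^ 7 + z) / 2) (\<lambda>z. (z ^ 6 + 1) / 2) (\<lambda>z. (7 * z ^ 6 + 1) / 2)
     (\<lambda>z. (1 - z\<^sup>2) / z\<^sup>2) (1 / 2) 4 (real d / 2) 4 3" using depth_map_bayes_one True by simp
    show e: "dual_act (bayes_act d) z = (z ^ 7 + z) / 2" if "z \<in> {-1..1}" for z
      using dual_act_bayes_one[OF that] True by simp
    show "dual_act_deriv (bayes_act d) z = (7 * z ^ 6 + 1) / 2" if "z \<in> {-1..1}" for z
      by (rule dual_act_deriv_eq[OF e _ that]) (auto intro!: derivative_eq_intros)
  qed measurable
next
  case False
  then have d: "2 \<le> d" using assms by simp
  define a where "a = 1 / 2 powr (real d / 2)"
  show ?thesis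
  proof (rule that)
    show "depth_map (\<lambda>z. a * z ^ 3 + (1 - 2 * a) * z\<^sup>2 + a * z) (\<lambda>z. a * z\<^sup>2 + (1 - 2 * a) * z + a)
     (\<lambda>z. 3 * a * z\<^sup>2 + 2 * (1 - 2 * a) * z + a) (\<lambda>z. (1 - z) / z) a 2 (real d / 2) 4 1"
      by (rule depth_map_bayes_ge_two[OF d a_def])
    show e: "dual_act (bayes_act d) z = a * z ^ 3 + (1 - 2 * a) * z\<^sup>2 + a * z" if "z \<in> {-1..1}" for z
      by (rule dual_act_bayes_ge_two[OF that d a_def])
    show "dual_act_deriv (bayes_act d) z = 3 * a * z\<^sup>2 + 2 * (1 - 2 * a) * z + a" if "z \<in> {-1..1}" for z
      by (rule dual_act_deriv_eq[OF e _ that]) (auto intro!: derivative_eq_intros)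
  qed measurable
qed

section \<open>Lebesgue points\<close>

lemma set_integrable_lborel_const:
  fixes c :: real
  assumes "A \<in> sets borel" "emeasure lborel A < \<infinity>"
  shows "set_integrable lborel A (\<lambda>_. c)"
  unfolding set_integrable_def using assms by (auto simp: integrable_mult_left_iff)

lemma set_integral_subset_mono:
  fixes f :: "'a::euclidean_space \<Rightarrow> real"
  assumes f: "set_integrable lborel B f" and A: "A \<in> sets borel" "A \<subseteq> B" and pos: "\<And>x. 0 \<le> f x"
  shows "(\<integral>x\<in>A. f x \<partial>lborel) \<le> (\<integral>x\<in>B. f x \<partial>lborel)"
  unfolding set_lebesgue_integral_def
proof (rule integral_mono)
  show "integrable lborel (\<lambda>x. indicat_real A x *\<^sub>R f x)"
    using set_integrable_subset[OF f _ A(2)] A(1) by (simp add: set_integrable_def)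
  show "integrable lborel (\<lambda>x. indicat_real B x *\<^sub>R f x)"
    using f by (simp add: set_integrable_def)
qed (use A pos in \<open>auto simp: indicator_def\<close>)

text \<open>A Vitali argument without maximal functions. Balls on which the average of
  \<open>k\<close> exceeds \<open>p'\<close> cover the exceptional set inside an open U that adds
  little \<open>k\<close>-mass to {k <= p}. For the disjoint union V of the chosen balls this gives
  p' |V| <= p |V| + d, so |V| is small.\<close>

lemma negligible_large_ball_averages:
  fixes k :: "'a::euclidean_space \<Rightarrow> real"
  assumes k: "integrable lborel k" "\<And>v. 0 \<le> k v" and p: "0 \<le> p" "p < p'"
  shows "negligible {v. k v \<le> p \<and> (\<forall>r0>0. \<exists>r>0. r < r0 \<and>
           p' * measure lborel (ball v r) < (\<integral>u\<in>ball v r. k u \<partial>lborel))}" (is "negligible ?E")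
proof -
  define M where "M = density lborel (\<lambda>v. ennreal (k v))"
  have km[measurable]: "k \<in> borel_measurable borel" using k by auto
  have setsM: "sets M = sets borel" unfolding M_def by simp
  have Mval: "emeasure M A = ennreal (\<integral>u\<in>A. k u \<partial>lborel)" if "A \<in> sets borel" for A
  proof -
    have "emeasure M A = (\<integral>\<^sup>+u. ennreal (indicator A u * k u) \<partial>lborel)"
      unfolding M_def using that
      by (subst emeasure_density) (auto intro!: nn_integral_cong simp: indicator_def split: if_splits)
    also have "\<dots> = ennreal (\<integral>u. indicator A u * k u \<partial>lborel)"
      using that k by (intro nn_integral_eq_integral integrable_mult_indicator[where 'b = real, simplified] AE_I2) auto
    finally show ?thesis by (simp add: set_lebesgue_integral_def)
  qed
  interpret M: finite_measure M
    by (rule finite_measureI) (simp add: Mval setsM[THEN sets_eq_imp_space_eq])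
  define G where "G = {v. k v \<le> p}"
  have G: "G \<in> sets borel" unfolding G_def by measurable
  show ?thesis
    unfolding negligible_outer
  proof (intro allI impI)
    fix e :: real assume e: "0 < e"
    define d where "d = e * (p' - p) / 2"
    have d: "0 < d" using e p by (simp add: d_def)
    \<comment> \<open>Outer regularity is applied to \<open>M\<close>, the measure with density
      \<open>k\<close>, because the excess over {k <= p} must be small in \<open>k\<close>-mass and
      not merely in volume.\<close>
    have "emeasure M G = (INF U\<in>{U. G \<subseteq> U \<and> open U}. emeasure M U)"
      by (rule outer_regular[OF setsM]) (use G M.emeasure_finite in auto)
    moreover have "emeasure M G < emeasure M G + ennreal d"
      using d M.emeasure_finite[of G] by (simp add: ennreal_less_top less_top[symmetric])
    ultimately obtain U where U: "G \<subseteq> U" "open U" "emeasure M U < emeasure M G + ennreal d"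
      by (auto simp: INF_less_iff)
    have "emeasure M (U - G) \<le> ennreal d"
    proof -
      have "emeasure M (U - G) = emeasure M U - emeasure M G"
        using U G setsM M.emeasure_finite by (intro emeasure_Diff) auto
      then show ?thesis using U(3) by (metis add.commute ennreal_minus_le_iff less_imp_le M.emeasure_finite)
    qed
    then have UG: "(\<integral>u\<in>(U - G). k u \<partial>lborel) \<le> d"
      using U G d by (subst (asm) Mval) auto
    let ?K = "{(v, r). 0 < r \<and> ball v r \<subseteq> U \<and> p' * measure lborel (ball v r) < (\<integral>u\<in>ball v r. k u \<partial>lborel)}"
    have cover: "\<exists>i. i \<in> ?K \<and> v \<in> ball (fst i) (snd i) \<and> snd i < s" if vE: "v \<in> ?E" and s0: "0 < s" for v s
    proof -
      have "v \<in> U" using that U by (auto simp: G_def)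
      then obtain t where t: "t > 0" "ball v t \<subseteq> U" using U open_contains_ball by blast
      obtain r where r: "0 < r" "r < min s t" "p' * measure lborel (ball v r) < (\<integral>u\<in>ball v r. k u \<partial>lborel)"
        using vE[unfolded mem_Collect_eq, THEN conjunct2, rule_format, of "min s t"] s0 t(1) by auto
      moreover have "ball v r \<subseteq> U" using t r by (auto simp: subset_iff)
      ultimately show ?thesis using that by (intro exI[of _ "(v, r)"]) auto
    qed
    obtain I where I: "countable I" "I \<subseteq> ?K"
      "pairwise (\<lambda>i j. disjnt (ball (fst i) (snd i)) (ball (fst j) (snd j))) I"
      "negligible (?E - (\<Union>i\<in>I. ball (fst i) (snd i)))"
      by (rule Vitali_covering_theorem_balls[of ?E ?K fst snd, OF cover])
    define B where "B i = ball (fst i) (snd i)" for i :: "'a \<times> real"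
    define V where "V = (\<Union>i\<in>I. B i)"
    have Bb: "B i \<in> sets borel" for i by (simp add: B_def)
    have V: "V \<in> sets borel" "V \<subseteq> U" using I(2) unfolding V_def B_def by (auto 0 4 intro!: borel_open simp: subset_iff)
    have disj: "disjoint_family_on B I"
      using I(3) by (auto simp: disjoint_family_on_def pairwise_def disjnt_def B_def)
    have eV: "ennreal p' * emeasure lborel V \<le> emeasure M V"
    proof -
      have "emeasure lborel V = (\<integral>\<^sup>+i. emeasure lborel (B i) \<partial>count_space I)"
        unfolding V_def using disj I(1) Bb by (intro emeasure_UN_countable) auto
      then have "ennreal p' * emeasure lborel V = (\<integral>\<^sup>+i. ennreal p' * emeasure lborel (B i) \<partial>count_space I)"
        by (simp add: nn_integral_cmult)
      also have "\<dots> \<le> (\<integral>\<^sup>+i. emeasure M (B i) \<partial>count_space I)"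
      proof (intro nn_integral_mono)
        fix i assume "i \<in> space (count_space I)"
        then have "i \<in> ?K" using I by auto
        then have "p' * measure lborel (B i) \<le> (\<integral>u\<in>B i. k u \<partial>lborel)" by (auto simp: B_def)
        then have "ennreal (p' * measure lborel (B i)) \<le> emeasure M (B i)"
          by (subst Mval) (auto simp: B_def ennreal_leI)
        then show "ennreal p' * emeasure lborel (B i) \<le> emeasure M (B i)"
          using p emeasure_lborel_ball_finite[of "fst i" "snd i"]
          by (subst emeasure_eq_ennreal_measure) (auto simp: B_def ennreal_mult)
      qed
      also have "\<dots> = emeasure M V"
        unfolding V_def using disj I(1) setsM Bb by (intro emeasure_UN_countable[symmetric]) auto
      finally show ?thesis .
    qed
    \<comment> \<open>The total mass of \<open>M\<close> is finite and \<open>p'\<close> > 0, so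
      \<open>eV\<close> bounds the volume of the covering.\<close>
    have fin: "emeasure lborel V < \<infinity>"
    proof (rule ccontr)
      assume "\<not> emeasure lborel V < \<infinity>"
      then have "emeasure lborel V = \<infinity>" by (simp add: less_top[symmetric])
      then have "emeasure M V = \<infinity>" using eV p by (simp add: ennreal_mult_top top_unique)
      then show False using M.emeasure_finite by auto
    qed
    have finG: "emeasure lborel (V \<inter> G) < \<infinity>"
      using le_less_trans[OF emeasure_mono[of "V \<inter> G" V lborel] fin] V by simp
    have rV: "p' * measure lborel V \<le> (\<integral>u\<in>V. k u \<partial>lborel)"
    proof -
      have "ennreal (p' * measure lborel V) = ennreal p' * emeasure lborel V"
        using fin p by (simp add: emeasure_eq_ennreal_measure less_top ennreal_mult)
      also have "\<dots> \<le> ennreal (\<integral>u\<in>V. k u \<partial>lborel)" using eV Mval V by simp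
      moreover have "0 \<le> (\<integral>u\<in>V. k u \<partial>lborel)"
        unfolding set_lebesgue_integral_def using k by (intro integral_nonneg_AE) auto
      ultimately show ?thesis by (metis ennreal_le_iff)
    qed
    have si: "set_integrable lborel A k" if "A \<in> sets borel" for A
      unfolding set_integrable_def using that k by (intro integrable_mult_indicator) auto
    have "(\<integral>u\<in>V. k u \<partial>lborel) = (\<integral>u\<in>(V \<inter> G). k u \<partial>lborel) + (\<integral>u\<in>(V - G). k u \<partial>lborel)"
    proof -
      have "V = (V \<inter> G) \<union> (V - G)" by auto
      then show ?thesis using V G by (metis (no_types, lifting) set_integral_Un si Diff_disjoint Int_Diff inf.commute inf_assoc inf_bot_right sets.Diff sets.Int Diff_Int_distrib Int_commute)
    qed
    also have "(\<integral>u\<in>(V \<inter> G). k u \<partial>lborel) \<le> (\<integral>u\<in>(V \<inter> G). p \<partial>lborel)"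
    proof (rule set_integral_mono)
      show "set_integrable lborel (V \<inter> G) (\<lambda>u. p)"
        using V G finG by (intro set_integrable_lborel_const) auto
    qed (use V G si in \<open>auto simp: G_def\<close>)
    also have "(\<integral>u\<in>(V \<inter> G). p \<partial>lborel) = measure lborel (V \<inter> G) * p"
      using V G finG by (subst set_integral_const) auto
    also have "\<dots> \<le> measure lborel V * p"
      using V G fin p by (intro mult_right_mono measure_mono_fmeasurable) (auto simp: fmeasurable_def)
    also have "(\<integral>u\<in>(V - G). k u \<partial>lborel) \<le> (\<integral>u\<in>(U - G). k u \<partial>lborel)"
      using V U G k by (intro set_integral_subset_mono si) auto
    also have "\<dots> \<le> d" by (rule UG)
    finally have "p' * measure lborel V \<le> measure lborel V * p + d" using rV by simp
    then have "measure lborel V * (p' - p) \<le> d" by (simp add: algebra_simps)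
    then have "measure lborel V \<le> d / (p' - p)" using p by (subst pos_le_divide_eq) auto
    also have "\<dots> = e / 2" using p unfolding d_def by (subst divide_divide_eq_left, subst mult.commute[of 2], subst divide_divide_eq_left[symmetric]) simp
    finally have "measure lborel V \<le> e / 2" .
    then have mV: "measure lebesgue V < e" using e V by (simp add: measure_completion)
    have neg: "negligible (?E - V)" using I(4) by (simp add: V_def B_def)
    have Vl: "V \<in> lmeasurable" using V fin by (auto simp: fmeasurable_def)
    moreover have N: "?E - V \<in> lmeasurable" "measure lebesgue (?E - V) = 0"
      using neg negligible_iff_measure by auto
    ultimately have Wl: "V \<union> (?E - V) \<in> lmeasurable" by (intro fmeasurable.Un)
    have mW: "measure lebesgue (V \<union> (?E - V)) \<le> measure lebesgue V"
      using measure_Un_le[OF fmeasurableD[OF Vl] fmeasurableD[OF N(1)]] N(2) by simp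
    show "\<exists>T. ?E \<subseteq> T \<and> T \<in> lmeasurable \<and> measure lebesgue T < e"
      by (rule exI[of _ "V \<union> (?E - V)"]) (intro conjI Wl le_less_trans[OF mW mV]; blast)
  qed
qed

text \<open>Outside one null set for all rational \<open>q\<close>, small ball averages of |g - q|
  barely exceed its value at the centre, and this value is small when \<open>q\<close> is close to
  \<open>g v\<close>. Cutting |g - q| off at an integer radius makes it integrable.\<close>

theorem AE_lebesgue_point:
  fixes g :: "'a::euclidean_space \<Rightarrow> real"
  assumes g: "integrable lborel g"
  shows "AE v in lborel. \<forall>e>0. \<exists>r0>0. \<forall>r. 0 < r \<and> r < r0 \<longrightarrow>
           (\<integral>u\<in>ball v r. \<bar>g u - g v\<bar> \<partial>lborel) \<le> e * measure lborel (ball v r)"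
proof -
  have gm[measurable]: "g \<in> borel_measurable borel" using g by auto
  define k where "k q N u = indicator (ball 0 (real N)) u * \<bar>g u - q\<bar>" for q :: real and N u
  have ki: "integrable lborel (k q N)" for q N
  proof -
    have "set_integrable lborel (ball 0 (real N)) (\<lambda>u. \<bar>g u - q\<bar>)"
      by (intro set_integrable_abs set_integral_diff set_integrable_lborel_const)
        (auto simp: set_integrable_def intro!: emeasure_lborel_ball_finite[unfolded infinity_ennreal_def] integrable_mult_indicator[where 'b = real, simplified] g)
    then show ?thesis by (simp add: set_integrable_def k_def[abs_def])
  qed
  have kn: "0 \<le> k q N u" for q N u by (simp add: k_def)
  define E where "E = (\<lambda>(q, N, p, p'). {v. k q N v \<le> p \<and> (\<forall>r0>0. \<exists>r>0. r < r0 \<and>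
           p' * measure lborel (ball v r) < (\<integral>u\<in>ball v r. k q N u \<partial>lborel))})"
  define I where "I = {(q, N::nat, p, p'). (q::real) \<in> \<rat> \<and> p \<in> \<rat> \<and> p' \<in> \<rat> \<and> 0 \<le> p \<and> p < (p' :: real)}"
  have "countable (\<rat> \<times> (UNIV :: nat set) \<times> (\<rat> :: real set) \<times> (\<rat> :: real set))"
    by (intro countable_SIGMA countable_rat) auto
  then have "countable I" by (rule countable_subset[rotated]) (auto simp: I_def)
  moreover have "negligible (E i)" if "i \<in> I" for i
    using that negligible_large_ball_averages[OF ki kn] unfolding I_def E_def by fastforce
  ultimately have "negligible (\<Union>i\<in>I. E i)"
    by (metis (no_types, lifting) countable_image imageE negligible_countable_Union)
  then have "AE v in lebesgue. v \<notin> (\<Union>i\<in>I. E i)"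
    unfolding negligible_iff_null_sets by (rule AE_not_in)
  then have "AE v in lborel. v \<notin> (\<Union>i\<in>I. E i)" by (simp add: AE_completion_iff)
  then show ?thesis
  proof (rule AE_mp, intro AE_I2 impI allI)
    fix v and e :: real assume v: "v \<notin> (\<Union>i\<in>I. E i)" and e: "0 < e"
    obtain N :: nat where N: "norm v < real N" using reals_Archimedean2 by blast
    \<comment> \<open>The margins are ordered as |g v - q| < e / 4 < p < 3 e / 8 < p' < e / 2.
      Passing from \<open>q\<close> back to \<open>g v\<close> costs another e / 4, so the total
      stays below \<open>e\<close>.\<close>
    obtain q where q: "q \<in> \<rat>" "g v < q" "q < g v + e / 4" using Rats_dense_in_real[of "g v" "g v + e / 4"] e by auto
    obtain p where p: "p \<in> \<rat>" "e / 4 < p" "p < 3 * e / 8" using Rats_dense_in_real[of "e / 4" "3 * e / 8"] e by auto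
    obtain p' where p': "p' \<in> \<rat>" "3 * e / 8 < p'" "p' < e / 2" using Rats_dense_in_real[of "3 * e / 8" "e / 2"] e by auto
    have "(q, N, p, p') \<in> I" using q p p' e by (auto simp: I_def)
    then have "v \<notin> E (q, N, p, p')" using v by blast
    moreover have "k q N v \<le> p" using q p N by (auto simp: k_def)
    ultimately obtain r0 where r0: "r0 > 0"
      "\<And>r. 0 < r \<Longrightarrow> r < r0 \<Longrightarrow> (\<integral>u\<in>ball v r. k q N u \<partial>lborel) \<le> p' * measure lborel (ball v r)"
      unfolding E_def by (simp add: not_less) (metis not_less)
    show "\<exists>r0>0. \<forall>r. 0 < r \<and> r < r0 \<longrightarrow>
           (\<integral>u\<in>ball v r. \<bar>g u - g v\<bar> \<partial>lborel) \<le> e * measure lborel (ball v r)"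
    proof (intro exI[of _ "min r0 (real N - norm v)"] conjI allI impI)
      fix r assume r: "0 < r \<and> r < min r0 (real N - norm v)"
      let ?B = "ball v r"
      have sub: "u \<in> ball 0 (real N)" if "u \<in> ?B" for u
        using that r norm_triangle_ineq2[of u v] by (auto simp: dist_norm norm_minus_commute)
      have sk: "set_integrable lborel ?B (k q N)"
        unfolding set_integrable_def by (intro integrable_mult_indicator ki) auto
      have sg: "set_integrable lborel ?B (\<lambda>u. \<bar>g u - g v\<bar>)"
        by (intro set_integrable_abs set_integral_diff set_integrable_lborel_const)
          (auto simp: set_integrable_def intro!: emeasure_lborel_ball_finite[unfolded infinity_ennreal_def] integrable_mult_indicator[where 'b = real, simplified] g)
      have sc: "set_integrable lborel ?B (\<lambda>u. \<bar>q - g v\<bar>)"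
        by (intro set_integrable_lborel_const) (auto intro!: emeasure_lborel_ball_finite[unfolded infinity_ennreal_def])
      have "(\<integral>u\<in>?B. \<bar>g u - g v\<bar> \<partial>lborel) \<le> (\<integral>u\<in>?B. k q N u + \<bar>q - g v\<bar> \<partial>lborel)"
        using sub by (intro set_integral_mono sg set_integral_add sk sc) (auto simp: k_def)
      also have "\<dots> = (\<integral>u\<in>?B. k q N u \<partial>lborel) + measure lborel ?B * \<bar>q - g v\<bar>"
        using emeasure_lborel_ball_finite[of v r]
        by (subst set_integral_add(2)[OF sk sc]) (simp add: set_integral_const less_top)
      also have "\<dots> \<le> p' * measure lborel ?B + measure lborel ?B * (e / 4)"
        using r0(2)[of r] r q by (intro add_mono mult_left_mono) auto
      also have "\<dots> = (p' + e / 4) * measure lborel ?B" by (simp add: algebra_simps)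
      also have "\<dots> \<le> e * measure lborel ?B" using p' e by (intro mult_right_mono) auto
      finally show "(\<integral>u\<in>?B. \<bar>g u - g v\<bar> \<partial>lborel) \<le> e * measure lborel ?B" .
    qed (use r0 N in auto)
  qed
qed

section \<open>Spherical caps\<close>

abbreviation dir :: "'a::real_normed_vector \<Rightarrow> 'a" where
  "dir v \<equiv> v /\<^sub>R norm v"

text \<open>The cone over an open spherical cap of chordal radius \<open>r\<close>, truncated at
  radius \<open>s\<close>. For s = 1 its volume is the surface area of the cap up to the dimension
  factor in \<open>sphere_surface\<close>.\<close>

definition cap_cone :: "'a::euclidean_space \<Rightarrow> real \<Rightarrow> real \<Rightarrow> 'a set" where
  "cap_cone x r s = {v. v \<noteq> 0 \<and> norm v \<le> s \<and> dist (dir v) x < r}"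

abbreviation cap_volume :: "'a::euclidean_space \<Rightarrow> real \<Rightarrow> real" where
  "cap_volume x r \<equiv> measure lborel (cap_cone x r 1)"

abbreviation cap_integral :: "('a::euclidean_space \<Rightarrow> real) \<Rightarrow> 'a \<Rightarrow> real \<Rightarrow> real" where
  "cap_integral k x r \<equiv> \<integral>v\<in>cap_cone x r 1. k (dir v) \<partial>lborel"

lemma cap_cone_borel [measurable]: "cap_cone x r s \<in> sets borel"
  unfolding cap_cone_def by measurable

lemma cap_cone_subset: "cap_cone x r s \<subseteq> cball 0 s"
  by (auto simp: cap_cone_def)

lemma normalize_measurable [measurable]: "(\<lambda>v::'a::euclidean_space. dir v) \<in> borel_measurable borel"
  by measurable

text \<open>The integrand depends on the direction alone, so a dilation changes only the volume
  element.\<close>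

lemma cap_cone_integral_scale:
  fixes k :: "'a::euclidean_space \<Rightarrow> real"
  assumes [measurable]: "k \<in> borel_measurable borel" and s: "0 < s"
  shows "(\<integral>v\<in>cap_cone x r s. k (dir v) \<partial>lborel)
     = s ^ DIM('a) * cap_integral k x r"
proof -
  let ?f = "\<lambda>v. indicator (cap_cone x r s) v *\<^sub>R k (dir v)"
  have "(\<integral>v. ?f v \<partial>lborel) = (\<integral>v. ?f v \<partial>density (distr lborel borel (\<lambda>v. 0 + s *\<^sub>R v)) (\<lambda>_. \<bar>s\<bar> ^ DIM('a)))"
    using lborel_affine[of s "0::'a"] s by simp
  also have "\<dots> = (\<integral>v. s ^ DIM('a) * ?f (s *\<^sub>R v) \<partial>lborel)"
    using s by (subst integral_density) (auto simp: integral_distr)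
  also have "\<dots> = s ^ DIM('a) * (\<integral>v. ?f (s *\<^sub>R v) \<partial>lborel)" by simp
  also have "(\<lambda>v. ?f (s *\<^sub>R v)) = (\<lambda>v. indicator (cap_cone x r 1) v *\<^sub>R k (dir v))"
  proof
    fix v :: 'a
    have 1: "(s *\<^sub>R v) /\<^sub>R norm (s *\<^sub>R v) = dir v" using s by simp
    have 2: "norm (s *\<^sub>R v) \<le> s \<longleftrightarrow> norm v \<le> 1" using s by (simp add: mult_le_cancel_left2)
    have 3: "s *\<^sub>R v \<noteq> 0 \<longleftrightarrow> v \<noteq> 0" using s by simp
    show "?f (s *\<^sub>R v) = indicator (cap_cone x r 1) v *\<^sub>R k (dir v)"
      unfolding cap_cone_def indicator_def mem_Collect_eq 1 2 3 ..
  qed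
  finally show ?thesis unfolding set_lebesgue_integral_def .
qed

section \<open>Caps and shells compared with Euclidean balls\<close>

lemma cap_cone_fmeasurable: "cap_cone (x::'a::euclidean_space) r s \<in> fmeasurable lborel"
proof -
  have "emeasure lborel (cap_cone x r s) \<le> emeasure lborel (cball (0::'a) s)"
    by (rule emeasure_mono[OF cap_cone_subset]) simp
  also have "\<dots> < \<infinity>" by (rule emeasure_lborel_cball_finite)
  finally show ?thesis by (auto simp: fmeasurable_def)
qed

text \<open>The shell has diameter and inradius of order \<open>r\<close>, so Lebesgue points control averages over it; for a function
  that is homogeneous of degree 0 these equal the averages over the whole cone.\<close>

definition cap_shell :: "'a::euclidean_space \<Rightarrow> real \<Rightarrow> real \<Rightarrow> 'a set" where
  "cap_shell x r t = cap_cone x r t - cap_cone x r (t * (1 - r))"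

text \<open>t^D - (t (1 - r))^D for the dimension D: the ratio between the integral over the shell
  and that over the unit cone, for integrands that depend on the direction. It cancels in averages.
  The type argument carries D.\<close>

definition shell_factor :: "'a::euclidean_space itself \<Rightarrow> real \<Rightarrow> real \<Rightarrow> real" where
  "shell_factor _ t r = t ^ DIM('a) * (1 - (1 - r) ^ DIM('a))"

lemma shell_factor_bounds:
  fixes r t :: real
  assumes r: "0 < r" "r < 1" and t: "0 < t"
  shows "t ^ DIM('a) * r \<le> shell_factor TYPE('a::euclidean_space) t r"
    and "shell_factor TYPE('a) t r \<le> t ^ DIM('a) * (DIM('a) * r)"
    and "0 < shell_factor TYPE('a) t r"
proof -
  have "(1 - r) ^ DIM('a) \<le> (1 - r) ^ 1" using r by (intro power_decreasing) (auto simp: Suc_leI)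
  then have 1: "r \<le> 1 - (1 - r) ^ DIM('a)" by simp
  have "1 + real DIM('a) * (- r) \<le> (1 + (- r)) ^ DIM('a)" using r by (intro Bernoulli_inequality) auto
  then have 2: "1 - (1 - r) ^ DIM('a) \<le> DIM('a) * r" by simp
  show "t ^ DIM('a) * r \<le> shell_factor TYPE('a) t r" "shell_factor TYPE('a) t r \<le> t ^ DIM('a) * (DIM('a) * r)"
    unfolding shell_factor_def using 1 2 t by (auto intro!: mult_left_mono)
  then show "0 < shell_factor TYPE('a) t r" using r t by (smt (verit) mult_pos_pos zero_less_power)
qed

lemma cap_shell_integral:
  fixes k :: "'a::euclidean_space \<Rightarrow> real"
  assumes k[measurable]: "k \<in> borel_measurable borel" and r: "0 < r" "r < 1" and t: "0 < t"
    and int: "set_integrable lborel (cball 0 t) (\<lambda>v. k (dir v))"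
  shows "(\<integral>v\<in>cap_shell x r t. k (dir v) \<partial>lborel)
     = shell_factor TYPE('a) t r * cap_integral k x r"
proof -
  have t': "0 < t * (1 - r)" using r t by simp
  let ?k = "\<lambda>v. k (dir v)"
  have sub: "cap_cone x r (t * (1 - r)) \<subseteq> cap_cone x r t"
    using r t mult_left_le[of "1 - r" t] unfolding cap_cone_def by (auto intro: order_trans)
  have ii: "set_integrable lborel A ?k" if "A \<in> sets borel" "A \<subseteq> cap_cone x r t" for A
    using that cap_cone_subset by (intro set_integrable_subset[OF int]) force+
  have "(\<integral>v\<in>cap_cone x r t. ?k v \<partial>lborel)
      = (\<integral>v\<in>(cap_shell x r t \<union> cap_cone x r (t * (1 - r))). ?k v \<partial>lborel)"
    using sub by (intro arg_cong[where f = "\<lambda>A. set_lebesgue_integral lborel A ?k"]) (auto simp: cap_shell_def)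
  also have "\<dots> = (\<integral>v\<in>cap_shell x r t. ?k v \<partial>lborel) + (\<integral>v\<in>cap_cone x r (t * (1 - r)). ?k v \<partial>lborel)"
    using sub by (intro set_integral_Un ii) (auto simp: cap_shell_def)
  finally show ?thesis
    using cap_cone_integral_scale[OF k t, of x r] cap_cone_integral_scale[OF k t', of x r]
    unfolding power_mult_distrib shell_factor_def by (simp only: algebra_simps)
qed

lemma cap_shell_borel [measurable]: "cap_shell x r t \<in> sets borel"
  unfolding cap_shell_def by measurable

lemma cap_shell_fmeasurable: "cap_shell x r t \<in> fmeasurable lborel"
  unfolding cap_shell_def using cap_cone_fmeasurable by (intro fmeasurable_Diff) auto

lemma measure_cap_shell:
  assumes r: "0 < r" "r < 1" and t: "0 < t"
  shows "measure lborel (cap_shell (x::'a::euclidean_space) r t) = shell_factor TYPE('a) t r * cap_volume x r"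
proof -
  have 1: "measure lborel A = (\<integral>v\<in>A. 1 \<partial>lborel)" if "A \<in> fmeasurable lborel" for A :: "'a set"
    using that fmeasurableD2[OF that] by (simp add: set_integral_const fmeasurable_def)
  have "set_integrable lborel (cball 0 t) (\<lambda>v::'a. 1 :: real)"
    by (intro set_integrable_lborel_const) (use emeasure_lborel_cball_finite in auto)
  from cap_shell_integral[of "\<lambda>_. 1", OF _ r t this] show ?thesis
    by (simp add: 1[OF cap_shell_fmeasurable] 1[OF cap_cone_fmeasurable])
qed

text \<open>The displacement from t x splits into an angular and a radial part, and each is at most
  t r.\<close>

lemma cap_shell_subset_ball:
  assumes x: "norm x = 1" and r: "0 < r" "r < 1" and t: "0 < t"
  shows "cap_shell x r t \<subseteq> ball (t *\<^sub>R x) (2 * t * r)"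
proof
  fix u assume u: "u \<in> cap_shell x r t"
  then have u: "u \<noteq> 0" "norm u \<le> t" "dist (dir u) x < r" "t * (1 - r) < norm u"
    by (auto simp: cap_shell_def cap_cone_def)
  have "u - t *\<^sub>R x = norm u *\<^sub>R (dir u - x) + (norm u - t) *\<^sub>R x"
    using u(1) by (simp add: algebra_simps)
  then have "norm (u - t *\<^sub>R x) \<le> norm u * norm (dir u - x) + \<bar>norm u - t\<bar> * norm x"
    by (metis norm_scaleR norm_triangle_ineq abs_norm_cancel)
  also have "norm u * norm (dir u - x) < norm u * r"
    using u by (intro mult_strict_left_mono) (auto simp: dist_norm)
  also have "norm u * r \<le> t * r" using u r by simp
  also have "\<bar>norm u - t\<bar> * norm x \<le> t * r" using u x by (simp add: algebra_simps)
  finally have "norm (u - t *\<^sub>R x) < 2 * t * r" by (simp add: mult_ac)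
  then show "u \<in> ball (t *\<^sub>R x) (2 * t * r)" by (simp add: dist_norm norm_minus_commute)
qed

text \<open>The centre lies half-way through the shell, so the radius t r / 8 leaves room radially.
  Angularly, the deviation of \<open>norm u *\<^sub>R dir u\<close> from
  \<open>norm u *\<^sub>R x\<close> is below t r / 4, while \<open>norm u\<close> exceeds 3 t /
  8.\<close>

lemma ball_subset_cap_shell:
  assumes x: "norm x = 1" and r: "0 < r" "r < 1" and t: "0 < t"
  shows "ball ((t * (1 - r / 2)) *\<^sub>R x) (t * r / 8) \<subseteq> cap_shell x r t"
proof
  let ?s = "t * (1 - r / 2)"
  fix u assume u: "u \<in> ball (?s *\<^sub>R x) (t * r / 8)"
  have tr: "0 < t * r" "t * r < t" using r t by auto
  have s: "?s = t - t * r / 2" by (simp add: algebra_simps)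
  have s0: "0 < ?s" using tr unfolding s by linarith
  have d: "norm (u - ?s *\<^sub>R x) < t * r / 8" using u by (simp add: dist_norm norm_minus_commute)
  have ns: "norm (?s *\<^sub>R x) = ?s" using x s0 by simp
  have nu: "\<bar>norm u - ?s\<bar> < t * r / 8"
    using norm_triangle_ineq3[of u "?s *\<^sub>R x"] d unfolding ns by linarith
  then have "norm u < ?s + t * r / 8" "?s - t * r / 8 < norm u" by linarith+
  then have 1: "norm u \<le> t" "t * (1 - r) < norm u" using tr unfolding s right_diff_distrib by linarith+
  have pos: "3 * t / 8 < norm u" using nu tr unfolding s by linarith
  then have u0: "u \<noteq> 0" using t by auto
  have "norm u *\<^sub>R (dir u - x) = (u - ?s *\<^sub>R x) + (?s - norm u) *\<^sub>R x"
    using u0 by (simp add: algebra_simps)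
  then have "norm u * norm (dir u - x) \<le> norm (u - ?s *\<^sub>R x) + \<bar>?s - norm u\<bar> * norm x"
    by (metis norm_scaleR norm_triangle_ineq abs_norm_cancel)
  also have "\<dots> < t * r / 4" using d nu x abs_minus_commute[of ?s "norm u"] by simp
  also have "\<dots> = (t / 4) * r" by simp
  also have "\<dots> < norm u * r" using pos r t by (intro mult_strict_right_mono) auto
  finally have "norm (dir u - x) < r" using u0 by simp
  then show "u \<in> cap_shell x r t" using 1 u0 by (auto simp: cap_shell_def cap_cone_def dist_norm)
qed

text \<open>The shell lies between two balls of radius of order r, hence has volume of order r^D.
  Dividing by \<open>shell_factor\<close>, which is of order r, leaves r^(D - 1) without any
  computation of cap areas.\<close>

lemma cap_cone_measure_bounds:
  fixes x :: "'a::euclidean_space"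
  assumes x: "norm x = 1" and r: "0 < r" "r < 1"
  shows "unit_ball_vol DIM('a) / (8 ^ DIM('a) * DIM('a)) * r ^ (DIM('a) - 1) \<le> cap_volume x r"
    and "cap_volume x r \<le> unit_ball_vol DIM('a) * 2 ^ DIM('a) * r ^ (DIM('a) - 1)"
    and "0 < cap_volume x r"
proof -
  let ?D = "DIM('a)" and ?\<kappa> = "unit_ball_vol DIM('a)"
  obtain D' where D': "?D = Suc D'" using DIM_positive[where 'a = 'a] by (metis Suc_pred)
  have hr: "r ^ ?D = r * r ^ (?D - 1)" by (simp add: D')
  have "measure lborel (ball ((1 * (1 - r / 2)) *\<^sub>R x) (1 * r / 8)) \<le> measure lborel (cap_shell x r 1)"
    using ball_subset_cap_shell[OF x r, of 1] by (intro measure_mono_fmeasurable cap_shell_fmeasurable) auto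
  then have "?\<kappa> * (r / 8) ^ ?D \<le> shell_factor TYPE('a) 1 r * cap_volume x r"
    using r by (simp add: content_ball measure_cap_shell)
  also have "\<dots> \<le> (?D * r) * cap_volume x r"
    using shell_factor_bounds(2)[OF r, of 1, where 'a = 'a] by (intro mult_right_mono) auto
  finally have 1: "?\<kappa> * (r / 8) ^ ?D \<le> (?D * r) * cap_volume x r" .
  have "?\<kappa> / (8 ^ ?D * ?D) * r ^ (?D - 1) = ?\<kappa> * (r / 8) ^ ?D / (?D * r)"
    using r hr by (simp add: power_divide)
  also have "\<dots> \<le> cap_volume x r" using 1 r by (simp add: pos_divide_le_eq mult.commute)
  finally show a: "?\<kappa> / (8 ^ ?D * ?D) * r ^ (?D - 1) \<le> cap_volume x r" .
  have "r * cap_volume x r \<le> shell_factor TYPE('a) 1 r * cap_volume x r"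
    using shell_factor_bounds(1)[OF r, of 1, where 'a = 'a] by (intro mult_right_mono) auto
  also have "\<dots> = measure lborel (cap_shell x r 1)" using r by (simp add: measure_cap_shell)
  also have "\<dots> \<le> measure lborel (ball (1 *\<^sub>R x) (2 * 1 * r))"
    using cap_shell_subset_ball[OF x r, of 1] by (intro measure_mono_fmeasurable) (auto simp: fmeasurable_def intro!: emeasure_lborel_ball_finite[unfolded infinity_ennreal_def])
  also have "\<dots> = r * (?\<kappa> * 2 ^ ?D * r ^ (?D - 1))" using r by (simp add: content_ball D' power_mult_distrib)
  finally show "cap_volume x r \<le> ?\<kappa> * 2 ^ ?D * r ^ (?D - 1)" using r by simp
  have "0 < ?\<kappa> / (8 ^ ?D * ?D) * r ^ (?D - 1)" using r by simp
  then show "0 < cap_volume x r" using a by linarith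
qed

text \<open>As r tends to 0 the shells at radius t shrink to t x and fill a fixed proportion of
  balls around it, so their averages converge at a Lebesgue point. By homogeneity these averages are
  the cap averages.\<close>

lemma cap_average_tendsto_at_lebesgue_point:
  fixes k :: "'a::euclidean_space \<Rightarrow> real"
  assumes k[measurable]: "k \<in> borel_measurable borel"
    and int: "set_integrable lborel (cball 0 1) (\<lambda>v. k (dir v))"
    and x: "norm x = 1" and t: "0 < t" "t < 1"
    and leb: "\<And>e. 0 < e \<Longrightarrow> \<exists>r0>0. \<forall>r. 0 < r \<and> r < r0 \<longrightarrow>
       (\<integral>u\<in>ball (t *\<^sub>R x) r. \<bar>indicator (cball 0 1) u * k (dir u) - k x\<bar> \<partial>lborel)
         \<le> e * measure lborel (ball (t *\<^sub>R x) r)"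
  shows "((\<lambda>r. cap_integral k x r / cap_volume x r) \<longlongrightarrow> k x) (at_right 0)"
proof (rule tendstoI)
  fix e :: real assume e: "0 < e"
  let ?D = "DIM('a)" and ?\<kappa> = "unit_ball_vol DIM('a)" and ?k = "\<lambda>v. k (dir v)"
  \<comment> \<open>16 is the ratio of the radii 2 t r and t r / 8 of the circumscribed and the
    inscribed ball of the shell.\<close>
  define e' where "e' = e / 2 / 16 ^ ?D"
  have e': "0 < e'" using e by (simp add: e'_def)
  obtain r0 where r0: "r0 > 0" "\<And>r. 0 < r \<Longrightarrow> r < r0 \<Longrightarrow>
       (\<integral>u\<in>ball (t *\<^sub>R x) r. \<bar>indicator (cball 0 1) u * ?k u - k x\<bar> \<partial>lborel)
         \<le> e' * measure lborel (ball (t *\<^sub>R x) r)" using leb[OF e'] by blast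
  have intt: "set_integrable lborel (cball 0 t) ?k"
    by (rule set_integrable_subset[OF int]) (use t in auto)
  have "eventually (\<lambda>r. r < min 1 (r0 / (2 * t))) (at_right 0)"
    by (rule eventually_at_rightI[of 0 "min 1 (r0 / (2 * t))"]) (use r0 t in auto)
  moreover have "eventually (\<lambda>r. 0 < r) (at_right (0::real))" by (rule eventually_at_right_less)
  ultimately show "\<forall>\<^sub>F r in at_right 0. dist (cap_integral k x r / cap_volume x r) (k x) < e"
  proof eventually_elim
    case (elim r)
    then have r: "0 < r" "r < 1" "2 * t * r < r0" using t by (auto simp: field_simps)
    let ?T = "cap_shell x r t" and ?B = "ball (t *\<^sub>R x) (2 * t * r)" and ?lam = "shell_factor TYPE('a) t r"
    have TB: "?T \<subseteq> ?B" by (rule cap_shell_subset_ball[OF x r(1,2) t(1)])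
    have T1: "?T \<subseteq> cball 0 1" using t by (auto simp: cap_shell_def cap_cone_def)
    have iT: "set_integrable lborel ?T ?k" by (rule set_integrable_subset[OF int]) (use T1 in auto)
    have cT: "set_integrable lborel ?T (\<lambda>_. k x)"
      using fmeasurableD2[OF cap_shell_fmeasurable[of x r t]]
      by (intro set_integrable_lborel_const) (auto simp: less_top)
    have mT: "measure lborel ?T = ?lam * cap_volume x r" by (rule measure_cap_shell[OF r(1,2) t(1)])
    have \<lambda>: "0 < ?lam" by (rule shell_factor_bounds(3)[OF r(1,2) t(1)])
    have c0: "0 < cap_volume x r" by (rule cap_cone_measure_bounds(3)[OF x r(1,2)])
    have T0: "0 < measure lborel ?T" unfolding mT using \<lambda> c0 by simp
    have iB: "set_integrable lborel ?B (\<lambda>u. \<bar>indicator (cball 0 1) u * ?k u - k x\<bar>)"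
    proof (intro set_integrable_abs set_integral_diff)
      have "integrable lborel (\<lambda>u. indicator (cball 0 1) u * ?k u)"
        using int by (simp add: set_integrable_def)
      then show "set_integrable lborel ?B (\<lambda>u. indicator (cball 0 1) u * ?k u)"
        unfolding set_integrable_def by (intro integrable_mult_indicator) auto
      show "set_integrable lborel ?B (\<lambda>_. k x)"
        by (intro set_integrable_lborel_const) (use emeasure_lborel_ball_finite in auto)
    qed
    have "\<bar>(\<integral>v\<in>?T. ?k v \<partial>lborel) - k x * measure lborel ?T\<bar> = \<bar>\<integral>v\<in>?T. ?k v - k x \<partial>lborel\<bar>"
      using fmeasurableD2[OF cap_shell_fmeasurable[of x r t]]
      by (subst set_integral_diff(2)[OF iT cT]) (simp add: set_integral_const mult.commute)
    also have "\<dots> \<le> (\<integral>v\<in>?T. \<bar>?k v - k x\<bar> \<partial>lborel)"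
      using set_integral_norm_bound[OF set_integral_diff(1)[OF iT cT]] by simp
    also have "\<dots> = (\<integral>v\<in>?T. \<bar>indicator (cball 0 1) v * ?k v - k x\<bar> \<partial>lborel)"
      by (rule set_lebesgue_integral_cong) (use T1 in auto)
    also have "\<dots> \<le> (\<integral>v\<in>?B. \<bar>indicator (cball 0 1) v * ?k v - k x\<bar> \<partial>lborel)"
      by (rule set_integral_subset_mono[OF iB]) (use TB in auto)
    also have "\<dots> \<le> e' * measure lborel ?B" using r t by (intro r0) auto
    also have "measure lborel ?B = 16 ^ ?D * measure lborel (ball ((t * (1 - r / 2)) *\<^sub>R x) (t * r / 8))"
    proof -
      have 1: "measure lborel ?B = ?\<kappa> * (2 * t * r) ^ ?D" using r t by (intro content_ball) auto
      have 2: "measure lborel (ball ((t * (1 - r / 2)) *\<^sub>R x) (t * r / 8)) = ?\<kappa> * (t * r / 8) ^ ?D"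
        using r t by (intro content_ball) auto
      have 3: "(2 * t * r) ^ ?D = 16 ^ ?D * (t * r / 8) ^ ?D"
        by (subst power_mult_distrib[symmetric]) (rule arg_cong[where f = "\<lambda>y. y ^ ?D"], simp)
      show ?thesis unfolding 1 2 3 by (simp only: mult_ac)
    qed
    also have "\<dots> \<le> 16 ^ ?D * measure lborel ?T"
      using ball_subset_cap_shell[OF x r(1,2) t(1)]
      by (intro mult_left_mono measure_mono_fmeasurable cap_shell_fmeasurable) auto
    also have "e' * (16 ^ ?D * measure lborel ?T) = e / 2 * measure lborel ?T" by (simp add: e'_def)
    finally have main: "\<bar>(\<integral>v\<in>?T. ?k v \<partial>lborel) - k x * measure lborel ?T\<bar> \<le> e / 2 * measure lborel ?T"
      using e' by simp
    have "cap_integral k x r / cap_volume x r = (\<integral>v\<in>?T. ?k v \<partial>lborel) / measure lborel ?T"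
      unfolding mT cap_shell_integral[OF k r(1,2) t(1) intt] using \<lambda> by simp
    moreover have "(\<integral>v\<in>?T. ?k v \<partial>lborel) / measure lborel ?T - k x
        = ((\<integral>v\<in>?T. ?k v \<partial>lborel) - k x * measure lborel ?T) / measure lborel ?T"
      using T0 by (simp add: diff_divide_distrib)
    ultimately have "dist (cap_integral k x r / cap_volume x r) (k x)
        = \<bar>(\<integral>v\<in>?T. ?k v \<partial>lborel) - k x * measure lborel ?T\<bar> / measure lborel ?T"
      by (simp add: dist_real_def abs_divide)
    also have "\<dots> \<le> e / 2" using main T0 by (simp add: pos_divide_le_eq)
    finally show ?case using e by simp
  qed
qed

text \<open>If almost every point has a property, then almost every ray contains many such points. This transfers
  the property to the sphere also when the set where it holds is not known to be measurable there.\<close>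

lemma AE_all_scalings:
  fixes N :: "'a::euclidean_space set"
  assumes N: "N \<in> null_sets lborel"
  shows "AE v in lborel. v \<noteq> 0 \<longrightarrow> (\<integral>\<^sup>+r. indicator {0<..} r * indicator N (r *\<^sub>R (dir v)) \<partial>lborel) = 0"
proof -
  have Nb[measurable]: "N \<in> sets borel" using N by auto
  define \<phi> where "\<phi> v = (\<integral>\<^sup>+r. indicator {0<..} r * indicator N (r *\<^sub>R v) \<partial>lborel)" for v :: 'a
  have [measurable]: "\<phi> \<in> borel_measurable borel" unfolding \<phi>_def by measurable
  \<comment> \<open>Interchanging the integrals avoids polar coordinates: for fixed r > 0 the v with
    r v in \<open>N\<close> form a dilate of \<open>N\<close>, hence a null set.\<close>
  have "(\<integral>\<^sup>+v. \<phi> v \<partial>lborel) = (\<integral>\<^sup>+r. (\<integral>\<^sup>+v. indicator {0<..} r * indicator N (r *\<^sub>R v) \<partial>lborel) \<partial>lborel)"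
    unfolding \<phi>_def by (rule lborel_pair.Fubini'[symmetric]) measurable
  also have "\<dots> = (\<integral>\<^sup>+r. 0 \<partial>(lborel :: real measure))"
  proof (rule nn_integral_cong)
    fix r :: real
    show "(\<integral>\<^sup>+v. indicator {0<..} r * indicator N (r *\<^sub>R v) \<partial>lborel) = 0"
    proof (cases "0 < r")
      case True
      have "0 = (\<integral>\<^sup>+v. indicator N v \<partial>lborel)" using null_setsD1[OF N] by simp
      also have "\<dots> = (\<integral>\<^sup>+v. indicator N v \<partial>density (distr lborel borel (\<lambda>v. 0 + r *\<^sub>R v)) (\<lambda>_. \<bar>r\<bar> ^ DIM('a)))"
        using lborel_affine[of r "0::'a"] True by simp
      also have "\<dots> = r ^ DIM('a) * (\<integral>\<^sup>+v. indicator N (r *\<^sub>R v) \<partial>lborel)"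
        using True by (subst nn_integral_density, simp, simp, subst nn_integral_cmult, simp, subst nn_integral_distr)
          (auto simp: ennreal_power)
      finally have "(\<integral>\<^sup>+v. indicator N (r *\<^sub>R v) \<partial>lborel) = 0" using True by simp
      then show ?thesis using True by simp
    qed simp
  qed
  finally have "(\<integral>\<^sup>+v. \<phi> v \<partial>lborel) = 0" by simp
  then have "AE v in lborel. \<phi> v = 0" by (subst (asm) nn_integral_0_iff_AE) auto
  then show ?thesis
  proof (rule AE_mp, intro AE_I2 impI)
    fix v :: 'a assume v: "\<phi> v = 0" "v \<noteq> 0"
    \<comment> \<open>The substitution r -> \<open>norm v\<close> r passes from multiples of
      \<open>v\<close> to multiples of its direction.\<close>
    have "(\<integral>\<^sup>+r. indicator {0<..} r * indicator N (r *\<^sub>R (dir v)) \<partial>lborel)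
        = norm v * (\<integral>\<^sup>+r. indicator {0<..} (0 + norm v * r) * indicator N ((0 + norm v * r) *\<^sub>R (dir v)) \<partial>lborel)"
      using v by (subst nn_integral_real_affine[where c = "norm v" and t = 0]) auto
    also have "(\<lambda>r. indicator {0<..} (0 + norm v * r) * indicator N ((0 + norm v * r) *\<^sub>R (dir v)))
        = (\<lambda>r. indicator {0<..} r * indicator N (r *\<^sub>R v) :: ennreal)"
    proof -
      have e: "(0 + norm v * r) *\<^sub>R (dir v) = r *\<^sub>R v" for r
        unfolding scaleR_scaleR using v by (intro arg_cong[where f = "\<lambda>r. r *\<^sub>R v"]) (simp add: field_simps)
      show ?thesis unfolding e using v by (auto simp: fun_eq_iff indicator_def zero_less_mult_iff)
    qed
    finally show "(\<integral>\<^sup>+r. indicator {0<..} r * indicator N (r *\<^sub>R (dir v)) \<partial>lborel) = 0"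
      using v(1) by (simp add: \<phi>_def)
  qed
qed

section \<open>Transfer to the surface measure\<close>

lemma sphere_surface_density:
  "(sphere_surface :: (real ^ 'n) measure) =
     density (distr (restrict_space lborel (cball 0 1 - {0})) borel (\<lambda>x. dir x)) (\<lambda>_. ennreal (real CARD('n)))"
  unfolding sphere_surface_def
  by (rule measure_eqI) (auto simp: emeasure_density nn_integral_cmult_indicator ennreal_of_nat_eq_real_of_nat)

lemma normalize_restrict_measurable [measurable]:
  "(\<lambda>x::'a::euclidean_space. dir x) \<in> measurable (restrict_space lborel (cball 0 1 - {0})) borel"
  by (rule measurable_restrict_space1) simp

text \<open>One good point on each ray is enough for functions of the direction. Asking for r < 1
  keeps it in the interior of the unit ball, outside which the integrands are cut off.\<close>

lemma AE_sphere_surface: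
  fixes P :: "real ^ 'n \<Rightarrow> bool"
  assumes P: "AE v in lborel. P v"
  shows "AE u in (sphere_surface :: (real ^ 'n) measure). norm u = 1 \<and> (\<exists>r. 0 < r \<and> r < 1 \<and> P (r *\<^sub>R u))"
proof -
  obtain N where N: "{v. \<not> P v} \<subseteq> N" "N \<in> null_sets lborel"
    using P by (auto elim!: AE_E simp: null_sets_def)
  have [measurable]: "N \<in> sets borel" using N by auto
  let ?\<phi> = "\<lambda>u :: real ^ 'n. \<integral>\<^sup>+r. indicator {0<..} r * indicator N (r *\<^sub>R u) \<partial>lborel"
  have "AE v in restrict_space lborel (cball 0 1 - {0}). norm (dir v) = 1 \<and> ?\<phi> (dir v) = 0"
    using AE_all_scalings[OF N(2)] by (subst AE_restrict_space_iff) auto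
  then have "AE u in (sphere_surface :: (real ^ 'n) measure). norm u = 1 \<and> ?\<phi> u = 0"
    unfolding sphere_surface_density by (subst AE_density, simp, subst AE_distr_iff) auto
  then show ?thesis
  proof (rule AE_mp, intro AE_I2 impI conjI)
    fix u :: "real ^ 'n" assume u: "norm u = 1 \<and> ?\<phi> u = 0"
    then show "norm u = 1" by simp
    have "AE r in lborel. indicator {0<..} r * indicator N (r *\<^sub>R u) = (0 :: ennreal)"
      using u by (subst nn_integral_0_iff_AE[symmetric]) auto
    then have "AE r in lborel. 0 < r \<longrightarrow> r *\<^sub>R u \<notin> N" by (auto simp: indicator_def)
    moreover have "\<not> (AE r in lborel. r \<notin> {0<..<1::real})"
    proof
      assume "AE r in lborel. r \<notin> {0<..<1::real}"
      then have "{0<..<1::real} \<in> null_sets lborel" by (subst (asm) AE_iff_null_sets[symmetric]) auto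
      then show False by (simp add: null_sets_def)
    qed
    ultimately obtain r where "r \<in> {0<..<1::real}" "r *\<^sub>R u \<notin> N"
      by (metis (mono_tags, lifting) AE_mp AE_I2 greaterThanLessThan_iff)
    then show "\<exists>r. 0 < r \<and> r < 1 \<and> P (r *\<^sub>R u)" using N(1) by (intro exI[of _ r]) auto
  qed
qed

theorem AE_cap_average_tendsto:
  fixes k :: "real ^ 'n \<Rightarrow> real"
  assumes k[measurable]: "k \<in> borel_measurable borel"
    and int: "set_integrable lborel (cball 0 1) (\<lambda>v. k (dir v))"
  shows "AE u in sphere_surface. norm u = 1 \<and>
     ((\<lambda>r. cap_integral k u r / cap_volume u r) \<longlongrightarrow> k u) (at_right 0)"
proof -
  let ?g = "\<lambda>u. indicator (cball 0 1) u * k (dir u)"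
  have "integrable lborel ?g" using int by (simp add: set_integrable_def)
  from AE_sphere_surface[OF AE_lebesgue_point[OF this]] show ?thesis
  proof (rule AE_mp, intro AE_I2 impI conjI)
    fix u :: "real ^ 'n"
    assume "norm u = 1 \<and> (\<exists>t. 0 < t \<and> t < 1 \<and> (\<forall>e>0. \<exists>r0>0. \<forall>r. 0 < r \<and> r < r0 \<longrightarrow>
      (\<integral>w\<in>ball (t *\<^sub>R u) r. \<bar>?g w - ?g (t *\<^sub>R u)\<bar> \<partial>lborel) \<le> e * measure lborel (ball (t *\<^sub>R u) r)))"
    then obtain t where u: "norm u = 1" and t: "0 < t" "t < 1" and leb: "\<And>e. 0 < e \<Longrightarrow> \<exists>r0>0. \<forall>r. 0 < r \<and> r < r0 \<longrightarrow>
      (\<integral>w\<in>ball (t *\<^sub>R u) r. \<bar>?g w - ?g (t *\<^sub>R u)\<bar> \<partial>lborel) \<le> e * measure lborel (ball (t *\<^sub>R u) r)"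
      by blast
    show "norm u = 1" by (rule u)
    have gu: "?g (t *\<^sub>R u) = k u" using u t by simp
    show "((\<lambda>r. cap_integral k u r / cap_volume u r) \<longlongrightarrow> k u) (at_right 0)"
      by (rule cap_average_tendsto_at_lebesgue_point[OF k int u t leb[unfolded gu]])
  qed
qed

section \<open>Sums of i.i.d. votes with heavy tails\<close>

lemma product_prob_space_const: "prob_space D \<Longrightarrow> product_prob_space (\<lambda>_. D)"
  unfolding product_prob_space_def product_prob_space_axioms_def product_sigma_finite_def
  by (auto intro: prob_space_imp_sigma_finite)

lemma sum_square_sample_law:
  assumes D: "prob_space D" and V: "integrable D V" "integrable D (\<lambda>w. (V w)\<^sup>2)" and m: "(\<integral>w. V w \<partial>D) = 0"
  shows "integrable (sample_law n D) (\<lambda>S. (\<Sum>i<n. V (S i :: 'b))\<^sup>2 :: real)"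
    and "(\<integral>S. (\<Sum>i<n. V (S i))\<^sup>2 \<partial>sample_law n D) = n * (\<integral>w. (V w)\<^sup>2 \<partial>D)"
proof -
  interpret D: prob_space D by fact
  interpret P: product_prob_space "\<lambda>_. D" by (rule product_prob_space_const[OF D])
  \<comment> \<open>A product of two coordinates, written as a product over all of them, so that its
    integral factorises. Off the diagonal one factor has integral 0.\<close>
  define f where "f i j k w = (if k = i \<and> k = j then (V w)\<^sup>2 else if k = i \<or> k = j then V w else 1)" for i j k :: nat and w
  have fi: "integrable D (f i j k)" for i j k using V by (cases "k = i"; cases "k = j") (auto simp: f_def[abs_def])
  have prod: "V (S i) * V (S j) = (\<Prod>k<n. f i j k (S k))" if "i < n" "j < n" for i j and S :: "nat \<Rightarrow> 'b"
  proof (cases "i = j")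
    case True
    have "(\<Prod>k<n. f i j k (S k)) = (\<Prod>k<n. if k = i then (V (S k))\<^sup>2 else 1)"
      by (rule prod.cong) (auto simp: f_def True)
    then show ?thesis using that True by (simp add: prod.delta power2_eq_square)
  next
    case False
    have "(\<Prod>k<n. f i j k (S k)) = (\<Prod>k<n. (if k = i then V (S k) else 1) * (if k = j then V (S k) else 1))"
      by (rule prod.cong) (use False in \<open>auto simp: f_def\<close>)
    then show ?thesis using that by (simp add: prod.distrib prod.delta)
  qed
  have int: "integrable (sample_law n D) (\<lambda>S. V (S i) * V (S j))" if "i < n" "j < n" for i j
    unfolding sample_law_def prod[OF that] using fi by (intro P.product_integrable_prod) auto
  have val: "(\<integral>S. V (S i) * V (S j) \<partial>sample_law n D) = (if i = j then (\<integral>w. (V w)\<^sup>2 \<partial>D) else 0)"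
    if "i < n" "j < n" for i j
  proof -
    have "(\<integral>S. V (S i) * V (S j) \<partial>sample_law n D) = (\<Prod>k<n. \<integral>w. f i j k w \<partial>D)"
      unfolding sample_law_def prod[OF that] using fi by (intro P.product_integral_prod) auto
    also have "\<dots> = (if i = j then (\<integral>w. (V w)\<^sup>2 \<partial>D) else 0)"
    proof (cases "i = j")
      case True
      have "(\<Prod>k<n. \<integral>w. f i j k w \<partial>D) = (\<Prod>k<n. if k = i then (\<integral>w. (V w)\<^sup>2 \<partial>D) else 1)"
        by (rule prod.cong) (auto simp: f_def True D.prob_space)
      then show ?thesis using that True by (simp add: prod.delta)
    next
      case False
      have "(\<integral>w. f i j i w \<partial>D) = 0" using False m by (simp add: f_def)
      then show ?thesis using that False by (auto intro!: prod_zero)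
    qed
    finally show ?thesis .
  qed
  have sq: "(\<Sum>i<n. V (S i))\<^sup>2 = (\<Sum>i<n. \<Sum>j<n. V (S i) * V (S j))" for S :: "nat \<Rightarrow> 'b"
    by (simp add: power2_eq_square sum_product)
  show "integrable (sample_law n D) (\<lambda>S. (\<Sum>i<n. V (S i))\<^sup>2)"
    unfolding sq using int by (intro Bochner_Integration.integrable_sum) auto
  have "(\<integral>S. (\<Sum>i<n. V (S i))\<^sup>2 \<partial>sample_law n D) = (\<Sum>i<n. \<Sum>j<n. \<integral>S. V (S i) * V (S j) \<partial>sample_law n D)"
    unfolding sq using int
    by (subst Bochner_Integration.integral_sum) (auto intro!: Bochner_Integration.integrable_sum sum.cong Bochner_Integration.integral_sum)
  also have "\<dots> = (\<Sum>i<n. \<Sum>j<n. if i = j then (\<integral>w. (V w)\<^sup>2 \<partial>D) else 0)"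
    by (intro sum.cong refl) (use val in auto)
  also have "\<dots> = n * (\<integral>w. (V w)\<^sup>2 \<partial>D)" by (simp add: sum.delta)
  finally show "(\<integral>S. (\<Sum>i<n. V (S i))\<^sup>2 \<partial>sample_law n D) = n * (\<integral>w. (V w)\<^sup>2 \<partial>D)" .
qed

text \<open>Layer-cake formula: the tail C / t keeps 2 t P(|Z| >= t) bounded, so the second moment
  grows linearly in \<open>T\<close> instead of quadratically. The constant C + 1 also covers t < 1,
  where the probability is only bounded by 1.\<close>

lemma truncated_second_moment:
  fixes Z :: "'b \<Rightarrow> real"
  assumes "prob_space D" and Z[measurable]: "Z \<in> borel_measurable D"
    and C: "\<And>t. 1 \<le> t \<Longrightarrow> measure D {w \<in> space D. t \<le> \<bar>Z w\<bar>} \<le> C / t" and T: "1 \<le> T"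
  shows "(\<integral>w. (Z w * indicator {w. \<bar>Z w\<bar> < T} w)\<^sup>2 \<partial>D) \<le> 2 * (C + 1) * T"
proof -
  interpret D: prob_space D by fact
  interpret pair_sigma_finite D lborel ..
  have C0: "0 \<le> C" using C[of 1] measure_nonneg[of D] by (smt (verit) div_by_1)
  have tail: "2 * t * measure D {w \<in> space D. t \<le> \<bar>Z w\<bar>} \<le> 2 * (C + 1)" if "0 \<le> t" for t
  proof (cases "1 \<le> t")
    case True
    then have "t * measure D {w \<in> space D. t \<le> \<bar>Z w\<bar>} \<le> C" using C[OF True] by (simp add: field_simps)
    then show ?thesis by simp
  next
    case False
    then have "t * measure D {w \<in> space D. t \<le> \<bar>Z w\<bar>} \<le> 1 * 1" using that by (intro mult_mono) auto
    then show ?thesis using C0 by simp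
  qed
  let ?V = "\<lambda>w. (Z w * indicator {w. \<bar>Z w\<bar> < T} w)\<^sup>2"
  let ?g = "\<lambda>w t. ennreal (2 * t) * indicator {w. \<bar>Z w\<bar> < T} w * indicator {0..\<bar>Z w\<bar>} t"
  have "(\<integral>\<^sup>+w. ennreal (?V w) \<partial>D) = (\<integral>\<^sup>+w. (\<integral>\<^sup>+t. ?g w t \<partial>lborel) \<partial>D)"
  proof (rule nn_integral_cong)
    fix w
    have "(\<integral>\<^sup>+t. ennreal (2 * t) * indicator {0..\<bar>Z w\<bar>} t \<partial>lborel) = ennreal (\<bar>Z w\<bar>\<^sup>2 - 0\<^sup>2)"
      by (rule nn_integral_FTC_Icc) (auto intro!: derivative_eq_intros)
    then show "ennreal (?V w) = (\<integral>\<^sup>+t. ?g w t \<partial>lborel)"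
      by (cases "\<bar>Z w\<bar> < T") auto
  qed
  also have "\<dots> = (\<integral>\<^sup>+t. (\<integral>\<^sup>+w. ?g w t \<partial>D) \<partial>lborel)"
  proof (rule Fubini'[symmetric])
    have [measurable]: "Measurable.pred (D \<Otimes>\<^sub>M lborel) (\<lambda>x. snd x \<in> {0..\<bar>Z (fst x)\<bar>})"
      unfolding atLeastAtMost_iff by measurable
    show "(\<lambda>(w, t). ?g w t) \<in> borel_measurable (D \<Otimes>\<^sub>M lborel)" by measurable
  qed
  also have "\<dots> \<le> (\<integral>\<^sup>+t. ennreal (2 * (C + 1)) * indicator {0..T} t \<partial>lborel)"
  proof (rule nn_integral_mono)
    fix t :: real
    show "(\<integral>\<^sup>+w. ?g w t \<partial>D) \<le> ennreal (2 * (C + 1)) * indicator {0..T} t"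
    proof (cases "0 \<le> t \<and> t \<le> T")
      case True
      have "(\<integral>\<^sup>+w. ?g w t \<partial>D) \<le> (\<integral>\<^sup>+w. ennreal (2 * t) * indicator {w \<in> space D. t \<le> \<bar>Z w\<bar>} w \<partial>D)"
        by (rule nn_integral_mono) (auto simp: indicator_def)
      also have "\<dots> = ennreal (2 * t) * emeasure D {w \<in> space D. t \<le> \<bar>Z w\<bar>}"
        by (rule nn_integral_cmult_indicator) measurable
      also have "\<dots> = ennreal (2 * t * measure D {w \<in> space D. t \<le> \<bar>Z w\<bar>})"
        using True by (simp add: D.emeasure_eq_measure ennreal_mult)
      also have "\<dots> \<le> ennreal (2 * (C + 1))" using tail True by (intro ennreal_leI) auto
      finally show ?thesis using True by simp
    next
      case False
      then have z: "?g w t = 0" for w by (auto simp: indicator_def)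
      show ?thesis unfolding z by simp
    qed
  qed
  also have "\<dots> = ennreal (2 * (C + 1) * T)"
    using T C0 by (simp add: nn_integral_cmult_indicator ennreal_mult)
  finally have "(\<integral>\<^sup>+w. ennreal (?V w) \<partial>D) \<le> ennreal (2 * (C + 1) * T)" .
  then show ?thesis using C0 T
    by (intro integral_real_bounded) auto
qed

text \<open>Layer-cake formula for a signed variable: the truncated mean is the integral over 0 <= t
  <= T of the mean of Y on t < W < T. The levels from \<open>t1\<close> on contribute \<beta> ln T,
  those below cost at most (\<beta> + 1) t1, and removing W >= T costs at most T P(W >= T) <=
  M.\<close>

lemma truncated_mean_ge_log:
  fixes Y W :: "'b \<Rightarrow> real"
  assumes "prob_space D" and Y[measurable]: "Y \<in> borel_measurable D" and W[measurable]: "W \<in> borel_measurable D"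
    and sY: "\<And>w. w \<in> space D \<Longrightarrow> \<bar>Y w\<bar> = 1" and W0: "\<And>w. 0 \<le> W w"
    and \<beta>: "0 \<le> \<beta>" and t1: "1 \<le> t1"
    and level: "\<And>t. t1 \<le> t \<Longrightarrow> \<beta> / t \<le> (\<integral>w. indicator {w. t < W w} w * Y w \<partial>D)"
    and tail: "\<And>t. 1 \<le> t \<Longrightarrow> measure D {w \<in> space D. t \<le> W w} \<le> M / t" and T: "1 \<le> T"
  shows "\<beta> * ln T - ((\<beta> + 1) * t1 + M) \<le> (\<integral>w. Y w * W w * indicator {w. W w < T} w \<partial>D)"
proof -
  interpret prob_space D by fact
  let ?R = "restrict_space lborel {0..T} :: real measure"
  interpret R: finite_measure ?R
    by (rule finite_measureI) (use T in \<open>simp add: emeasure_restrict_space space_restrict_space\<close>)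
  interpret DR: pair_sigma_finite D ?R ..
  interpret DRf: finite_measure "D \<Otimes>\<^sub>M ?R" by (intro finite_measure_pair_measure R.finite_measure_axioms finite_measure_axioms)
  define g where "g w t = (if t < W w \<and> W w < T then Y w else 0)" for w and t :: real
  have gb: "\<bar>g w t\<bar> \<le> 1" if "w \<in> space D" for w t using sY[OF that] by (simp add: g_def)
  have idm[measurable]: "(\<lambda>t. t) \<in> borel_measurable ?R" by (intro measurable_restrict_space1) simp
  have gm[measurable]: "(\<lambda>(w, t). g w t) \<in> borel_measurable (D \<Otimes>\<^sub>M ?R)"
    unfolding g_def by measurable
  have gi: "integrable (D \<Otimes>\<^sub>M ?R) (\<lambda>(w, t). g w t)"
    by (rule DRf.integrable_const_bound[where B = 1]) (use gb in \<open>auto simp: space_pair_measure\<close>)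
  define p where "p = measure D {w \<in> space D. T \<le> W w}"
  have pC: "p * T \<le> M" using tail T by (simp add: p_def field_simps)
  have p0: "0 \<le> p" by (simp add: p_def)
  \<comment> \<open>a lower bound for the mean above level \<open>t\<close>, valid also below \<open>t1\<close> and easy to integrate\<close>
  define l where "l t = \<beta> / (t + 1) - (\<beta> + 1) * indicator {..<t1} t - p" for t :: real
  have lower: "l t \<le> (\<integral>w. g w t \<partial>D)" if t: "0 \<le> t" for t
  proof -
    have i1: "integrable D (\<lambda>w. indicator {w. t < W w} w * Y w)"
      by (rule integrable_const_bound[where B = 1]) (use sY in \<open>auto intro!: AE_I2 simp: indicator_def\<close>)
    have i2: "integrable D (indicat_real {w \<in> space D. T \<le> W w})"
      by (rule integrable_const_bound[where B = 1]) auto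
    have i3: "integrable D (\<lambda>w. g w t)"
      by (rule integrable_const_bound[where B = 1]) (use gb in \<open>auto simp: g_def\<close>)
    have "(\<integral>w. indicator {w. t < W w} w * Y w - indicator {w \<in> space D. T \<le> W w} w \<partial>D) \<le> (\<integral>w. g w t \<partial>D)"
    proof (rule integral_mono[OF Bochner_Integration.integrable_diff[OF i1 i2] i3])
      fix w assume w: "w \<in> space D"
      show "indicator {w. t < W w} w * Y w - indicator {w \<in> space D. T \<le> W w} w \<le> g w t"
        using sY[OF w] w by (auto simp: g_def indicator_def)
    qed
    then have 1: "(\<integral>w. indicator {w. t < W w} w * Y w \<partial>D) - p \<le> (\<integral>w. g w t \<partial>D)"
      by (subst (asm) Bochner_Integration.integral_diff[OF i1 i2]) (simp add: p_def)
    have "\<beta> / (t + 1) - (\<beta> + 1) * indicator {..<t1} t \<le> (\<integral>w. indicator {w. t < W w} w * Y w \<partial>D)"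
    proof (cases "t1 \<le> t")
      case True
      have "\<beta> / (t + 1) \<le> \<beta> / t" using True t1 \<beta> by (intro divide_left_mono) auto
      then show ?thesis using level[OF True] True by simp
    next
      case False
      have "\<beta> / (t + 1) \<le> \<beta>" using \<beta> t by (simp add: divide_le_eq mult_le_cancel_left1)
      moreover have "- 1 \<le> (\<integral>w. indicator {w. t < W w} w * Y w \<partial>D)"
      proof -
        have "(\<integral>w. - 1 \<partial>D) \<le> (\<integral>w. indicator {w. t < W w} w * Y w \<partial>D)"
        proof (rule integral_mono[OF _ i1])
          fix w assume "w \<in> space D"
          then show "- 1 \<le> indicator {w. t < W w} w * Y w"
            using sY[of w] by (auto simp: indicator_def abs_if split: if_splits)
        qed simp
        then show ?thesis by (simp add: prob_space)
      qed
      ultimately show ?thesis using False by simp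
    qed
    then show ?thesis using 1 by (simp add: l_def)
  qed
  have "{..<t1} \<in> sets borel" by simp
  then have lm: "l \<in> borel_measurable borel" unfolding l_def[abs_def] by measurable
  have "(\<integral>t. l t \<partial>?R) \<le> (\<integral>t. (\<integral>w. g w t \<partial>D) \<partial>?R)"
  proof (rule integral_mono)
    show "integrable ?R l"
    proof (rule R.integrable_const_bound[where B = "\<beta> + (\<beta> + 1) + p"])
      have "\<bar>l t\<bar> \<le> \<beta> + (\<beta> + 1) + p" if "0 \<le> t" for t
      proof -
        have "0 \<le> \<beta> / (t + 1)" "\<beta> / (t + 1) \<le> \<beta>" using \<beta> that by (auto simp: divide_le_eq mult_le_cancel_left1)
        then show ?thesis using \<beta> p0 by (auto simp: l_def indicator_def abs_le_iff)
      qed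
      then show "AE t in ?R. norm (l t) \<le> \<beta> + (\<beta> + 1) + p" by (auto simp: space_restrict_space)
    qed (use lm in \<open>intro measurable_restrict_space1, simp\<close>)
    show "integrable ?R (\<lambda>t. \<integral>w. g w t \<partial>D)" using DR.integrable_snd[OF gi] by simp
  qed (use lower in \<open>auto simp: space_restrict_space\<close>)
  also have "\<dots> = (\<integral>w. (\<integral>t. g w t \<partial>?R) \<partial>D)" by (rule DR.Fubini_integral[OF gi])
  also have "\<dots> = (\<integral>w. Y w * W w * indicator {w. W w < T} w \<partial>D)"
  proof (rule Bochner_Integration.integral_cong[OF refl])
    fix w
    show "(\<integral>t. g w t \<partial>?R) = Y w * W w * indicator {w. W w < T} w"
    proof (cases "W w < T")
      case True
      have "(\<integral>t. g w t \<partial>?R) = (\<integral>t. Y w * indicator {0..<W w} t \<partial>lborel)"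
        by (subst integral_restrict_space, simp, rule Bochner_Integration.integral_cong)
          (use True in \<open>auto simp: g_def indicator_def\<close>)
      also have "\<dots> = Y w * W w" using W0[of w] by simp
      finally show ?thesis using True by simp
    qed (simp add: g_def)
  qed
  finally have up: "(\<integral>t. l t \<partial>?R) \<le> (\<integral>w. Y w * W w * indicator {w. W w < T} w \<partial>D)" .
  have F1: "has_bochner_integral lborel (\<lambda>t. \<beta> / (t + 1) * indicator {0..T} t) (\<beta> * ln (T + 1) - \<beta> * ln (0 + 1))"
    by (rule has_bochner_integral_FTC_Icc_nonneg) (use T \<beta> in \<open>auto intro!: derivative_eq_intros continuous_intros\<close>)
  have "(\<integral>t. l t \<partial>?R) = (\<integral>t. \<beta> / (t + 1) * indicator {0..T} t - (\<beta> + 1) * indicator ({0..T} \<inter> {..<t1}) t - p * indicator {0..T} t \<partial>lborel)"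
    by (subst integral_restrict_space) (auto intro!: Bochner_Integration.integral_cong simp: l_def indicator_def)
  also have "\<dots> = \<beta> * ln (T + 1) - (\<beta> + 1) * measure lborel ({0..T} \<inter> {..<t1}) - p * T"
  proof -
    have "emeasure lborel ({0..T} \<inter> {..<t1}) \<le> emeasure lborel {0..T}" by (rule emeasure_mono) auto
    then have "emeasure lborel ({0..T} \<inter> {..<t1}) < \<infinity>" using T by (auto simp: le_less_trans)
    then have ia: "integrable lborel (\<lambda>t. (\<beta> + 1) * indicat_real ({0..T} \<inter> {..<t1}) t)"
      by (intro integrable_mult_right) (simp add: integrable_indicator_iff)
    have ib: "integrable lborel (\<lambda>t. p * indicat_real {0..T} t)"
      using T by (intro integrable_mult_right) (simp add: integrable_indicator_iff)
    note i0 = F1[THEN integrable.intros]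
    show ?thesis
      unfolding Bochner_Integration.integral_diff[OF Bochner_Integration.integrable_diff[OF i0 ia] ib]
        Bochner_Integration.integral_diff[OF i0 ia] has_bochner_integral_integral_eq[OF F1]
      using T by simp
  qed
  also have "\<dots> \<ge> \<beta> * ln T - (\<beta> + 1) * t1 - M"
  proof -
    have "measure lborel ({0..T} \<inter> {..<t1}) \<le> measure lborel {0..t1}"
      using t1 by (intro measure_mono_fmeasurable) (auto simp: fmeasurable_def)
    then have "(\<beta> + 1) * measure lborel ({0..T} \<inter> {..<t1}) \<le> (\<beta> + 1) * t1" using \<beta> t1 by (intro mult_left_mono) auto
    moreover have "\<beta> * ln T \<le> \<beta> * ln (T + 1)" using T \<beta> by (intro mult_left_mono) auto
    ultimately show ?thesis using pC by linarith
  qed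
  finally show ?thesis using up by linarith
qed

section \<open>Truncation and Chebyshev's inequality\<close>

lemma sample_coordinate_measure:
  assumes "prob_space D" "A \<in> sets D" "i < n"
  shows "measure (sample_law n D) {S \<in> space (sample_law n D). S i \<in> A} = measure D A"
proof -
  interpret P: product_prob_space "\<lambda>_. D" "{..<n}" by (rule product_prob_space_const) fact
  have "emeasure (Pi\<^sub>M {..<n} (\<lambda>_. D)) {S \<in> space (Pi\<^sub>M {..<n} (\<lambda>_. D)). S i \<in> A} = emeasure D A"
    using assms by (intro P.emeasure_PiM_Collect_single) auto
  then show ?thesis by (simp add: sample_law_def measure_def)
qed

lemma prob_space_sample_law: "prob_space D \<Longrightarrow> prob_space (sample_law n D)"
  unfolding sample_law_def by (intro prob_space_PiM)

text \<open>Unless some |Z_i| reaches \<open>T\<close>, which accounts for the first summand, the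
  sum equals the truncated one. The latter has mean n m > 0, and being non-positive it deviates from
  it by at least n m.\<close>

lemma sum_nonpos_bound:
  fixes Z :: "'b \<Rightarrow> real"
  assumes D: "prob_space D" and Z[measurable]: "Z \<in> borel_measurable D"
    and C: "\<And>t. 1 \<le> t \<Longrightarrow> measure D {w \<in> space D. t \<le> \<bar>Z w\<bar>} \<le> C / t" and T: "1 \<le> T"
    and m: "m = (\<integral>w. Z w * indicator {w. \<bar>Z w\<bar> < T} w \<partial>D)" "0 < m" and n: "0 < n"
  shows "measure (sample_law n D) {S \<in> space (sample_law n D). (\<Sum>i<n. Z (S i)) \<le> 0}
     \<le> n * C / T + 2 * (C + 1) * T / (n * m\<^sup>2)"
proof -
  interpret D: prob_space D by fact
  interpret P: prob_space "sample_law n D" by (rule prob_space_sample_law[OF D])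
  let ?P = "sample_law n D"
  have [measurable]: "(\<lambda>S. S i) \<in> measurable ?P D" if "i < n" for i
    unfolding sample_law_def using that by (intro measurable_component_singleton) auto
  define V where "V w = Z w * indicator {w. \<bar>Z w\<bar> < T} w" for w
  have Vm[measurable]: "V \<in> borel_measurable D" unfolding V_def by measurable
  have Vb: "\<bar>V w\<bar> \<le> T" for w using T by (auto simp: V_def indicator_def)
  have Vi: "integrable D V" using Vb by (intro D.integrable_const_bound[where B = T]) auto
  have V2b: "(V w)\<^sup>2 \<le> T\<^sup>2" for w using Vb[of w] T by (metis abs_le_square_iff abs_of_nonneg order_trans zero_le_one)
  have Vi2: "integrable D (\<lambda>w. (V w)\<^sup>2)" using V2b by (intro D.integrable_const_bound[where B = "T\<^sup>2"]) auto
  define U where "U w = V w - m" for w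
  have Vm': "(\<integral>w. V w \<partial>D) = m" by (simp add: m V_def)
  have Ui: "integrable D U" unfolding U_def using Vi by simp
  have U2: "(U w)\<^sup>2 = (V w)\<^sup>2 - 2 * m * V w + m\<^sup>2" for w
    by (simp add: U_def power2_diff algebra_simps)
  have Ui2: "integrable D (\<lambda>w. (U w)\<^sup>2)" unfolding U2 using Vi Vi2 by simp
  have U0: "(\<integral>w. U w \<partial>D) = 0" unfolding U_def using Vi Vm' by (simp add: D.prob_space)
  have "(\<integral>w. (U w)\<^sup>2 \<partial>D) = (\<integral>w. (V w)\<^sup>2 \<partial>D) - m\<^sup>2"
    unfolding U2 using Vi Vi2 Vm' by (simp add: D.prob_space power2_eq_square)
  also have "\<dots> \<le> 2 * (C + 1) * T"
    using truncated_second_moment[OF D Z C T] by (simp add: V_def algebra_simps) (smt (verit) zero_le_power2)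
  finally have UV: "(\<integral>w. (U w)\<^sup>2 \<partial>D) \<le> 2 * (C + 1) * T" .
  let ?A = "{S \<in> space ?P. (\<Sum>i<n. Z (S i)) \<le> 0}"
  let ?B = "\<Union>i<n. {S \<in> space ?P. S i \<in> {w \<in> space D. T \<le> \<bar>Z w\<bar>}}"
  let ?C = "{S \<in> space ?P. (n * m)\<^sup>2 \<le> (\<Sum>i<n. U (S i))\<^sup>2}"
  have [measurable]: "U \<in> borel_measurable D" unfolding U_def by measurable
  have Bi: "{S \<in> space ?P. S i \<in> {w \<in> space D. T \<le> \<bar>Z w\<bar>}} \<in> sets ?P" if "i < n" for i
    using that by measurable
  have Cs: "?C \<in> sets ?P" by measurable
  have "?A \<subseteq> ?B \<union> ?C"
  proof
    fix S assume S: "S \<in> ?A"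
    show "S \<in> ?B \<union> ?C"
    proof (cases "\<exists>i<n. T \<le> \<bar>Z (S i)\<bar>")
      case True
      then obtain i where i: "i < n" "T \<le> \<bar>Z (S i)\<bar>" by blast
      have "S i \<in> space D" using S i by (auto simp: sample_law_def space_PiM)
      then show ?thesis using i S by auto
    next
      case False
      then have "V (S i) = Z (S i)" if "i < n" for i using that by (auto simp: V_def)
      then have "(\<Sum>i<n. V (S i)) \<le> 0" using S by simp
      then have "(\<Sum>i<n. U (S i)) \<le> - (n * m)" by (simp add: U_def sum_subtractf)
      then have "\<bar>n * m\<bar> \<le> \<bar>\<Sum>i<n. U (S i)\<bar>" using m by simp
      then show ?thesis using S by (simp add: abs_le_square_iff)
    qed
  qed
  then have "measure ?P ?A \<le> measure ?P (?B \<union> ?C)"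
    using Bi Cs by (intro P.finite_measure_mono) auto
  also have "\<dots> \<le> measure ?P ?B + measure ?P ?C"
    using Bi Cs by (intro measure_Un_le) auto
  also have "measure ?P ?B \<le> (\<Sum>i<n. measure ?P {S \<in> space ?P. S i \<in> {w \<in> space D. T \<le> \<bar>Z w\<bar>}})"
    using Bi by (intro P.finite_measure_subadditive_finite) auto
  also have "\<dots> = (\<Sum>i<n. measure D {w \<in> space D. T \<le> \<bar>Z w\<bar>})"
    by (intro sum.cong refl sample_coordinate_measure[OF D]) auto
  also have "\<dots> \<le> n * (C / T)" unfolding sum_constant card_lessThan using C[OF T] by (intro mult_left_mono) auto
  also have "measure ?P ?C \<le> (\<integral>S. (\<Sum>i<n. U (S i))\<^sup>2 \<partial>?P) / (n * m)\<^sup>2"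
    using n m sum_square_sample_law(1)[OF D Ui Ui2 U0, of n] by (intro integral_Markov_inequality_measure[where A = "{}"]) auto
  also have "\<dots> = n * (\<integral>w. (U w)\<^sup>2 \<partial>D) / (n * m)\<^sup>2"
    by (simp add: sum_square_sample_law(2)[OF D Ui Ui2 U0])
  also have "\<dots> \<le> n * (2 * (C + 1) * T) / (n * m)\<^sup>2"
    using UV by (intro divide_right_mono mult_left_mono) auto
  also have "\<dots> = 2 * (C + 1) * T / (n * m\<^sup>2)" using n by (simp add: power2_eq_square)
  finally show ?thesis by simp
qed

theorem weighted_vote_consistent:
  fixes Z :: "'b \<Rightarrow> real"
  assumes D: "prob_space D" and Z[measurable]: "Z \<in> borel_measurable D"
    and tail: "\<And>t. 1 \<le> t \<Longrightarrow> measure D {w \<in> space D. t \<le> \<bar>Z w\<bar>} \<le> C / t"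
    and mean: "\<And>T. 1 \<le> T \<Longrightarrow> c * ln T - B \<le> (\<integral>w. Z w * indicator {w. \<bar>Z w\<bar> < T} w \<partial>D)" and c: "0 < c"
  shows "(\<lambda>n. measure (sample_law n D) {S \<in> space (sample_law n D). (\<Sum>i<n. Z (S i)) \<le> 0}) \<longlonglongrightarrow> 0"
proof (rule tendsto_sandwich[OF always_eventually _ tendsto_const])
  have C0: "0 \<le> C" using tail[of 1] measure_nonneg[of D] by (smt (verit) div_by_1)
  have lln: "filterlim (\<lambda>n. ln (real n)) at_top sequentially"
    by (intro filterlim_compose[OF ln_at_top] filterlim_real_sequentially)
  show "(\<lambda>n. (C + 8 * (C + 1) / c\<^sup>2) / ln (real n)) \<longlonglongrightarrow> 0"
    by (intro real_tendsto_divide_at_top[OF tendsto_const lln])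
  show "\<forall>\<^sub>F n in sequentially. measure (sample_law n D) {S \<in> space (sample_law n D). (\<Sum>i<n. Z (S i)) \<le> 0}
      \<le> (C + 8 * (C + 1) / c\<^sup>2) / ln (real n)"
    using filterlim_at_top[THEN iffD1, OF lln, rule_format, of "max 1 (2 * B / c)"] eventually_gt_at_top[of 0]
  proof eventually_elim
    case (elim n)
    define l where "l = ln (real n)"
    have l: "1 \<le> l" "B \<le> c * l / 2" using elim c by (auto simp: l_def field_simps)
    \<comment> \<open>With l = ln n and m >= c l / 2, the errors n C / T and T / (n m^2) are both of
      order 1 / l. T = n would leave the first one constant, and T = n l^2 would not make the bound
      on the second one tend to 0.\<close>
    define T where "T = n * l"
    have nT: "real n \<le> T" using l elim by (simp add: T_def mult_le_cancel_left1)
    then have T1: "1 \<le> T" using elim by simp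
    define m where "m = (\<integral>w. Z w * indicator {w. \<bar>Z w\<bar> < T} w \<partial>D)"
    have "l \<le> ln T" unfolding l_def using nT elim by simp
    then have "c * l \<le> c * ln T" using c by simp
    then have m: "c * l / 2 \<le> m" using mean[OF T1] l by (simp add: m_def)
    have cl: "0 < c * l / 2" using c l by simp
    have "measure (sample_law n D) {S \<in> space (sample_law n D). (\<Sum>i<n. Z (S i)) \<le> 0}
        \<le> n * C / T + 2 * (C + 1) * T / (n * m\<^sup>2)"
      using m cl elim by (intro sum_nonpos_bound[OF D Z tail T1 m_def]) auto
    also have "2 * (C + 1) * T / (n * m\<^sup>2) \<le> 2 * (C + 1) * T / (n * (c * l / 2)\<^sup>2)"
      using m cl elim C0 T1 by (intro divide_left_mono mult_left_mono power_mono mult_pos_pos) auto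
    also have "2 * (C + 1) * T / (n * (c * l / 2)\<^sup>2) = 8 * (C + 1) / c\<^sup>2 / l"
      using elim l c by (simp add: T_def power2_eq_square field_simps)
    also have "n * C / T = C / l" using elim l by (simp add: T_def)
    finally show ?case by (simp add: add_divide_distrib l_def)
  qed
qed simp

section \<open>Infinite-depth limit of the kernel machine\<close>

text \<open>Cramer's rule for y A^(-1) k. As a rational function of the entries it makes limits and
  measurability immediate, and division by 0 reproduces the value 0 of \<open>ntk_predictor\<close>
  at a singular matrix.\<close>

definition kernel_predictor :: "nat \<Rightarrow> real mat \<Rightarrow> (nat \<Rightarrow> real) \<Rightarrow> (nat \<Rightarrow> real) \<Rightarrow> real" where
  "kernel_predictor n A y k = (\<Sum>i<n. \<Sum>j<n. y i * adj_mat A $$ (i, j) * k j) / det A"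

lemma kernel_predictor_eq_inverse:
  assumes A: "A \<in> carrier_mat n n"
  shows "(case mat_inverse A of
        Some B \<Rightarrow> scalar_prod (Matrix.vec n y) (B *\<^sub>v Matrix.vec n k) | None \<Rightarrow> 0) = kernel_predictor n A y k"
proof (cases "mat_inverse A")
  case None
  have "det A = 0"
    using mat_inverse(1)[OF A None, where b = "()"] det_non_zero_imp_unit[OF A, where b = "()"] by blast
  then show ?thesis using None by (simp add: kernel_predictor_def)
next
  case (Some B)
  from mat_inverse(2)[OF A Some] have B: "A * B = 1\<^sub>m n" "B * A = 1\<^sub>m n" "B \<in> carrier_mat n n" by auto
  have "det A * det B = 1" using det_mult[OF A B(3)] B(1) by simp
  then have d: "det A \<noteq> 0" by auto
  have aA: "adj_mat A \<in> carrier_mat n n" by (rule adj_mat(1)[OF A])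
  have "adj_mat A = (B * A) * adj_mat A" using aA B(2) by simp
  also have "\<dots> = B * (A * adj_mat A)" using A aA B(3) by (intro assoc_mult_mat) auto
  also have "\<dots> = B * (det A \<cdot>\<^sub>m 1\<^sub>m n)" by (simp add: adj_mat(2)[OF A])
  also have "\<dots> = det A \<cdot>\<^sub>m B" using mult_smult_distrib[OF B(3), of "1\<^sub>m n" n "det A"] B(3) by simp
  finally have "adj_mat A = det A \<cdot>\<^sub>m B" .
  then have "adj_mat A $$ (i, j) = det A * B $$ (i, j)" if "i < n" "j < n" for i j
    using that B(3) by simp
  then have eB: "B $$ (i, j) = adj_mat A $$ (i, j) / det A" if "i < n" "j < n" for i j
    using that d by simp
  have "scalar_prod (Matrix.vec n y) (B *\<^sub>v Matrix.vec n k) = (\<Sum>i<n. y i * (\<Sum>j<n. B $$ (i, j) * k j))"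
    using B(3) by (auto simp: scalar_prod_def lessThan_atLeast0 intro!: sum.cong)
  also have "\<dots> = (\<Sum>i<n. \<Sum>j<n. y i * (B $$ (i, j) * k j))" by (simp add: sum_distrib_left)
  also have "\<dots> = (\<Sum>i<n. \<Sum>j<n. y i * adj_mat A $$ (i, j) * k j / det A)"
    by (intro sum.cong refl) (simp add: eB)
  also have "\<dots> = kernel_predictor n A y k" by (simp add: kernel_predictor_def sum_divide_distrib)
  finally show ?thesis using Some by simp
qed

section \<open>Continuity, measurability and scaling of the predictor\<close>

lemma adj_mat_index:
  assumes "A \<in> carrier_mat n n" "i < n" "j < n"
  shows "adj_mat A $$ (i, j) = (-1) ^ (j + i) * det (mat_delete A j i)"
  using assms by (simp add: adj_mat_def cofactor_def)

lemma mat_delete_index: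
  assumes "A \<in> carrier_mat n n" "i' < n - 1" "j' < n - 1"
  shows "mat_delete A i j $$ (i', j') = A $$ (if i' < i then i' else Suc i', if j' < j then j' else Suc j')"
  using assms by (simp add: mat_delete_def)

lemma tendsto_det:
  fixes A :: "'b \<Rightarrow> real mat"
  assumes A: "\<And>L. A L \<in> carrier_mat n n" and B: "B \<in> carrier_mat n n"
    and lim: "\<And>i j. i < n \<Longrightarrow> j < n \<Longrightarrow> ((\<lambda>L. A L $$ (i, j)) \<longlongrightarrow> B $$ (i, j)) F"
  shows "((\<lambda>L. det (A L)) \<longlongrightarrow> det B) F"
  unfolding det_def'[OF A] det_def'[OF B]
  by (intro tendsto_sum tendsto_mult tendsto_const tendsto_prod lim) (auto dest: permutes_in_image)

lemma measurable_det:
  fixes A :: "'b \<Rightarrow> real mat"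
  assumes A: "\<And>L. A L \<in> carrier_mat n n"
    and m: "\<And>i j. i < n \<Longrightarrow> j < n \<Longrightarrow> (\<lambda>L. A L $$ (i, j)) \<in> borel_measurable M"
  shows "(\<lambda>L. det (A L)) \<in> borel_measurable M"
  unfolding det_def'[OF A]
  by (intro borel_measurable_sum borel_measurable_times borel_measurable_const borel_measurable_prod m)
     (auto dest: permutes_in_image)

lemma tendsto_kernel_predictor:
  fixes A :: "'b \<Rightarrow> real mat"
  assumes A: "\<And>L. A L \<in> carrier_mat n n"
    and lim: "\<And>i j. i < n \<Longrightarrow> j < n \<Longrightarrow> ((\<lambda>L. A L $$ (i, j)) \<longlongrightarrow> (if i = j then 1 else 0)) F"
    and k: "\<And>i. i < n \<Longrightarrow> ((\<lambda>L. k L i) \<longlongrightarrow> w i) F"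
  shows "((\<lambda>L. kernel_predictor n (A L) y (k L)) \<longlongrightarrow> (\<Sum>i<n. y i * w i)) F"
proof -
  let ?I = "1\<^sub>m n :: real mat"
  have I: "?I \<in> carrier_mat n n" by simp
  have lim': "((\<lambda>L. A L $$ (i, j)) \<longlongrightarrow> ?I $$ (i, j)) F" if "i < n" "j < n" for i j
    using lim[OF that] that by simp
  have d: "((\<lambda>L. det (A L)) \<longlongrightarrow> 1) F" using tendsto_det[OF A I lim'] by simp
  have "adj_mat ?I = ?I * adj_mat ?I" using adj_mat(1)[OF I] by simp
  then have "adj_mat ?I = 1 \<cdot>\<^sub>m ?I" using adj_mat(2)[OF I] by simp
  also have "\<dots> = ?I" by (intro eq_matI) auto
  finally have aI: "adj_mat ?I = ?I" .
  have adj: "((\<lambda>L. adj_mat (A L) $$ (i, j)) \<longlongrightarrow> (if i = j then 1 else 0)) F" if ij: "i < n" "j < n" for i j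
  proof -
    have "((\<lambda>L. (-1) ^ (j + i) * det (mat_delete (A L) j i)) \<longlongrightarrow> (-1) ^ (j + i) * det (mat_delete ?I j i)) F"
    proof (intro tendsto_mult tendsto_const tendsto_det[where n = "n - 1"] mat_delete_carrier A I)
      fix i' j' assume "i' < n - 1" "j' < n - 1"
      then show "((\<lambda>L. mat_delete (A L) j i $$ (i', j')) \<longlongrightarrow> mat_delete ?I j i $$ (i', j')) F"
        unfolding mat_delete_index[OF A \<open>i' < n - 1\<close> \<open>j' < n - 1\<close>] mat_delete_index[OF I \<open>i' < n - 1\<close> \<open>j' < n - 1\<close>]
        by (intro lim') auto
    qed
    then have "((\<lambda>L. adj_mat (A L) $$ (i, j)) \<longlongrightarrow> adj_mat ?I $$ (i, j)) F"
      unfolding adj_mat_index[OF A ij] adj_mat_index[OF I ij] .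
    then show ?thesis unfolding aI using ij by simp
  qed
  have "((\<lambda>L. kernel_predictor n (A L) y (k L)) \<longlongrightarrow> (\<Sum>i<n. \<Sum>j<n. y i * (if i = j then 1 else 0) * w j) / 1) F"
    unfolding kernel_predictor_def
    by (intro tendsto_divide tendsto_sum tendsto_mult tendsto_const adj k d) auto
  also have "(\<Sum>i<n. \<Sum>j<n. y i * (if i = j then 1 else 0) * w j) / 1 = (\<Sum>i<n. y i * w i)"
    by (simp add: if_distrib if_distribR sum.delta cong: if_cong)
  finally show ?thesis .
qed

lemma measurable_kernel_predictor:
  fixes A :: "'b \<Rightarrow> real mat"
  assumes A: "\<And>L. A L \<in> carrier_mat n n"
    and m: "\<And>i j. i < n \<Longrightarrow> j < n \<Longrightarrow> (\<lambda>L. A L $$ (i, j)) \<in> borel_measurable M"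
    and y: "\<And>i. i < n \<Longrightarrow> (\<lambda>L. y L i) \<in> borel_measurable M"
    and k: "\<And>i. i < n \<Longrightarrow> (\<lambda>L. k L i) \<in> borel_measurable M"
  shows "(\<lambda>L. kernel_predictor n (A L) (y L) (k L)) \<in> borel_measurable M"
proof -
  have adj: "(\<lambda>L. adj_mat (A L) $$ (i, j)) \<in> borel_measurable M" if ij: "i < n" "j < n" for i j
    unfolding adj_mat_index[OF A ij]
  proof (intro borel_measurable_times borel_measurable_const measurable_det[where n = "n - 1"] mat_delete_carrier A)
    fix i' j' assume "i' < n - 1" "j' < n - 1"
    then show "(\<lambda>L. mat_delete (A L) j i $$ (i', j')) \<in> borel_measurable M"
      unfolding mat_delete_index[OF A \<open>i' < n - 1\<close> \<open>j' < n - 1\<close>] by (intro m) auto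
  qed
  show ?thesis unfolding kernel_predictor_def
    by (intro borel_measurable_divide borel_measurable_sum borel_measurable_times adj y k measurable_det[OF A] m) auto
qed

text \<open>The adjugate scales with c^(n - 1) and the determinant with c^n. For n = 0 both sides
  are 0.\<close>

lemma kernel_predictor_smult:
  assumes A: "A \<in> carrier_mat n n" and c: "c \<noteq> 0"
  shows "kernel_predictor n (c \<cdot>\<^sub>m A) y k = kernel_predictor n A y k / c"
proof (cases n)
  case 0 then show ?thesis by (simp add: kernel_predictor_def)
next
  case (Suc m)
  have cA: "c \<cdot>\<^sub>m A \<in> carrier_mat n n" using A by simp
  have "mat_delete (c \<cdot>\<^sub>m A) j i = c \<cdot>\<^sub>m mat_delete A j i" for i j
    using A by (intro eq_matI) (auto simp: mat_delete_def)
  then have adj: "adj_mat (c \<cdot>\<^sub>m A) $$ (i, j) = c ^ m * adj_mat A $$ (i, j)" if "i < n" "j < n" for i j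
    using that A Suc mat_delete_carrier[OF A, of j i] by (simp add: adj_mat_index[OF A] adj_mat_index[OF cA])
  have "(\<Sum>i<n. \<Sum>j<n. y i * adj_mat (c \<cdot>\<^sub>m A) $$ (i, j) * k j)
      = c ^ m * (\<Sum>i<n. \<Sum>j<n. y i * adj_mat A $$ (i, j) * k j)"
    unfolding sum_distrib_left by (intro sum.cong refl) (simp add: adj mult_ac)
  then show ?thesis using A Suc c by (simp add: kernel_predictor_def)
qed

lemma kernel_predictor_scale_right: "kernel_predictor n A y (\<lambda>i. c * k i) = c * kernel_predictor n A y k"
  by (simp add: kernel_predictor_def sum_distrib_left mult_ac)

lemma kernel_predictor_cong:
  "(\<And>i. i < n \<Longrightarrow> k i = k' i) \<Longrightarrow> kernel_predictor n A y k = kernel_predictor n A y k'"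
  by (simp add: kernel_predictor_def)

lemma ntk_predictor_eq:
  "ntk_predictor \<phi> L n S x = kernel_predictor n (ntk_gram \<phi> L n S) (\<lambda>i. snd (S i)) (\<lambda>i. ntk \<phi> L (inner (fst (S i)) x))"
  unfolding ntk_predictor_def ntk_cross_def
  by (rule kernel_predictor_eq_inverse) (simp add: ntk_gram_def)

text \<open>\<open>F\<close> and \<open>F'\<close> are Borel functions on the whole line that stand
  in for the dual activation and its derivative, with which they agree on [-1, 1].\<close>

locale deep_ntk = depth_map +
  fixes \<phi> :: "real \<Rightarrow> real"
  assumes dual: "\<And>z. z \<in> {-1..1} \<Longrightarrow> dual_act \<phi> z = F z"
    and dual_deriv: "\<And>z. z \<in> {-1..1} \<Longrightarrow> dual_act_deriv \<phi> z = F' z"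
    and F_measurable [measurable]: "F \<in> borel_measurable borel" "F' \<in> borel_measurable borel"
begin

lemma dual_iter: "0 \<le> z \<Longrightarrow> z \<le> 1 \<Longrightarrow> (dual_act \<phi> ^^ k) z = (F ^^ k) z"
proof (induction k)
  case (Suc k)
  then show ?case using iter_range[of z k] iter_range1[of z k] by (simp add: dual)
qed simp

lemma ntk_rec:
  assumes "0 \<le> z" "z \<le> 1"
  shows "ntk \<phi> (Suc L) z = (F ^^ Suc L) z + ntk \<phi> L z * F' ((F ^^ L) z)"
  using assms iter_range[of z L] iter_range1[of z L] by (simp only: ntk.simps dual_iter) (simp add: dual_deriv)

lemma ntk_tendsto_psi:
  assumes "0 \<le> z" "z < 1"
  shows "(\<lambda>L. ntk \<phi> L z / (real L * a ^ L)) \<longlonglongrightarrow> psi z"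
  by (rule ntk_limit[OF assms]) (use assms ntk_rec in auto)

lemma ntk_one_ge: "1 \<le> ntk \<phi> L 1"
  by (rule ntk_diagonal) (use ntk_rec[of 1] in auto)

lemma ntk_tendsto_zero:
  assumes "0 \<le> z" "z < 1"
  shows "(\<lambda>L. ntk \<phi> L z / ntk \<phi> L 1) \<longlonglongrightarrow> 0"
proof -
  have "(\<lambda>L. real L * a ^ L) \<longlonglongrightarrow> 0" using a by (intro powser_times_n_limit_0) auto
  from tendsto_mult[OF ntk_tendsto_psi[OF assms] this]
  have "(\<lambda>L. ntk \<phi> L z / (real L * a ^ L) * (real L * a ^ L)) \<longlonglongrightarrow> 0" by simp
  \<comment> \<open>The cancellation needs L >= 1, as \<open>real L\<close> vanishes at L =
    0.\<close>
  then have "(\<lambda>L. ntk \<phi> L z) \<longlonglongrightarrow> 0"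
    by (rule Lim_transform_eventually, intro eventually_sequentiallyI[of 1]) (use a in auto)
  then show ?thesis
  proof (rule Lim_null_comparison[rotated, OF tendsto_norm_zero])
    show "\<forall>\<^sub>F L in sequentially. norm (ntk \<phi> L z / ntk \<phi> L 1) \<le> norm (ntk \<phi> L z)"
    proof (intro always_eventually allI)
      fix L show "norm (ntk \<phi> L z / ntk \<phi> L 1) \<le> norm (ntk \<phi> L z)"
        using ntk_one_ge[of L] by (simp add: abs_divide divide_le_eq mult_le_cancel_left1)
    qed
  qed
qed

text \<open>Two different normalisations are used: the Gram matrix is divided by its diagonal value
  and the cross vector by L a^L. For L >= 1 both factors are positive and leave the sign unchanged.
  A non-zero limit lies where \<open>sgn\<close> is continuous.\<close>

lemma depth_seq_tendsto:
  fixes x :: "'v::real_inner"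
  assumes diag: "\<And>i. i < n \<Longrightarrow> inner (fst (S i)) (fst (S i)) = 1"
    and off: "\<And>i j. i < n \<Longrightarrow> j < n \<Longrightarrow> i \<noteq> j \<Longrightarrow> 0 \<le> inner (fst (S i)) (fst (S j)) \<and> inner (fst (S i)) (fst (S j)) < 1"
    and test: "\<And>i. i < n \<Longrightarrow> 0 \<le> inner (fst (S i)) x \<and> inner (fst (S i)) x < 1"
    and nz: "(\<Sum>i<n. snd (S i) * psi (inner (fst (S i)) x)) \<noteq> 0"
  shows "depth_seq \<phi> n S x \<longlonglongrightarrow> sgn (\<Sum>i<n. snd (S i) * psi (inner (fst (S i)) x))"
proof -
  define A where "A L = inverse (ntk \<phi> L 1) \<cdot>\<^sub>m ntk_gram \<phi> L n S" for L
  have G: "ntk_gram \<phi> L n S \<in> carrier_mat n n" for L by (simp add: ntk_gram_def)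
  have A: "A L \<in> carrier_mat n n" for L using G by (simp add: A_def)
  have pos: "0 < ntk \<phi> L 1" for L using ntk_one_ge[of L] by simp
  let ?k = "\<lambda>L i. ntk \<phi> L (inner (fst (S i)) x)"
  have lim: "(\<lambda>L. A L $$ (i, j)) \<longlonglongrightarrow> (if i = j then 1 else 0)" if ij: "i < n" "j < n" for i j
  proof -
    have e: "A L $$ (i, j) = ntk \<phi> L (inner (fst (S i)) (fst (S j))) / ntk \<phi> L 1" for L
      using ij by (simp add: A_def ntk_gram_def divide_inverse mult.commute)
    show ?thesis
    proof (cases "i = j")
      case True
      have "A L $$ (i, j) = 1" for L unfolding e using diag[OF ij(1)] True pos[of L] by simp
      then show ?thesis using True by simp
    next
      case False
      then show ?thesis unfolding e using ntk_tendsto_zero off[OF ij False] by simp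
    qed
  qed
  let ?s = "\<Sum>i<n. snd (S i) * psi (inner (fst (S i)) x)"
  have main: "(\<lambda>L. kernel_predictor n (A L) (\<lambda>i. snd (S i)) (\<lambda>i. ?k L i / (real L * a ^ L))) \<longlonglongrightarrow> ?s"
    using test by (intro tendsto_kernel_predictor A lim ntk_tendsto_psi) auto
  have eq: "kernel_predictor n (A L) (\<lambda>i. snd (S i)) (\<lambda>i. ?k L i / (real L * a ^ L))
      = ntk \<phi> L 1 / (real L * a ^ L) * ntk_predictor \<phi> L n S x" for L
  proof -
    have "kernel_predictor n (A L) (\<lambda>i. snd (S i)) (\<lambda>i. ?k L i / (real L * a ^ L))
        = kernel_predictor n (A L) (\<lambda>i. snd (S i)) (\<lambda>i. (1 / (real L * a ^ L)) * ?k L i)"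
      by (rule kernel_predictor_cong) simp
    also have "\<dots> = ntk \<phi> L 1 / (real L * a ^ L) * ntk_predictor \<phi> L n S x"
      unfolding kernel_predictor_scale_right A_def ntk_predictor_eq using pos[of L]
      by (subst kernel_predictor_smult[OF G]) (auto simp: divide_inverse)
    finally show ?thesis .
  qed
  have "(\<lambda>L. sgn (kernel_predictor n (A L) (\<lambda>i. snd (S i)) (\<lambda>i. ?k L i / (real L * a ^ L)))) \<longlonglongrightarrow> sgn ?s"
    by (rule tendsto_sgn[OF main nz])
  then show ?thesis
  proof (rule Lim_transform_eventually)
    show "\<forall>\<^sub>F L in sequentially. sgn (kernel_predictor n (A L) (\<lambda>i. snd (S i)) (\<lambda>i. ?k L i / (real L * a ^ L))) = depth_seq \<phi> n S x L"
    proof (intro eventually_sequentiallyI[of 1])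
      fix L :: nat assume L: "1 \<le> L"
      have "0 < ntk \<phi> L 1 / (real L * a ^ L)" using pos[of L] L a by simp
      then have "sgn (ntk \<phi> L 1 / (real L * a ^ L)) = 1" by (rule sgn_pos)
      then show "sgn (kernel_predictor n (A L) (\<lambda>i. snd (S i)) (\<lambda>i. ?k L i / (real L * a ^ L))) = depth_seq \<phi> n S x L"
        unfolding eq depth_seq_def sgn_mult by (simp only: mult_1_left)
    qed
  qed
qed

text \<open>The kernel recursion for \<open>F\<close> and \<open>F'\<close>, a Borel function on the
  whole line. On [0, 1], where all inner products of points in the orthant lie, it is the
  kernel.\<close>

primrec ntk_map :: "nat \<Rightarrow> real \<Rightarrow> real" where
  "ntk_map 0 z = z"
| "ntk_map (Suc L) z = (F ^^ Suc L) z + ntk_map L z * F' ((F ^^ L) z)"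

lemma ntk_eq_map: "0 \<le> z \<Longrightarrow> z \<le> 1 \<Longrightarrow> ntk \<phi> L z = ntk_map L z"
  by (induction L) (simp_all only: ntk_map.simps ntk_rec, simp_all)

lemma iter_measurable [measurable]: "(F ^^ k) \<in> borel_measurable borel"
  by (induction k) (auto simp: id_def intro: measurable_comp)

lemma ntk_map_measurable [measurable]: "ntk_map L \<in> borel_measurable borel"
proof (induction L)
  case (Suc L)
  then show ?case unfolding ntk_map.simps[abs_def] by measurable
qed simp

lemma depth_seq_measurable:
  fixes x :: "'v::{real_inner, second_countable_topology}"
  assumes m: "\<And>i. i < n \<Longrightarrow> (\<lambda>S. S i) \<in> measurable M (borel \<Otimes>\<^sub>M borel)"
    and off: "\<And>S i j. S \<in> space M \<Longrightarrow> i < n \<Longrightarrow> j < n \<Longrightarrow> inner (fst (S i)) (fst (S j)) \<in> {0..1}"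
    and test: "\<And>S i. S \<in> space M \<Longrightarrow> i < n \<Longrightarrow> inner (fst (S i)) x \<in> {0..1}"
  shows "(\<lambda>S. depth_seq \<phi> n S x L) \<in> borel_measurable M"
proof -
  have fm[measurable]: "(\<lambda>S. fst (S i)) \<in> borel_measurable M" "(\<lambda>S. snd (S i)) \<in> borel_measurable M" if "i < n" for i
    using m[OF that] by (auto intro: measurable_compose[OF _ measurable_fst] measurable_compose[OF _ measurable_snd])
  define G where "G S = mat n n (\<lambda>(i, j). ntk_map L (inner (fst (S i)) (fst (S j))))" for S :: "nat \<Rightarrow> 'v \<times> real"
  have "(\<lambda>S. sgn (kernel_predictor n (G S) (\<lambda>i. snd (S i)) (\<lambda>i. ntk_map L (inner (fst (S i)) x)))) \<in> borel_measurable M"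
  proof (intro measurable_compose[OF measurable_kernel_predictor borel_measurable_sgn])
    show "G S \<in> carrier_mat n n" for S by (simp add: G_def)
    fix i j assume [measurable]: "i < n" "j < n"
    show "(\<lambda>S. G S $$ (i, j)) \<in> borel_measurable M"
      unfolding G_def using \<open>i < n\<close> \<open>j < n\<close> by simp
  qed measurable
  moreover have "depth_seq \<phi> n S x L = sgn (kernel_predictor n (G S) (\<lambda>i. snd (S i)) (\<lambda>i. ntk_map L (inner (fst (S i)) x)))"
    if "S \<in> space M" for S
  proof -
    have "ntk_gram \<phi> L n S = G S"
      unfolding ntk_gram_def G_def using off[OF that] by (intro eq_matI) (auto simp: ntk_eq_map)
    moreover have "kernel_predictor n (G S) (\<lambda>i. snd (S i)) (\<lambda>i. ntk \<phi> L (inner (fst (S i)) x))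
       = kernel_predictor n (G S) (\<lambda>i. snd (S i)) (\<lambda>i. ntk_map L (inner (fst (S i)) x))"
      using test[OF that] by (intro kernel_predictor_cong ntk_eq_map) auto
    ultimately show ?thesis by (simp add: depth_seq_def ntk_predictor_eq)
  qed
  ultimately show ?thesis by (subst measurable_cong) auto
qed

end

text \<open>Convergence is the Cauchy property, a countable combination of measurable conditions,
  and \<open>lim\<close> is measurable as a whole, also where the sequence diverges.\<close>

lemma error_event_measurable:
  assumes "\<And>L. (\<lambda>S. depth_seq \<phi> n S x L) \<in> borel_measurable (sample_law n D)"
  shows "error_event \<phi> n D \<eta> x \<epsilon> \<in> sets (sample_law n D)"
proof -
  let ?P = "sample_law n D" and ?X = "\<lambda>S. depth_seq \<phi> n S x"
  note [measurable] = assms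
  have C: "{S \<in> space ?P. Cauchy (?X S)} \<in> sets ?P"
    using sets_Collect_Cauchy[of "\<lambda>L S. ?X S L" ?P] assms by simp
  have l[measurable]: "(\<lambda>S. lim (?X S)) \<in> borel_measurable ?P"
    using borel_measurable_lim_metric[of "\<lambda>L S. ?X S L" ?P] assms by simp
  have "(\<lambda>S. infdist (lim (?X S)) (bayes_labels \<eta> x)) \<in> borel_measurable ?P"
    by (rule measurable_compose[OF l]) (intro borel_measurable_continuous_onI continuous_intros)
  then have "{S \<in> space ?P. infdist (lim (?X S)) (bayes_labels \<eta> x) > \<epsilon>} \<in> sets ?P" by measurable
  moreover have "error_event \<phi> n D \<eta> x \<epsilon> = (space ?P - {S \<in> space ?P. Cauchy (?X S)})
      \<union> {S \<in> space ?P. infdist (lim (?X S)) (bayes_labels \<eta> x) > \<epsilon>}"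
    by (auto simp: error_event_def deep_classifier_def Cauchy_convergent_iff)
  ultimately show ?thesis using C by auto
qed

section \<open>The law of the data near a point\<close>

lemma orthant_sphere_closed: "closed (orthant_sphere :: (real ^ 'n) set)"
proof -
  have e: "orthant_sphere = {x :: real ^ 'n. norm x = 1} \<inter> (\<Inter>i. {x. 0 \<le> x $ i})"
    by (auto simp: orthant_sphere_def)
  show ?thesis unfolding e
    by (intro closed_Int closed_INT ballI closed_Collect_eq closed_Collect_le continuous_intros)
qed

lemma orthant_sphere_borel [measurable]: "orthant_sphere \<in> sets borel"
  by (rule borel_closed[OF orthant_sphere_closed])

lemma sets_sphere_surface [simp, measurable_cong]: "sets sphere_surface = sets borel"
  by (simp add: sphere_surface_def)

lemma space_sphere_surface [simp]: "space sphere_surface = UNIV"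
  by (simp add: sphere_surface_def space_scale_measure)

locale sphere_law =
  fixes D :: "((real ^ 'n) \<times> real) measure"
    and f :: "real ^ 'n \<Rightarrow> ennreal"
    and \<eta> :: "real \<Rightarrow> real ^ 'n \<Rightarrow> real"
  assumes card_ge: "2 \<le> CARD('n)"
    and prob_D: "prob_space D"
    and sets_D: "sets D = sets (restrict_space borel (orthant_sphere \<times> {-1, 1}))"
    and law: "distributed D (restrict_space sphere_surface orthant_sphere) fst f"
    and label: "is_label_prob D \<eta>"
begin

sublocale prob_space D by (rule prob_D)

abbreviation "orth \<equiv> (orthant_sphere :: (real ^ 'n) set)"
abbreviation "surf \<equiv> (sphere_surface :: (real ^ 'n) measure)"

section \<open>The data law in ambient coordinates\<close>

lemma space_D: "space D = orth \<times> {-1, 1}"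
  using sets_eq_imp_space_eq[OF sets_D] by (simp add: space_restrict_space)

lemma fst_borel [measurable]: "fst \<in> borel_measurable D"
  unfolding measurable_cong_sets[OF sets_D refl]
  by (intro measurable_restrict_space1 borel_measurable_continuous_onI continuous_intros)

lemma snd_borel [measurable]: "snd \<in> borel_measurable D"
  unfolding measurable_cong_sets[OF sets_D refl]
  by (intro measurable_restrict_space1 borel_measurable_continuous_onI continuous_intros)

lemma fst_orth [measurable]: "fst \<in> measurable D (restrict_space borel orth)"
  using space_D by (intro measurable_restrict_space2) auto

lemma sets_restr: "sets (restrict_space surf orth) = sets (restrict_space borel orth)"
  by (rule sets_restrict_space_cong) simp

text \<open>A real density on the whole space, 0 off the orthant and at the negligible points where
  \<open>f\<close> is infinite, so that differentiation in the ambient space applies to it.\<close>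

definition dens :: "real ^ 'n \<Rightarrow> real" where
  "dens u = indicator orth u * enn2real (f u)"

lemma f_measurable: "f \<in> borel_measurable (restrict_space surf orth)"
  using law by (simp add: distributed_def)

lemma dens_measurable [measurable]: "dens \<in> borel_measurable borel"
proof -
  have "(\<lambda>u. enn2real (f u)) \<in> borel_measurable (restrict_space surf orth)"
    using f_measurable by measurable
  then show ?thesis
    unfolding dens_def[abs_def]
    by (subst (asm) borel_measurable_restrict_space_iff) (auto cong: measurable_cong_sets)
qed

lemma marginal_eq: "marginal D = density (restrict_space surf orth) f"
proof -
  have "marginal D = distr D (restrict_space surf orth) fst"
    unfolding marginal_def by (rule distr_cong) (auto simp: sets_restr)
  then show ?thesis using law by (simp add: distributed_def)
qed

lemma f_finite: "AE u in restrict_space surf orth. f u \<noteq> \<infinity>"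
proof (rule nn_integral_PInf_AE[OF f_measurable])
  interpret M: prob_space "marginal D"
    unfolding marginal_def by (rule prob_space_distr) simp
  have "orth \<in> sets (restrict_space surf orth)" by (simp add: sets_restr sets_restrict_space_iff)
  then have "(\<integral>\<^sup>+u. f u \<partial>restrict_space surf orth) = emeasure (marginal D) (space (marginal D))"
    unfolding marginal_eq using f_measurable
    by (subst emeasure_density) (auto intro!: nn_integral_cong simp: space_restrict_space)
  then show "(\<integral>\<^sup>+u. f u \<partial>restrict_space surf orth) \<noteq> \<infinity>" using M.emeasure_space_1 by simp
qed

lemma marginal_eq_real: "marginal D = density (restrict_space surf orth) (\<lambda>u. ennreal (enn2real (f u)))"
  unfolding marginal_eq
  by (rule density_cong) (use f_measurable f_finite in \<open>auto simp: less_top\<close>)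

text \<open>The marginal ignores surface null sets and charges only points of positive density. This
  positivity is what lets cap averages be bounded below later.\<close>

lemma AE_marginal:
  assumes "AE u in surf. Q u"
  shows "AE x in marginal D. Q x \<and> x \<in> orth \<and> 0 < dens x"
proof -
  have "AE x in restrict_space surf orth. Q x"
    using assms by (subst AE_restrict_space_iff) auto
  moreover have "AE x in restrict_space surf orth. x \<in> orth"
    by (subst AE_restrict_space_iff) auto
  ultimately have "AE x in restrict_space surf orth. 0 < f x \<longrightarrow> Q x \<and> x \<in> orth \<and> 0 < dens x"
    using f_finite
  proof eventually_elim
    case (elim x)
    then show ?case by (auto simp: dens_def enn2real_positive_iff less_top)
  qed
  then show ?thesis unfolding marginal_eq using f_measurable by (subst AE_density) auto
qed

text \<open>Polar coordinates: expectations over the inputs become Lebesgue integrals, over the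
  punctured unit ball, of functions of the direction.\<close>

lemma law_integral:
  fixes h :: "real ^ 'n \<Rightarrow> real"
  assumes h[measurable]: "h \<in> borel_measurable borel"
  shows "integrable D (\<lambda>w. h (fst w)) \<longleftrightarrow>
           integrable lborel (\<lambda>v. indicator (cball 0 1 - {0}) v * (dens (dir v) * h (dir v)))" (is ?A)
    and "(\<integral>w. h (fst w) \<partial>D)
           = CARD('n) * (\<integral>v. indicator (cball 0 1 - {0}) v * (dens (dir v) * h (dir v)) \<partial>lborel)" (is ?B)
proof -
  have hO: "h \<in> borel_measurable (restrict_space borel orth)" by (intro measurable_restrict_space1) simp
  have hR: "h \<in> borel_measurable (restrict_space surf orth)" using hO by (simp cong: measurable_cong_sets add: sets_restr)
  have gR: "(\<lambda>u. enn2real (f u)) \<in> borel_measurable (restrict_space surf orth)"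
    using f_measurable by measurable
  have [measurable]: "(\<lambda>u. dens u * h u) \<in> borel_measurable borel" by measurable
  let ?n = "\<lambda>v :: real ^ 'n. dir v"
  let ?R = "restrict_space lborel (cball 0 1 - {0}) :: (real ^ 'n) measure"
  have "integrable D (\<lambda>w. h (fst w)) \<longleftrightarrow> integrable (marginal D) h"
    unfolding marginal_def by (rule integrable_distr_eq[symmetric]) (use hO in auto)
  also have "\<dots> \<longleftrightarrow> integrable (restrict_space surf orth) (\<lambda>u. enn2real (f u) *\<^sub>R h u)"
    unfolding marginal_eq_real by (rule integrable_density) (use hR gR in auto)
  also have "\<dots> \<longleftrightarrow> integrable surf (\<lambda>u. dens u * h u)"
    by (subst integrable_restrict_space) (auto simp: dens_def mult.assoc)
  also have "\<dots> \<longleftrightarrow> integrable (distr ?R borel ?n) (\<lambda>u. real CARD('n) *\<^sub>R (dens u * h u))"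
    unfolding sphere_surface_density by (rule integrable_density) auto
  also have "\<dots> \<longleftrightarrow> integrable ?R (\<lambda>v. real CARD('n) * (dens (?n v) * h (?n v)))"
    by (subst integrable_distr_eq) auto
  also have "\<dots> \<longleftrightarrow> integrable ?R (\<lambda>v. dens (?n v) * h (?n v))" by (subst integrable_mult_left_iff) auto
  also have "\<dots> \<longleftrightarrow> integrable lborel (\<lambda>v. indicator (cball 0 1 - {0}) v * (dens (?n v) * h (?n v)))"
    by (subst integrable_restrict_space) auto
  finally show ?A .
  have "(\<integral>w. h (fst w) \<partial>D) = (\<integral>u. h u \<partial>marginal D)"
    unfolding marginal_def by (rule integral_distr[symmetric]) (use hO in auto)
  also have "\<dots> = (\<integral>u. enn2real (f u) *\<^sub>R h u \<partial>restrict_space surf orth)"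
    unfolding marginal_eq_real by (rule integral_density) (use hR gR in auto)
  also have "\<dots> = (\<integral>u. dens u * h u \<partial>surf)"
    by (subst integral_restrict_space) (auto simp: dens_def mult.assoc)
  also have "\<dots> = (\<integral>u. real CARD('n) *\<^sub>R (dens u * h u) \<partial>distr ?R borel ?n)"
    unfolding sphere_surface_density by (rule integral_density) auto
  also have "\<dots> = (\<integral>v. real CARD('n) * (dens (?n v) * h (?n v)) \<partial>?R)"
    by (subst integral_distr) auto
  also have "\<dots> = CARD('n) * (\<integral>v. dens (?n v) * h (?n v) \<partial>?R)" by simp
  also have "(\<integral>v. dens (?n v) * h (?n v) \<partial>?R)
      = (\<integral>v. indicator (cball 0 1 - {0}) v * (dens (?n v) * h (?n v)) \<partial>lborel)"
    by (subst integral_restrict_space) auto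
  finally show ?B .
qed

section \<open>Label probabilities and their margin\<close>

definition eta :: "real \<Rightarrow> real ^ 'n \<Rightarrow> real" where
  "eta c x = indicator orth x * \<eta> c x"

lemma eta_measurable: "c \<in> {-1, 1} \<Longrightarrow> eta c \<in> borel_measurable borel"
  using label unfolding is_label_prob_def eta_def[abs_def]
  by (auto simp: borel_measurable_restrict_space_iff)

text \<open>The defining property of conditional expectation, with a bounded function of the input
  as test function.\<close>

lemma label_integral:
  fixes h :: "real ^ 'n \<Rightarrow> real"
  assumes c: "c \<in> {-1, 1}" and h[measurable]: "h \<in> borel_measurable borel" and bound: "\<And>u. \<bar>h u\<bar> \<le> B"
  shows "integrable D (\<lambda>w. h (fst w) * eta c (fst w))"
    and "(\<integral>w. h (fst w) * indicator {w. snd w = c} w \<partial>D) = (\<integral>w. h (fst w) * eta c (fst w) \<partial>D)"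
proof -
  let ?O = "restrict_space borel orth"
  let ?F = "vimage_algebra (space D) fst ?O"
  let ?Y = "indicator {w \<in> space D. snd w = c} :: (real ^ 'n) \<times> real \<Rightarrow> real"
  have spO: "space ?O = orth" by (simp add: space_restrict_space)
  have im: "fst \<in> space D \<rightarrow> space ?O" using space_D spO by auto
  have sub: "subalgebra D ?F"
    unfolding subalgebra_def
  proof
    show "sets ?F \<subseteq> sets D"
      unfolding sets_vimage_algebra2[OF im] using measurable_sets[OF fst_orth] by auto
  qed simp
  interpret F: finite_measure_subalgebra D ?F by standard (rule sub)
  have hF: "(\<lambda>w. h (fst w)) \<in> borel_measurable ?F"
    by (rule measurable_compose[OF measurable_vimage_algebra1[OF im]]) (intro measurable_restrict_space1, simp)
  have Ym: "?Y \<in> borel_measurable D" by measurable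
  have int: "integrable D (\<lambda>w. h (fst w) * ?Y w)"
  proof (rule integrable_const_bound[where B = "\<bar>B\<bar>"])
    have "\<bar>h u * ?Y w\<bar> \<le> \<bar>B\<bar>" for u w using bound[of u] by (auto simp: indicator_def)
    then show "AE w in D. norm (h (fst w) * ?Y w) \<le> \<bar>B\<bar>" by simp
  qed (use Ym in measurable)
  have ae: "AE w in D. real_cond_exp D ?F ?Y w = eta c (fst w)"
  proof -
    have "AE w in D. real_cond_exp D ?F ?Y w = \<eta> c (fst w)" using label c unfolding is_label_prob_def by auto
    then show ?thesis by (rule AE_mp) (auto intro!: AE_I2 simp: eta_def space_D)
  qed
  have em: "eta c \<in> borel_measurable borel" by (rule eta_measurable[OF c])
  note cond = F.real_cond_exp_intg[OF int hF Ym]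
  have ae': "AE w in D. h (fst w) * real_cond_exp D ?F ?Y w = h (fst w) * eta c (fst w)" using ae by auto
  have m1: "(\<lambda>w. h (fst w) * real_cond_exp D ?F ?Y w) \<in> borel_measurable D" using cond(1) by simp
  have m2: "(\<lambda>w. h (fst w) * eta c (fst w)) \<in> borel_measurable D" using em by measurable
  show "integrable D (\<lambda>w. h (fst w) * eta c (fst w))"
    using cond(1) integrable_cong_AE[OF m1 m2 ae'] by simp
  have "(\<integral>w. h (fst w) * indicator {w. snd w = c} w \<partial>D) = (\<integral>w. h (fst w) * ?Y w \<partial>D)"
    by (rule Bochner_Integration.integral_cong) (auto simp: indicator_def)
  also have "\<dots> = (\<integral>w. h (fst w) * eta c (fst w) \<partial>D)"
    using cond(2) integral_cong_AE[OF m1 m2 ae'] by simp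
  finally show "(\<integral>w. h (fst w) * indicator {w. snd w = c} w \<partial>D) = (\<integral>w. h (fst w) * eta c (fst w) \<partial>D)" .
qed

text \<open>On the orthant sphere, a version of the conditional expectation of the label given the
  input; its sign is the Bayes decision.\<close>

definition margin :: "real ^ 'n \<Rightarrow> real" where
  "margin x = eta 1 x - eta (-1) x"

lemma margin_measurable [measurable]: "margin \<in> borel_measurable borel"
  unfolding margin_def[abs_def] using eta_measurable by measurable

lemma margin_integral:
  fixes h :: "real ^ 'n \<Rightarrow> real"
  assumes h[measurable]: "h \<in> borel_measurable borel" and bound: "\<And>u. \<bar>h u\<bar> \<le> B"
  shows "integrable D (\<lambda>w. h (fst w) * margin (fst w))"
    and "(\<integral>w. h (fst w) * snd w \<partial>D) = (\<integral>w. h (fst w) * margin (fst w) \<partial>D)"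
proof -
  have i: "integrable D (\<lambda>w. h (fst w) * eta c (fst w))" if "c \<in> {-1, 1}" for c
    by (rule label_integral(1)[OF that h bound])
  have e: "(\<lambda>w. h (fst w) * margin (fst w)) = (\<lambda>w. h (fst w) * eta 1 (fst w) - h (fst w) * eta (-1) (fst w))"
    by (simp add: margin_def fun_eq_iff algebra_simps)
  show "integrable D (\<lambda>w. h (fst w) * margin (fst w))"
    unfolding e by (intro Bochner_Integration.integrable_diff i) auto
  have j: "integrable D (\<lambda>w. h (fst w) * indicator {w. snd w = c} w)" for c
  proof (rule integrable_const_bound[where B = "\<bar>B\<bar>"])
    have "\<bar>h u * indicator {w. snd w = c} w\<bar> \<le> \<bar>B\<bar>" for u and w :: "(real ^ 'n) \<times> real"
      using bound[of u] by (auto simp: indicator_def)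
    then show "AE w in D. norm (h (fst w) * indicator {w. snd w = c} w) \<le> \<bar>B\<bar>" by simp
  qed measurable
  have "(\<integral>w. h (fst w) * snd w \<partial>D)
      = (\<integral>w. h (fst w) * indicator {w. snd w = 1} w - h (fst w) * indicator {w. snd w = -1} w \<partial>D)"
    by (rule Bochner_Integration.integral_cong) (auto simp: space_D indicator_def)
  also have "\<dots> = (\<integral>w. h (fst w) * eta 1 (fst w) \<partial>D) - (\<integral>w. h (fst w) * eta (-1) (fst w) \<partial>D)"
    using label_integral(2)[OF _ h bound] by (subst Bochner_Integration.integral_diff[OF j j]) auto
  also have "\<dots> = (\<integral>w. h (fst w) * margin (fst w) \<partial>D)"
    unfolding e by (rule Bochner_Integration.integral_diff[symmetric]) (auto intro: i)
  finally show "(\<integral>w. h (fst w) * snd w \<partial>D) = (\<integral>w. h (fst w) * margin (fst w) \<partial>D)" .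
qed

section \<open>Cap estimates at almost every point\<close>

lemma expectation_cap:
  fixes h :: "real ^ 'n \<Rightarrow> real"
  assumes [measurable]: "h \<in> borel_measurable borel"
  shows "(\<integral>w. indicator {u. dist u x < r} (fst w) * h (fst w) \<partial>D)
     = CARD('n) * (\<integral>v\<in>cap_cone x r 1. h (dir v) * dens (dir v) \<partial>lborel)"
proof -
  have "{u. dist u x < r} \<in> sets borel" by measurable
  then have "(\<integral>w. indicator {u. dist u x < r} (fst w) * h (fst w) \<partial>D)
     = CARD('n) * (\<integral>v. indicator (cball 0 1 - {0}) v * (dens (dir v) * (indicator {u. dist u x < r} (dir v) * h (dir v))) \<partial>lborel)"
    by (intro law_integral(2)) measurable
  also have "(\<lambda>v. indicator (cball 0 1 - {0}) v * (dens (dir v) * (indicator {u. dist u x < r} (dir v) * h (dir v))))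
     = (\<lambda>v. indicator (cap_cone x r 1) v *\<^sub>R (h (dir v) * dens (dir v)))"
    by (auto simp: fun_eq_iff indicator_def cap_cone_def)
  finally show ?thesis by (simp add: set_lebesgue_integral_def)
qed

lemma set_integrable_normalize:
  fixes h :: "real ^ 'n \<Rightarrow> real"
  assumes h[measurable]: "h \<in> borel_measurable borel" and i: "integrable D (\<lambda>w. h (fst w))"
  shows "set_integrable lborel (cball 0 1) (\<lambda>v. h (dir v) * dens (dir v))"
proof -
  have d0: "dens 0 = 0" by (simp add: dens_def orthant_sphere_def)
  have "(\<lambda>v. indicator (cball 0 1 - {0}) v * (dens (dir v) * h (dir v)))
      = (\<lambda>v. indicator (cball 0 1) v *\<^sub>R (h (dir v) * dens (dir v)))"
    by (auto simp: fun_eq_iff indicator_def d0)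
  then show ?thesis using i law_integral(1)[OF h] by (simp add: set_integrable_def)
qed

text \<open>All that the vote uses about the law near \<open>x\<close>. The upper bound controls the
  tail of the weights; the lower bound, with \<open>s\<close> the sign of the margin, drives the
  logarithmic growth of the truncated mean. The exponent is the dimension of the sphere.\<close>

definition regular_point :: "real \<Rightarrow> real ^ 'n \<Rightarrow> bool" where
  "regular_point s x \<longleftrightarrow> (\<exists>A \<alpha> r1. 0 < \<alpha> \<and> 0 < r1 \<and> (\<forall>r. 0 < r \<and> r < r1 \<longrightarrow>
     measure D {w \<in> space D. dist (fst w) x < r} \<le> A * r ^ (CARD('n) - 1) \<and>
     \<alpha> * r ^ (CARD('n) - 1) \<le> (\<integral>w. indicator {u. dist u x < r} (fst w) * (s * snd w) \<partial>D)))"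

text \<open>For small r the cap average of the density is below twice its positive limit, and the
  signed one is above half of its positive limit. Cap volumes are of order r^d.\<close>

lemma regular_pointI:
  assumes x: "norm x = 1" and d: "0 < dens x" and s: "0 < s * margin x"
    and l1: "((\<lambda>r. cap_integral dens x r / cap_volume x r) \<longlongrightarrow> dens x) (at_right 0)"
    and l2: "((\<lambda>r. cap_integral (\<lambda>u. margin u * dens u) x r / cap_volume x r) \<longlongrightarrow> margin x * dens x) (at_right 0)"
  shows "regular_point s x"
proof -
  let ?N = "CARD('n)" and ?\<kappa> = "unit_ball_vol (real CARD('n))"
  let ?c = "cap_volume x"
  let ?J = "cap_integral dens x"
  let ?K = "cap_integral (\<lambda>u. margin u * dens u) x"
  define g where "g = s * margin x * dens x"
  have g: "0 < g" using d s by (simp add: g_def)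
  have "((\<lambda>r. s * (?K r / ?c r)) \<longlongrightarrow> s * (margin x * dens x)) (at_right 0)" by (intro tendsto_mult_left l2)
  then have e2: "\<forall>\<^sub>F r in at_right 0. g / 2 < s * (?K r / ?c r)"
    using g by (intro order_tendstoD(1)) (auto simp: g_def mult_ac)
  have e1: "\<forall>\<^sub>F r in at_right 0. ?J r / ?c r < 2 * dens x"
    using order_tendstoD(2)[OF l1, of "2 * dens x"] d by simp
  from eventually_conj[OF e1 e2] obtain r1 where r1: "r1 > 0"
    "\<And>r. 0 < r \<Longrightarrow> r < r1 \<Longrightarrow> ?J r / ?c r < 2 * dens x \<and> g / 2 < s * (?K r / ?c r)"
    by (auto simp: eventually_at_right_field)
  show ?thesis
    unfolding regular_point_def
  proof (intro exI conjI allI impI)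
    show "0 < ?N * (g / 2 * (?\<kappa> / (8 ^ ?N * ?N)))" using g by simp
    show "0 < min r1 1" using r1 by simp
    fix r assume "0 < r \<and> r < min r1 1"
    then have r: "0 < r" "r < 1" "r < r1" by auto
    note b = cap_cone_measure_bounds[OF x r(1,2)]
    have J: "?J r \<le> 2 * dens x * ?c r" and K: "g / 2 * ?c r \<le> s * ?K r"
      using r1(2)[OF r(1,3)] b(3) by (auto simp: field_simps)
    have "{u. dist u x < r} \<in> sets borel" by measurable
    then have "{w \<in> space D. dist (fst w) x < r} \<in> sets D" by measurable
    then have "measure D {w \<in> space D. dist (fst w) x < r} = (\<integral>w. indicator {w \<in> space D. dist (fst w) x < r} w \<partial>D)" by simp
    also have "\<dots> = (\<integral>w. indicator {u. dist u x < r} (fst w) * 1 \<partial>D)"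
      by (rule Bochner_Integration.integral_cong) (auto simp: indicator_def)
    also have "\<dots> = ?N * ?J r" using expectation_cap[of "\<lambda>_. 1" x r] by simp
    also have "\<dots> \<le> ?N * (2 * dens x * (?\<kappa> * 2 ^ ?N * r ^ (?N - 1)))"
    proof (rule mult_left_mono[OF order_trans[OF J]])
      show "2 * dens x * ?c r \<le> 2 * dens x * (?\<kappa> * 2 ^ ?N * r ^ (?N - 1))"
        by (rule mult_left_mono) (use b(2) d in auto)
    qed simp
    finally show "measure D {w \<in> space D. dist (fst w) x < r} \<le> ?N * (2 * dens x * (?\<kappa> * 2 ^ ?N)) * r ^ (?N - 1)"
      by (simp only: mult.assoc)
    have "(\<integral>w. indicator {u. dist u x < r} (fst w) * (s * snd w) \<partial>D) = s * (\<integral>w. indicator {u. dist u x < r} (fst w) * snd w \<partial>D)"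
      by (subst integral_mult_right_zero[symmetric]) (rule Bochner_Integration.integral_cong, simp_all)
    also have "(\<integral>w. indicator {u. dist u x < r} (fst w) * snd w \<partial>D) = (\<integral>w. indicator {u. dist u x < r} (fst w) * margin (fst w) \<partial>D)"
      by (rule margin_integral(2)[where B = 1]) (auto simp: indicator_def)
    also have "\<dots> = ?N * ?K r" by (rule expectation_cap) simp
    finally have E: "(\<integral>w. indicator {u. dist u x < r} (fst w) * (s * snd w) \<partial>D) = ?N * (s * ?K r)" by simp
    have "?N * (g / 2 * (?\<kappa> / (8 ^ ?N * ?N))) * r ^ (?N - 1) = ?N * (g / 2 * (?\<kappa> / (8 ^ ?N * ?N) * r ^ (?N - 1)))" by (simp only: mult.assoc)
    also have "\<dots> \<le> ?N * (s * ?K r)"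
    proof (rule mult_left_mono[OF order_trans[OF _ K]])
      show "g / 2 * (?\<kappa> / (8 ^ ?N * ?N) * r ^ (?N - 1)) \<le> g / 2 * ?c r"
        by (rule mult_left_mono) (use b(1) g in auto)
    qed simp
    finally show "?N * (g / 2 * (?\<kappa> / (8 ^ ?N * ?N))) * r ^ (?N - 1) \<le> (\<integral>w. indicator {u. dist u x < r} (fst w) * (s * snd w) \<partial>D)"
      unfolding E .
  qed
qed

theorem AE_regular_point:
  "AE x in marginal D. x \<in> orth \<and> (\<forall>s. 0 < s * margin x \<longrightarrow> regular_point s x)"
proof -
  have i1: "set_integrable lborel (cball 0 1) (\<lambda>v. dens (dir v))"
    using set_integrable_normalize[of "\<lambda>_. 1", OF borel_measurable_const integrable_const]
    by (simp only: mult_1)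
  have i2: "set_integrable lborel (cball 0 1) (\<lambda>v. margin (dir v) * dens (dir v))"
  proof (rule set_integrable_normalize[OF margin_measurable])
    show "integrable D (\<lambda>w. margin (fst w))"
      using margin_integral(1)[of "\<lambda>_. 1" 1] by (simp only: mult_1) simp
  qed
  note a1 = AE_cap_average_tendsto[OF dens_measurable i1]
  have "(\<lambda>u. margin u * dens u) \<in> borel_measurable borel" by measurable
  note a2 = AE_cap_average_tendsto[OF this i2]
  from AE_marginal[OF AE_conjI[OF a1 a2]] show ?thesis
  proof (rule AE_mp, intro AE_I2 impI)
    fix x assume "((norm x = 1 \<and>
        ((\<lambda>r. cap_integral dens x r / cap_volume x r) \<longlongrightarrow> dens x) (at_right 0)) \<and>
      norm x = 1 \<and>
        ((\<lambda>r. cap_integral (\<lambda>u. margin u * dens u) x r / cap_volume x r)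
          \<longlongrightarrow> margin x * dens x) (at_right 0)) \<and> x \<in> orth \<and> 0 < dens x"
    then show "x \<in> orth \<and> (\<forall>s. 0 < s * margin x \<longrightarrow> regular_point s x)"
      by (blast intro: regular_pointI)
  qed
qed

end

section \<open>Moments of the weights\<close>

no_notation scalar_prod (infix "\<bullet>" 70)

text \<open>For c = 1 the cone is a ray, contained in a line. For c < 1 it bounds a convex cone: a
  move by e / 2 against \<open>x\<close> lowers the left side by e / 2 and the right side by at most
  c e / 2, so it leaves the convex cone.\<close>

lemma negligible_circular_cone:
  fixes x :: "'a::euclidean_space"
  assumes x: "norm x = 1" and c: "0 \<le> c" "c \<le> 1" and dim: "2 \<le> DIM('a)"
  shows "negligible {v. v \<bullet> x = c * norm v}"
proof (cases "c = 1")
  case True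
  have "{v. v \<bullet> x = c * norm v} \<subseteq> span {x}"
  proof
    fix v assume "v \<in> {v. v \<bullet> x = c * norm v}"
    then have "v \<bullet> x = norm v * norm x" using True x by simp
    then have "norm v *\<^sub>R x = norm x *\<^sub>R v" by (simp only: norm_cauchy_schwarz_eq)
    then have "v = norm v *\<^sub>R x" using x by simp
    then show "v \<in> span {x}" by (metis span_base span_mul singletonI)
  qed
  moreover have "negligible (span {x})"
    by (rule negligible_lowdim) (use dim dim_le_card[of "span {x}" "{x}"] in auto)
  ultimately show ?thesis by (rule negligible_subset[rotated])
next
  case False
  then have c1: "c < 1" using c by simp
  let ?K = "{v. c * norm v \<le> v \<bullet> x}"
  have conv: "convex ?K"
  proof (rule convexI, unfold mem_Collect_eq)
    fix u v and s t :: real assume *: "c * norm u \<le> u \<bullet> x" "c * norm v \<le> v \<bullet> x" "0 \<le> s" "0 \<le> t"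
    have "c * norm (s *\<^sub>R u + t *\<^sub>R v) \<le> c * (s * norm u + t * norm v)"
      using * c norm_triangle_ineq[of "s *\<^sub>R u" "t *\<^sub>R v"] by (intro mult_left_mono) auto
    also have "\<dots> = s * (c * norm u) + t * (c * norm v)" by (simp add: algebra_simps)
    also have "\<dots> \<le> s * (u \<bullet> x) + t * (v \<bullet> x)" using * by (intro add_mono mult_left_mono) auto
    finally show "c * norm (s *\<^sub>R u + t *\<^sub>R v) \<le> (s *\<^sub>R u + t *\<^sub>R v) \<bullet> x" by (simp add: inner_add_left)
  qed
  have "{v. v \<bullet> x = c * norm v} \<subseteq> frontier ?K"
  proof
    fix v assume "v \<in> {v. v \<bullet> x = c * norm v}"
    then have v: "v \<bullet> x = c * norm v" by simp
    have "v \<notin> interior ?K"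
    proof
      assume "v \<in> interior ?K"
      then obtain e where e: "e > 0" "ball v e \<subseteq> ?K" by (auto simp: mem_interior)
      let ?w = "v - (e / 2) *\<^sub>R x"
      have "?w \<in> ball v e" using e x by (simp add: dist_norm)
      then have "?w \<in> ?K" by (rule subsetD[OF e(2)])
      then have "c * norm ?w \<le> ?w \<bullet> x" by (simp only: mem_Collect_eq)
      moreover have "?w \<bullet> x = c * norm v - e / 2"
        using v x by (simp add: inner_diff_left power2_norm_eq_inner[symmetric])
      moreover have "norm v - e / 2 \<le> norm ?w"
        using norm_triangle_ineq2[of v "(e / 2) *\<^sub>R x"] e x by simp
      then have "c * (norm v - e / 2) \<le> c * norm ?w" using c by (intro mult_left_mono) auto
      ultimately have "e / 2 * (1 - c) \<le> 0" by (simp add: algebra_simps)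
      then show False using e c1 by (simp add: mult_le_0_iff)
    qed
    moreover have "v \<in> closure ?K" using v closure_subset[of ?K] by auto
    ultimately show "v \<in> frontier ?K" by (simp add: frontier_def)
  qed
  then show ?thesis using negligible_convex_frontier[OF conv] by (rule negligible_subset[rotated])
qed

lemma orthant_sphere_inner:
  fixes u x :: "real ^ 'n"
  assumes "u \<in> orthant_sphere" "x \<in> orthant_sphere"
  shows "0 \<le> u \<bullet> x" "u \<bullet> x \<le> 1" "(dist u x)\<^sup>2 = 2 * (1 - u \<bullet> x)" "u \<bullet> x = 1 \<longleftrightarrow> u = x"
proof -
  have n: "norm u = 1" "norm x = 1" and c: "0 \<le> u $ i" "0 \<le> x $ i" for i
    using assms by (auto simp: orthant_sphere_def)
  show "0 \<le> u \<bullet> x" unfolding inner_vec_def using c by (auto intro!: sum_nonneg)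
  show "u \<bullet> x \<le> 1" using norm_cauchy_schwarz[of u x] n by simp
  have "u \<bullet> u = 1" "x \<bullet> x = 1" using n by (simp_all add: norm_eq_1)
  then show d: "(dist u x)\<^sup>2 = 2 * (1 - u \<bullet> x)"
    unfolding dist_norm power2_norm_eq_inner by (simp add: inner_diff_left inner_diff_right inner_commute)
  show "u \<bullet> x = 1 \<longleftrightarrow> u = x"
    using d \<open>x \<bullet> x = 1\<close> by (metis cancel_comm_monoid_add_class.diff_cancel dist_eq_0_iff mult_zero_right zero_eq_power2)
qed

context depth_map
begin

text \<open>The values outside [0, 1) are set to 0, so that the weight is non-negative everywhere; z
  = 1, an example at the test point itself, has probability 0.\<close>

definition weight :: "real \<Rightarrow> real" where
  "weight z = (if 0 \<le> z \<and> z < 1 then psi z else 0)"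

lemma weight_nonneg: "0 \<le> weight z"
  using psi_ge[of z] by (auto simp: weight_def)

text \<open>By monotonicity and lower semicontinuity a superlevel set of \<open>psi\<close> is an
  interval open at its lower end \<open>\<zeta>\<close>. The power bounds for \<open>psi\<close>,
  read at \<open>\<zeta>\<close>, give the size of 1 - \<open>\<zeta>\<close>.\<close>

lemma weight_superlevel:
  obtains cl cu where "0 < cl" "0 < cu"
    "\<And>t. 1 \<le> t \<Longrightarrow> \<exists>\<zeta>. 0 \<le> \<zeta> \<and> \<zeta> < 1 \<and> (\<forall>z. 0 \<le> z \<longrightarrow> z \<le> 1 \<longrightarrow> (t < weight z \<longleftrightarrow> \<zeta> < z \<and> z < 1)) \<and>
       cl / t \<le> (1 - \<zeta>) powr \<gamma> \<and> (1 - \<zeta>) powr \<gamma> \<le> cu / t"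
proof -
  define c1 where "c1 = psi (1 / 2) * (2 * b) powr (- \<gamma>)"
  define c2 where "c2 = psi (1 / 2) * ((\<theta> * b) powr \<gamma> + 1)"
  have c1: "0 < c1" using psi_half_pos b by (simp add: c1_def)
  have c2: "0 < c2" using psi_half_pos by (simp add: c2_def add_nonneg_pos)
  have lo: "c1 * (1 - z) powr (- \<gamma>) \<le> psi z" if "1 / 2 \<le> z" "z < 1" for z
    using psi_lower[OF that] by (simp add: c1_def)
  have up: "psi z \<le> c2 * (1 - z) powr (- \<gamma>)" if "0 \<le> z" "z < 1" for z
    using psi_upper[OF that] by (simp add: c2_def)
  show ?thesis
  proof (rule that)
    show "0 < min c1 ((1 / 2) powr \<gamma>)" "0 < c2" using c1 c2 by auto
    fix t :: real assume t: "1 \<le> t"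
    define A where "A = {z. 0 \<le> z \<and> z < 1 \<and> t < psi z}"
    define \<zeta> where "\<zeta> = Inf A"
    have bdd: "bdd_below A" by (rule bdd_belowI[of _ 0]) (simp add: A_def)
    obtain z0 where z0: "z0 \<in> A"
    proof -
      \<comment> \<open>Chosen so that c1 y^(-\<gamma>) >= 2 t, where the factor 2 provides
        strictness; y <= 1 / 2 makes the lower bound on \<open>psi\<close> available at 1 -
        y.\<close>
      define y where "y = min (1 / 2) ((c1 / (2 * t)) powr (1 / \<gamma>))"
      have y: "0 < y" "y \<le> 1 / 2" "y \<le> (c1 / (2 * t)) powr (1 / \<gamma>)" using c1 t by (auto simp: y_def)
      have "y powr \<gamma> \<le> ((c1 / (2 * t)) powr (1 / \<gamma>)) powr \<gamma>" using y \<gamma> by (intro powr_mono2) auto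
      also have "\<dots> = c1 / (2 * t)" using \<gamma> c1 t by (simp add: powr_powr)
      finally have "2 * t * y powr \<gamma> \<le> c1" using t by (simp add: field_simps)
      then have "2 * t \<le> c1 / y powr \<gamma>" using y by (simp add: pos_le_divide_eq)
      then have "2 * t \<le> c1 * (1 - (1 - y)) powr (- \<gamma>)" by (simp add: powr_minus_divide)
      also have "\<dots> \<le> psi (1 - y)" using y by (intro lo) auto
      finally show ?thesis using t y by (intro that[of "1 - y"]) (auto simp: A_def)
    qed
    have \<zeta>0: "0 \<le> \<zeta>" unfolding \<zeta>_def using z0 by (intro cInf_greatest) (auto simp: A_def)
    have \<zeta>1: "\<zeta> < 1" unfolding \<zeta>_def using cInf_lower[OF z0 bdd] z0 by (simp add: A_def)
    have AI: "z \<in> A \<longleftrightarrow> \<zeta> < z \<and> z < 1" if z: "0 \<le> z" "z \<le> 1" for z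
    proof
      assume a: "\<zeta> < z \<and> z < 1"
      then obtain z' where "z' \<in> A" "z' < z" unfolding \<zeta>_def using cInf_lessD[of A z] z0 by auto
      then show "z \<in> A" using psi_mono[of z' z] a z by (auto simp: A_def)
    next
      assume a: "z \<in> A"
      then have "z \<noteq> 0" using psi_zero t by (auto simp: A_def)
      then have zp: "0 < z" using z by simp
      obtain \<delta> where \<delta>: "\<delta> > 0" "\<And>y. 0 \<le> y \<Longrightarrow> y < 1 \<Longrightarrow> \<bar>y - z\<bar> < \<delta> \<Longrightarrow> t < psi y"
        using psi_lower_semicont[of z t] a by (auto simp: A_def)
      define y where "y = max (z / 2) (z - \<delta> / 2)"
      have "y \<in> A" using \<delta> zp a by (auto simp: A_def y_def max_def intro!: \<delta>(2))
      then have "\<zeta> \<le> y" unfolding \<zeta>_def by (rule cInf_lower[OF _ bdd])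
      also have "y < z" using zp \<delta> by (simp add: y_def)
      finally show "\<zeta> < z \<and> z < 1" using a by (simp add: A_def)
    qed
    show "\<exists>\<zeta>. 0 \<le> \<zeta> \<and> \<zeta> < 1 \<and> (\<forall>z. 0 \<le> z \<longrightarrow> z \<le> 1 \<longrightarrow> (t < weight z \<longleftrightarrow> \<zeta> < z \<and> z < 1)) \<and>
       min c1 ((1 / 2) powr \<gamma>) / t \<le> (1 - \<zeta>) powr \<gamma> \<and> (1 - \<zeta>) powr \<gamma> \<le> c2 / t"
    proof (intro exI[of _ \<zeta>] conjI allI impI \<zeta>0 \<zeta>1)
      fix z :: real assume z: "0 \<le> z" "z \<le> 1"
      show "t < weight z \<longleftrightarrow> \<zeta> < z \<and> z < 1"
        unfolding AI[OF z, symmetric] using t z by (auto simp: A_def weight_def)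
    next
      show "min c1 ((1 / 2) powr \<gamma>) / t \<le> (1 - \<zeta>) powr \<gamma>"
      proof (cases "1 / 2 \<le> \<zeta>")
        case True
        have "\<not> t < psi \<zeta>" using AI[of \<zeta>] \<zeta>0 \<zeta>1 by (auto simp: A_def)
        then have "c1 * (1 - \<zeta>) powr (- \<gamma>) \<le> t" using lo[OF True \<zeta>1] by simp
        then have "c1 / t \<le> (1 - \<zeta>) powr \<gamma>" using \<zeta>1 t by (simp add: powr_minus_divide field_simps)
        moreover have "min c1 ((1 / 2) powr \<gamma>) / t \<le> c1 / t" using t by (intro divide_right_mono) auto
        ultimately show ?thesis by linarith
      next
        case False
        \<comment> \<open>The lower bound on \<open>psi\<close> starts at 1 / 2. Below it, 1 -
          \<open>\<zeta>\<close> > 1 / 2 and t >= 1 suffice, which explains the minimum.\<close>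
        have "min c1 ((1 / 2) powr \<gamma>) / t \<le> (1 / 2) powr \<gamma> / 1" using t c1 by (intro frac_le) auto
        also have "\<dots> \<le> (1 - \<zeta>) powr \<gamma>" using False \<gamma> by (simp add: powr_mono2)
        finally show ?thesis .
      qed
    next
      \<comment> \<open>The upper bound on \<open>psi\<close> is applied to every z above
        \<open>\<zeta>\<close>, where \<open>psi\<close> exceeds t, and then z decreases to
        \<open>\<zeta>\<close>.\<close>
      have "1 - (c2 / t) powr (1 / \<gamma>) \<le> \<zeta>"
      proof (rule dense_ge_bounded[OF \<zeta>1])
        fix z assume z: "\<zeta> < z" "z < 1"
        then have "t < psi z" using AI[of z] \<zeta>0 by (auto simp: A_def)
        also have "\<dots> \<le> c2 * (1 - z) powr (- \<gamma>)" using z \<zeta>0 by (intro up) auto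
        finally have "(1 - z) powr \<gamma> \<le> c2 / t" using z t by (simp add: powr_minus_divide field_simps)
        then have "((1 - z) powr \<gamma>) powr (1 / \<gamma>) \<le> (c2 / t) powr (1 / \<gamma>)" using \<gamma> by (intro powr_mono2) auto
        then show "1 - (c2 / t) powr (1 / \<gamma>) \<le> z" using z \<gamma> by (simp add: powr_powr)
      qed
      then have "(1 - \<zeta>) powr \<gamma> \<le> ((c2 / t) powr (1 / \<gamma>)) powr \<gamma>" using \<zeta>1 \<gamma> by (intro powr_mono2) auto
      then show "(1 - \<zeta>) powr \<gamma> \<le> c2 / t" using \<gamma> c2 t by (simp add: powr_powr)
    qed
  qed
qed

end

context deep_ntk
begin

lemma weight_measurable [measurable]: "weight \<in> borel_measurable borel"
proof -
  have "renorm k \<in> borel_measurable borel" for k unfolding renorm_def[abs_def] by measurable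
  then have "(\<lambda>z. lim (\<lambda>k. renorm k z)) \<in> borel_measurable borel" by (rule borel_measurable_lim_metric)
  then have [measurable]: "psi \<in> borel_measurable borel" by (simp add: psi_def[abs_def])
  show ?thesis unfolding weight_def[abs_def] by measurable
qed

end

context sphere_law
begin

text \<open>In polar coordinates a level set of the inner product becomes a circular cone, which is
  null in dimension at least 2.\<close>

lemma inner_not_atom:
  assumes x: "x \<in> orth"
  shows "AE w in D. fst w \<bullet> x \<noteq> c"
proof (cases "0 \<le> c \<and> c \<le> 1")
  case False
  show ?thesis
  proof (rule AE_I2)
    fix w assume "w \<in> space D"
    then show "fst w \<bullet> x \<noteq> c" using orthant_sphere_inner(1,2)[OF _ x, of "fst w"] False by (auto simp: space_D)
  qed
next
  case True
  have nx: "norm x = 1" using x by (simp add: orthant_sphere_def)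
  have S[measurable]: "{u. u \<bullet> x = c} \<in> sets borel" by measurable
  have "negligible {v. v \<bullet> x = c * norm v}" using True nx card_ge by (intro negligible_circular_cone) auto
  then have "AE v in lebesgue. v \<notin> {v. v \<bullet> x = c * norm v}" unfolding negligible_iff_null_sets by (rule AE_not_in)
  then have ae: "AE v in lborel. v \<bullet> x \<noteq> c * norm v" by (simp add: AE_completion_iff)
  have "(\<integral>w. indicator {u. u \<bullet> x = c} (fst w) \<partial>D)
      = CARD('n) * (\<integral>v. indicator (cball 0 1 - {0}) v * (dens (dir v) * indicator {u. u \<bullet> x = c} (dir v)) \<partial>lborel)"
    by (rule law_integral(2)) simp
  also have "(\<integral>v. indicator (cball 0 1 - {0}) v * (dens (dir v) * indicator {u. u \<bullet> x = c} (dir v)) \<partial>lborel) = 0"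
  proof (rule integral_eq_zero_AE, rule AE_mp[OF ae], intro AE_I2 impI)
    fix v assume v: "v \<bullet> x \<noteq> c * norm v"
    show "indicator (cball 0 1 - {0}) v * (dens (dir v) * indicator {u. u \<bullet> x = c} (dir v)) = 0"
    proof (cases "v = 0")
      case False
      then have "(dir v) \<bullet> x \<noteq> c" using v by (simp add: field_simps)
      then show ?thesis by simp
    qed simp
  qed
  finally have "(\<integral>w. indicat_real {w \<in> space D. fst w \<bullet> x = c} w \<partial>D) = 0"
    by (simp add: indicator_def cong: Bochner_Integration.integral_cong)
  moreover have "{w \<in> space D. fst w \<bullet> x = c} \<in> sets D" by measurable
  ultimately have "measure D {w \<in> space D. fst w \<bullet> x = c} = 0" by simp
  then have "emeasure D {w \<in> space D. fst w \<bullet> x = c} = 0" by (simp add: emeasure_eq_measure)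
  then show ?thesis using \<open>{w \<in> space D. fst w \<bullet> x = c} \<in> sets D\<close> by (intro AE_I[where N = "{w \<in> space D. fst w \<bullet> x = c}"]) auto
qed

end

text \<open>Fubini with one coordinate integrated while the others are frozen. It reduces
  coincidences of inputs and ties of the score to properties of a single example.\<close>

lemma AE_sample_coordinate:
  assumes D: "prob_space D" and i: "i < n"
    and m: "{S \<in> space (sample_law n D). \<not> P S} \<in> sets (sample_law n D)"
    and ae: "\<And>S. S \<in> space (Pi\<^sub>M ({..<n} - {i}) (\<lambda>_. D)) \<Longrightarrow> AE w in D. P (S(i := w))"
  shows "AE S in sample_law n D. P S"
proof -
  interpret P: product_prob_space "\<lambda>_. D" by (rule product_prob_space_const[OF D])
  let ?A = "{S \<in> space (sample_law n D). \<not> P S}"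
  have ins: "insert i ({..<n} - {i}) = {..<n}" using i by auto
  have "emeasure (sample_law n D) ?A = (\<integral>\<^sup>+S. indicator ?A S \<partial>Pi\<^sub>M (insert i ({..<n} - {i})) (\<lambda>_. D))"
    unfolding ins using m by (simp add: sample_law_def)
  also have "\<dots> = (\<integral>\<^sup>+S. (\<integral>\<^sup>+w. indicator ?A (S(i := w)) \<partial>D) \<partial>Pi\<^sub>M ({..<n} - {i}) (\<lambda>_. D))"
  proof (rule P.product_nn_integral_insert)
    show "indicator ?A \<in> borel_measurable (Pi\<^sub>M (insert i ({..<n} - {i})) (\<lambda>_. D))"
      unfolding ins using m by (simp add: sample_law_def)
  qed auto
  also have "\<dots> = (\<integral>\<^sup>+S. 0 \<partial>Pi\<^sub>M ({..<n} - {i}) (\<lambda>_. D))"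
  proof (rule nn_integral_cong)
    fix S assume S: "S \<in> space (Pi\<^sub>M ({..<n} - {i}) (\<lambda>_. D))"
    have "(\<integral>\<^sup>+w. indicator ?A (S(i := w)) \<partial>D) = (\<integral>\<^sup>+w. 0 \<partial>D)"
      by (rule nn_integral_cong_AE) (use ae[OF S] in \<open>auto simp: indicator_def\<close>)
    then show "(\<integral>\<^sup>+w. indicator ?A (S(i := w)) \<partial>D) = 0" by simp
  qed
  finally have "emeasure (sample_law n D) ?A = 0" by simp
  then show ?thesis using m by (intro AE_I[where N = ?A]) auto
qed

text \<open>The condition on \<open>\<gamma>\<close> halves the dimension of the sphere because 1 -
  u x (inner product) is half the squared distance on the sphere.\<close>

locale deep_sphere = deep_ntk F q F' \<Phi> a b \<gamma> C \<theta> \<phi> + sphere_law D f \<eta>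
  for F q F' \<Phi> :: "real \<Rightarrow> real" and a b \<gamma> C \<theta> :: real and \<phi> :: "real \<Rightarrow> real"
    and D :: "((real ^ 'n) \<times> real) measure" and f :: "real ^ 'n \<Rightarrow> ennreal" and \<eta> +
  assumes \<gamma>_dim: "\<gamma> = real (CARD('n) - 1) / 2"
begin

text \<open>Superlevel sets of the weight are caps: a threshold \<open>\<zeta>\<close> for the inner
  product is the radius sqrt (2 (1 - \<zeta>)), whose d-th power is of order 1 / t. The centre is
  excluded since the weight is 0 there.\<close>

lemma weight_level_radius:
  assumes x: "x \<in> orth"
  obtains L K where "0 < L" "0 < K"
    "\<And>t. 1 \<le> t \<Longrightarrow> \<exists>R>0. (\<forall>w\<in>space D. t < weight (fst w \<bullet> x) \<longleftrightarrow> fst w \<bullet> x \<noteq> 1 \<and> dist (fst w) x < R) \<and>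
       L / t \<le> R ^ (CARD('n) - 1) \<and> R ^ (CARD('n) - 1) \<le> K / t"
proof -
  obtain cl cu where c: "0 < cl" "0 < cu"
    "\<And>t. 1 \<le> t \<Longrightarrow> \<exists>\<zeta>. 0 \<le> \<zeta> \<and> \<zeta> < 1 \<and> (\<forall>z. 0 \<le> z \<longrightarrow> z \<le> 1 \<longrightarrow> (t < weight z \<longleftrightarrow> \<zeta> < z \<and> z < 1)) \<and>
       cl / t \<le> (1 - \<zeta>) powr \<gamma> \<and> (1 - \<zeta>) powr \<gamma> \<le> cu / t"
    by (rule weight_superlevel) blast
  show ?thesis
  proof (rule that)
    show "0 < 2 powr \<gamma> * cl" "0 < 2 powr \<gamma> * cu" using c by auto
    fix t :: real assume t: "1 \<le> t"
    obtain \<zeta> where z: "0 \<le> \<zeta>" "\<zeta> < 1" "\<And>z. 0 \<le> z \<Longrightarrow> z \<le> 1 \<Longrightarrow> t < weight z \<longleftrightarrow> \<zeta> < z \<and> z < 1"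
      "cl / t \<le> (1 - \<zeta>) powr \<gamma>" "(1 - \<zeta>) powr \<gamma> \<le> cu / t" using c(3)[OF t] by blast
    define R where "R = sqrt (2 * (1 - \<zeta>))"
    have R: "0 < R" "R\<^sup>2 = 2 * (1 - \<zeta>)" using z by (auto simp: R_def)
    have Rd: "R ^ (CARD('n) - 1) = 2 powr \<gamma> * (1 - \<zeta>) powr \<gamma>"
    proof -
      have "R ^ (CARD('n) - 1) = R powr real (CARD('n) - 1)" by (simp only: powr_realpow[OF R(1)])
      also have "\<dots> = ((2 * (1 - \<zeta>)) powr (1 / 2)) powr real (CARD('n) - 1)"
        using z by (simp add: R_def powr_half_sqrt)
      also have "\<dots> = (2 * (1 - \<zeta>)) powr \<gamma>" by (simp add: powr_powr \<gamma>_dim)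
      also have "\<dots> = 2 powr \<gamma> * (1 - \<zeta>) powr \<gamma>" by (rule powr_mult)
      finally show ?thesis .
    qed
    show "\<exists>R>0. (\<forall>w\<in>space D. t < weight (fst w \<bullet> x) \<longleftrightarrow> fst w \<bullet> x \<noteq> 1 \<and> dist (fst w) x < R) \<and>
       2 powr \<gamma> * cl / t \<le> R ^ (CARD('n) - 1) \<and> R ^ (CARD('n) - 1) \<le> 2 powr \<gamma> * cu / t"
    proof (intro exI[of _ R] conjI ballI)
      fix w assume "w \<in> space D"
      then have w: "fst w \<in> orth" by (auto simp: space_D)
      note i = orthant_sphere_inner[OF w x]
      have "dist (fst w) x < R \<longleftrightarrow> (dist (fst w) x)\<^sup>2 < R\<^sup>2"
        using R by (meson power_strict_mono power_less_imp_less_base zero_le_dist less_imp_le pos2)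
      also have "\<dots> \<longleftrightarrow> \<zeta> < fst w \<bullet> x" unfolding i(3) R(2) by auto
      finally show "t < weight (fst w \<bullet> x) \<longleftrightarrow> fst w \<bullet> x \<noteq> 1 \<and> dist (fst w) x < R"
        using z(3)[OF i(1,2)] i(2) by auto
    next
      show "2 powr \<gamma> * cl / t \<le> R ^ (CARD('n) - 1)" "R ^ (CARD('n) - 1) \<le> 2 powr \<gamma> * cu / t"
        using z(4,5) unfolding Rd by (simp_all add: mult.commute[of "2 powr \<gamma>"] flip: times_divide_eq_left)
    qed (rule R)
  qed
qed

text \<open>Oriented by \<open>s\<close>: when \<open>s\<close> is the sign of the margin at
  \<open>x\<close>, a positive sum of votes is a correct decision.\<close>

definition vote :: "real \<Rightarrow> real ^ 'n \<Rightarrow> (real ^ 'n) \<times> real \<Rightarrow> real" where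
  "vote s x w = s * (snd w * weight (fst w \<bullet> x))"

lemma vote_measurable [measurable]: "vote s x \<in> borel_measurable D"
  unfolding vote_def[abs_def] by measurable

lemma vote_abs: "s \<in> {-1, 1} \<Longrightarrow> w \<in> space D \<Longrightarrow> \<bar>vote s x w\<bar> = weight (fst w \<bullet> x)"
  using weight_nonneg[of "fst w \<bullet> x"] by (auto simp: vote_def space_D abs_mult)

text \<open>The cap estimates at radius r, read through the correspondence between the level t and
  r^d of order 1 / t, become tail and mean estimates for the weights.\<close>

lemma vote_moments:
  assumes x: "x \<in> orth" and s: "s \<in> {-1, 1}" and reg: "regular_point s x"
  obtains c B M where "0 < c"
    "\<And>t. 1 \<le> t \<Longrightarrow> measure D {w \<in> space D. t \<le> \<bar>vote s x w\<bar>} \<le> M / t"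
    "\<And>T. 1 \<le> T \<Longrightarrow> c * ln T - B \<le> (\<integral>w. vote s x w * indicator {w. \<bar>vote s x w\<bar> < T} w \<partial>D)"
proof -
  define W where "W w = weight (fst w \<bullet> x)" for w :: "(real ^ 'n) \<times> real"
  have Wm[measurable]: "W \<in> borel_measurable D" unfolding W_def by measurable
  have W0: "0 \<le> W w" for w by (simp add: W_def weight_nonneg)
  have sY: "\<bar>s * snd w\<bar> = 1" if "w \<in> space D" for w using that s by (auto simp: space_D)
  let ?d = "CARD('n) - 1"
  have d: "0 < ?d" using card_ge by simp
  obtain A \<alpha> r1 where reg: "0 < \<alpha>" "0 < r1"
    "\<And>r. 0 < r \<Longrightarrow> r < r1 \<Longrightarrow> measure D {w \<in> space D. dist (fst w) x < r} \<le> A * r ^ ?d"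
    "\<And>r. 0 < r \<Longrightarrow> r < r1 \<Longrightarrow> \<alpha> * r ^ ?d \<le> (\<integral>w. indicator {u. dist u x < r} (fst w) * (s * snd w) \<partial>D)"
    using reg unfolding regular_point_def by blast
  obtain L K where LK: "0 < L" "0 < K"
    "\<And>t. 1 \<le> t \<Longrightarrow> \<exists>R>0. (\<forall>w\<in>space D. t < W w \<longleftrightarrow> fst w \<bullet> x \<noteq> 1 \<and> dist (fst w) x < R) \<and>
       L / t \<le> R ^ ?d \<and> R ^ ?d \<le> K / t"
    using weight_level_radius[OF x] unfolding W_def by metis
  \<comment> \<open>For t >= \<open>t1\<close> the radius of level t satisfies R^d <= K / t < r1^d,
    so the cap estimates apply.\<close>
  define t1 where "t1 = 1 + K / r1 ^ ?d"
  have t1: "1 \<le> t1" using LK reg by (simp add: t1_def)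
  define \<beta> where "\<beta> = \<alpha> * L"
  have \<beta>: "0 < \<beta>" using LK reg by (simp add: \<beta>_def)
  have level: "measure D {w \<in> space D. t < W w} \<le> \<bar>A\<bar> * K / t"
      "\<beta> / t \<le> (\<integral>w. indicator {w. t < W w} w * (s * snd w) \<partial>D)" if t: "t1 \<le> t" for t
  proof -
    have t': "1 \<le> t" "0 < t" using t t1 by auto
    obtain R where R: "0 < R" "\<And>w. w \<in> space D \<Longrightarrow> t < W w \<longleftrightarrow> fst w \<bullet> x \<noteq> 1 \<and> dist (fst w) x < R"
       "L / t \<le> R ^ ?d" "R ^ ?d \<le> K / t" using LK(3)[OF t'(1)] by blast
    have "K / r1 ^ ?d < t" using t by (simp add: t1_def)
    then have "K / t < r1 ^ ?d" using t' reg by (simp add: field_simps)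
    then have "R ^ ?d < r1 ^ ?d" using R(4) by simp
    then have Rr: "R < r1" by (rule power_less_imp_less_base) (use reg in auto)
    have "{u. dist u x < R} \<in> sets borel" by measurable
    then have [measurable]: "{w \<in> space D. dist (fst w) x < R} \<in> sets D" by measurable
    have "measure D {w \<in> space D. t < W w} \<le> measure D {w \<in> space D. dist (fst w) x < R}"
      by (rule finite_measure_mono) (use R in auto)
    also have "\<dots> \<le> A * R ^ ?d" by (rule reg(3)[OF R(1) Rr])
    also have "\<dots> \<le> \<bar>A\<bar> * R ^ ?d" using R by (intro mult_right_mono) auto
    also have "\<dots> \<le> \<bar>A\<bar> * (K / t)" using R by (intro mult_left_mono) auto
    finally show "measure D {w \<in> space D. t < W w} \<le> \<bar>A\<bar> * K / t" by simp
    have "\<beta> / t = \<alpha> * (L / t)" by (simp add: \<beta>_def)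
    also have "\<dots> \<le> \<alpha> * R ^ ?d" using R reg by (intro mult_left_mono) auto
    also have "\<dots> \<le> (\<integral>w. indicator {u. dist u x < R} (fst w) * (s * snd w) \<partial>D)" by (rule reg(4)[OF R(1) Rr])
    also have "\<dots> = (\<integral>w. indicator {w. t < W w} w * (s * snd w) \<partial>D)"
    proof (rule integral_cong_AE)
      have "{u. dist u x < R} \<in> sets borel" by measurable
      then show "(\<lambda>w. indicator {u. dist u x < R} (fst w) * (s * snd w)) \<in> borel_measurable D" by measurable
      show "AE w in D. indicator {u. dist u x < R} (fst w) * (s * snd w) = indicator {w. t < W w} w * (s * snd w)"
        using inner_not_atom[OF x, of 1] by (rule AE_mp) (auto intro!: AE_I2 simp: indicator_def R(2))
    qed measurable
    finally show "\<beta> / t \<le> (\<integral>w. indicator {w. t < W w} w * (s * snd w) \<partial>D)" .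
  qed
  \<comment> \<open>For t >= 2 t1 the set W >= t lies in W > t / 2, which doubles the constant. For
    smaller t the summand 2 t1 makes M / t at least 1.\<close>
  define M where "M = 2 * \<bar>A\<bar> * K + 2 * t1"
  have tail: "measure D {w \<in> space D. t \<le> W w} \<le> M / t" if t: "1 \<le> t" for t
  proof (cases "2 * t1 \<le> t")
    case True
    have "measure D {w \<in> space D. t \<le> W w} \<le> measure D {w \<in> space D. t / 2 < W w}"
      using t by (intro finite_measure_mono) auto
    also have "\<dots> \<le> \<bar>A\<bar> * K / (t / 2)" using True by (intro level) auto
    also have "\<dots> \<le> M / t" using t t1 by (simp add: M_def field_simps)
    finally show ?thesis .
  next
    case False
    have "0 \<le> \<bar>A\<bar> * K" using LK by simp
    then have "1 \<le> M / t" using t False by (simp add: M_def pos_le_divide_eq)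
    then show ?thesis using prob_le_1 order_trans by blast
  qed
  have mean: "\<beta> * ln T - ((\<beta> + 1) * t1 + M) \<le> (\<integral>w. s * snd w * W w * indicator {w. W w < T} w \<partial>D)" if T: "1 \<le> T" for T
    by (rule truncated_mean_ge_log[OF prob_D _ Wm sY W0 less_imp_le[OF \<beta>] t1 level(2) tail T]) auto
  show ?thesis
  proof (rule that)
    show "0 < \<beta>" by (rule \<beta>)
    show "measure D {w \<in> space D. t \<le> \<bar>vote s x w\<bar>} \<le> M / t" if "1 \<le> t" for t
    proof -
      have "{w \<in> space D. t \<le> \<bar>vote s x w\<bar>} = {w \<in> space D. t \<le> W w}" using vote_abs[OF s] by (auto simp: W_def)
      then show ?thesis using tail[OF that] by simp
    qed
    show "\<beta> * ln T - ((\<beta> + 1) * t1 + M) \<le> (\<integral>w. vote s x w * indicator {w. \<bar>vote s x w\<bar> < T} w \<partial>D)" if "1 \<le> T" for T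
    proof -
      have "(\<integral>w. vote s x w * indicator {w. \<bar>vote s x w\<bar> < T} w \<partial>D) = (\<integral>w. s * snd w * W w * indicator {w. W w < T} w \<partial>D)"
      proof (rule Bochner_Integration.integral_cong[OF refl])
        fix w assume "w \<in> space D"
        then have e: "\<bar>vote s x w\<bar> = W w" by (simp add: vote_abs[OF s] W_def)
        show "vote s x w * indicator {w. \<bar>vote s x w\<bar> < T} w = s * snd w * W w * indicator {w. W w < T} w"
          unfolding indicator_def mem_Collect_eq e by (simp add: vote_def W_def)
      qed
      then show ?thesis using mean[OF that] by simp
    qed
  qed
qed

end

section \<open>Consistency\<close>

context deep_sphere
begin

abbreviation "sample n \<equiv> sample_law n D"

abbreviation score :: "nat \<Rightarrow> (nat \<Rightarrow> (real ^ 'n) \<times> real) \<Rightarrow> real ^ 'n \<Rightarrow> real" where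
  "score n S x \<equiv> \<Sum>i<n. snd (S i) * weight (fst (S i) \<bullet> x)"

section \<open>Null events of the sample\<close>

lemma coordinate_measurable [measurable]: "i < n \<Longrightarrow> (\<lambda>S. S i) \<in> measurable (sample n) D"
  unfolding sample_law_def by (intro measurable_component_singleton) auto

lemma sample_space: "S \<in> space (sample n) \<Longrightarrow> i < n \<Longrightarrow> S i \<in> space D"
  by (auto simp: sample_law_def space_PiM)

lemma sample_orth: "S \<in> space (sample n) \<Longrightarrow> i < n \<Longrightarrow> fst (S i) \<in> orth"
  using sample_space[of S n i] by (auto simp: space_D)

lemma AE_distinct_inputs:
  assumes "i < n" "j < n" "i \<noteq> j"
  shows "AE S in sample n. fst (S i) \<bullet> fst (S j) \<noteq> 1"
proof (rule AE_sample_coordinate[OF prob_D assms(1)])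
  show "{S \<in> space (sample n). \<not> fst (S i) \<bullet> fst (S j) \<noteq> 1} \<in> sets (sample n)"
    using assms by measurable
  fix S assume "S \<in> space (Pi\<^sub>M ({..<n} - {i}) (\<lambda>_. D))"
  then have "S j \<in> space D" using assms by (auto simp: space_PiM)
  then have "fst (S j) \<in> orth" by (auto simp: space_D)
  from inner_not_atom[OF this, of 1] show "AE w in D. fst ((S(i := w)) i) \<bullet> fst ((S(i := w)) j) \<noteq> 1"
    using assms by simp
qed

lemma AE_test_input:
  assumes "i < n" "x \<in> orth"
  shows "AE S in sample n. fst (S i) \<bullet> x \<noteq> 1"
proof (rule AE_sample_coordinate[OF prob_D assms(1)])
  show "{S \<in> space (sample n). \<not> fst (S i) \<bullet> x \<noteq> 1} \<in> sets (sample n)"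
    using assms by measurable
  show "AE w in D. fst ((S(i := w)) i) \<bullet> x \<noteq> 1" for S
    using inner_not_atom[OF assms(2), of 1] by simp
qed

text \<open>By injectivity of \<open>psi\<close> a value of the weight pins down the inner product,
  and no single inner product has positive probability.\<close>

lemma AE_weight_neq:
  assumes x: "x \<in> orth"
  shows "AE w in D. fst w \<bullet> x \<noteq> 1 \<longrightarrow> weight (fst w \<bullet> x) \<noteq> v"
proof (cases "\<exists>z. 0 \<le> z \<and> z < 1 \<and> psi z = v")
  case True
  then obtain z where z: "0 \<le> z" "z < 1" "psi z = v" by blast
  show ?thesis
    using inner_not_atom[OF x, of z]
  proof (rule AE_mp, intro AE_I2 impI)
    fix w assume w: "w \<in> space D" "fst w \<bullet> x \<noteq> z" "fst w \<bullet> x \<noteq> 1"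
    then have "fst w \<in> orth" by (auto simp: space_D)
    from orthant_sphere_inner[OF this x] show "weight (fst w \<bullet> x) \<noteq> v"
      using w psi_inj[OF _ _ z(1,2)] z(3) by (auto simp: weight_def)
  qed
next
  case False
  show ?thesis
  proof (intro AE_I2 impI)
    fix w assume w: "w \<in> space D" "fst w \<bullet> x \<noteq> 1"
    then have "fst w \<in> orth" by (auto simp: space_D)
    from orthant_sphere_inner[OF this x] show "weight (fst w \<bullet> x) \<noteq> v"
      using w False by (auto simp: weight_def)
  qed
qed

text \<open>With all examples but the first frozen, a tie forces the weight of the first to equal
  |?v|, a null event. An empty sample would always tie, hence n > 0.\<close>

lemma AE_no_tie:
  assumes n: "0 < n" and x: "x \<in> orth"
  shows "AE S in sample n. score n S x \<noteq> 0"
proof (rule AE_sample_coordinate[OF prob_D n])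
  show "{S \<in> space (sample n). \<not> score n S x \<noteq> 0} \<in> sets (sample n)"
    by measurable
  fix S :: "nat \<Rightarrow> (real ^ 'n) \<times> real"
  let ?v = "\<Sum>i\<in>{..<n} - {0}. snd (S i) * weight (fst (S i) \<bullet> x)"
  have sum: "score n (S(0 := w)) x = snd w * weight (fst w \<bullet> x) + ?v" for w
  proof -
    have "score n (S(0 := w)) x
        = snd w * weight (fst w \<bullet> x) + (\<Sum>i\<in>{..<n} - {0}. snd ((S(0 := w)) i) * weight (fst ((S(0 := w)) i) \<bullet> x))"
      using n by (subst sum.remove[of _ 0]) auto
    also have "(\<Sum>i\<in>{..<n} - {0}. snd ((S(0 := w)) i) * weight (fst ((S(0 := w)) i) \<bullet> x)) = ?v"
      by (rule sum.cong) auto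
    finally show ?thesis .
  qed
  show "AE w in D. score n (S(0 := w)) x \<noteq> 0"
    unfolding sum using AE_weight_neq[OF x, of "\<bar>?v\<bar>"] inner_not_atom[OF x, of 1] AE_space
  proof eventually_elim
    case (elim w)
    have "\<bar>snd w * weight (fst w \<bullet> x)\<bar> = weight (fst w \<bullet> x)"
      using elim(3) weight_nonneg[of "fst w \<bullet> x"] by (auto simp: space_D abs_mult)
    then show ?case using elim(1,2) by auto
  qed
qed

lemma depth_limit:
  assumes S: "S \<in> space (sample n)" and x: "x \<in> orth"
    and dist: "\<And>i j. i < n \<Longrightarrow> j < n \<Longrightarrow> i \<noteq> j \<Longrightarrow> fst (S i) \<bullet> fst (S j) \<noteq> 1"
    and test: "\<And>i. i < n \<Longrightarrow> fst (S i) \<bullet> x \<noteq> 1"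
    and tie: "score n S x \<noteq> 0"
  shows "depth_seq \<phi> n S x \<longlonglongrightarrow> sgn (score n S x)"
proof -
  note o = sample_orth[OF S]
  have t: "0 \<le> fst (S i) \<bullet> x \<and> fst (S i) \<bullet> x < 1" if "i < n" for i
    using orthant_sphere_inner(1,2)[OF o[OF that] x] test[OF that] by auto
  have e: "score n S x = (\<Sum>i<n. snd (S i) * psi (fst (S i) \<bullet> x))"
    using t by (intro sum.cong) (auto simp: weight_def)
  show ?thesis unfolding e
  proof (rule depth_seq_tendsto)
    show "fst (S i) \<bullet> fst (S i) = 1" if "i < n" for i
      using o[OF that] by (simp add: orthant_sphere_def norm_eq_1)
    show "0 \<le> fst (S i) \<bullet> fst (S j) \<and> fst (S i) \<bullet> fst (S j) < 1" if "i < n" "j < n" "i \<noteq> j" for i j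
      using orthant_sphere_inner(1,2)[OF o[OF that(1)] o[OF that(2)]] dist[OF that] by auto
  qed (use t tie e in auto)
qed

section \<open>From wrong signs to the error event\<close>

lemma error_event_sets:
  assumes x: "x \<in> orth"
  shows "error_event \<phi> n D \<eta> x \<epsilon> \<in> sets (sample n)"
proof (rule error_event_measurable, rule depth_seq_measurable)
  fix S i j assume S: "S \<in> space (sample n)"
  show "i < n \<Longrightarrow> j < n \<Longrightarrow> fst (S i) \<bullet> fst (S j) \<in> {0..1}"
    using orthant_sphere_inner(1,2)[OF sample_orth[OF S] sample_orth[OF S]] by auto
  show "i < n \<Longrightarrow> fst (S i) \<bullet> x \<in> {0..1}"
    using orthant_sphere_inner(1,2)[OF sample_orth[OF S] x] by auto
next
  fix i assume "i < n"
  have "(\<lambda>w. (fst w, snd w)) \<in> measurable D (borel \<Otimes>\<^sub>M borel)" by measurable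
  then show "(\<lambda>S. S i) \<in> measurable (sample n) (borel \<Otimes>\<^sub>M borel)"
    using measurable_compose[OF coordinate_measurable[OF \<open>i < n\<close>]] by simp
qed

text \<open>Almost surely the classifier exists and is the sign of a non-zero score. If that sign
  were a Bayes label, its \<open>infdist\<close> to the Bayes labels would be 0, so any error is a
  wrong sign.\<close>

lemma AE_correct:
  assumes n: "0 < n" and x: "x \<in> orth" and \<epsilon>: "0 < \<epsilon>"
  shows "AE S in sample n. S \<in> error_event \<phi> n D \<eta> x \<epsilon> \<longrightarrow>
     sgn (score n S x) \<in> {-1, 1} - bayes_labels \<eta> x"
proof -
  have 1: "AE S in sample n. \<forall>i\<in>{..<n}. \<forall>j\<in>{..<n}. i \<noteq> j \<longrightarrow> fst (S i) \<bullet> fst (S j) \<noteq> 1"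
    by (intro AE_finite_allI AE_impI AE_distinct_inputs) auto
  have 2: "AE S in sample n. \<forall>i\<in>{..<n}. fst (S i) \<bullet> x \<noteq> 1"
    by (intro AE_finite_allI AE_test_input x) auto
  show ?thesis
    using 1 2 AE_no_tie[OF n x] AE_space
  proof eventually_elim
    case (elim S)
      have lim: "depth_seq \<phi> n S x \<longlonglongrightarrow> sgn (score n S x)"
      using elim by (intro depth_limit x) auto
    have "deep_classifier \<phi> n S x = sgn (score n S x)"
      unfolding deep_classifier_def by (rule limI[OF lim])
    moreover have "convergent (depth_seq \<phi> n S x)" using lim by (auto simp: convergent_def)
    ultimately have "S \<in> error_event \<phi> n D \<eta> x \<epsilon> \<Longrightarrow> sgn (score n S x) \<notin> bayes_labels \<eta> x"
      using \<epsilon> by (auto simp: error_event_def)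
    then show ?case using elim(3) by (auto simp: sgn_if)
  qed
qed

lemma bayes_labels_eq:
  assumes x: "x \<in> orth"
  shows "margin x = 0 \<Longrightarrow> bayes_labels \<eta> x = {-1, 1}"
    and "s \<in> {-1, 1} \<Longrightarrow> 0 < s * margin x \<Longrightarrow> bayes_labels \<eta> x = {s}"
proof -
  have m: "margin x = \<eta> 1 x - \<eta> (-1) x" using x by (simp add: margin_def eta_def)
  have "c \<in> bayes_labels \<eta> x \<longleftrightarrow> c \<in> {-1, 1} \<and> \<eta> 1 x \<le> \<eta> c x \<and> \<eta> (-1) x \<le> \<eta> c x" for c
    unfolding bayes_labels_def is_arg_max_def mem_Collect_eq by (metis insert_iff not_less singletonD)
  then have e: "bayes_labels \<eta> x = {c \<in> {-1, 1}. \<eta> 1 x \<le> \<eta> c x \<and> \<eta> (-1) x \<le> \<eta> c x}"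
    by blast
  show "margin x = 0 \<Longrightarrow> bayes_labels \<eta> x = {-1, 1}"
    unfolding e by (auto simp: m)
  assume s: "s \<in> {-1, 1}" "0 < s * margin x"
  from s(1) consider "s = 1" | "s = -1" by blast
  then show "bayes_labels \<eta> x = {s}"
    by cases (use s(2) in \<open>auto simp: e m\<close>)
qed

theorem error_tendsto_zero:
  assumes x: "x \<in> orth" and reg: "\<And>s. 0 < s * margin x \<Longrightarrow> regular_point s x" and \<epsilon>: "0 < \<epsilon>"
  shows "(\<lambda>n. measure (sample n) (error_event \<phi> n D \<eta> x \<epsilon>)) \<longlonglongrightarrow> 0"
proof (cases "margin x = 0")
  case True
  show ?thesis
  \<comment> \<open>At margin 0 both labels are optimal, so for n >= 1 an error is a null event and
    no estimate of the score is needed. For n = 0 the score is 0, whose sign is not a label.\<close>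
  proof (rule tendsto_eventually, rule eventually_sequentiallyI[of 1])
    fix n :: nat assume "1 \<le> n"
    then have "AE S in sample n. S \<notin> error_event \<phi> n D \<eta> x \<epsilon>"
      using AE_correct[of n x \<epsilon>] x \<epsilon> bayes_labels_eq(1)[OF x True] by auto
    then show "measure (sample n) (error_event \<phi> n D \<eta> x \<epsilon>) = 0"
      using error_event_sets[OF x] by (simp add: AE_iff_null_sets[symmetric] null_sets_def measure_def)
  qed
next
  case False
  define s where "s = sgn (margin x)"
  have s: "s \<in> {-1, 1}" "0 < s * margin x" using False by (auto simp: s_def sgn_if)
  obtain c B M where cBM: "0 < c"
    "\<And>t. 1 \<le> t \<Longrightarrow> measure D {w \<in> space D. t \<le> \<bar>vote s x w\<bar>} \<le> M / t"
    "\<And>T. 1 \<le> T \<Longrightarrow> c * ln T - B \<le> (\<integral>w. vote s x w * indicator {w. \<bar>vote s x w\<bar> < T} w \<partial>D)"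
    by (rule vote_moments[OF x s(1) reg[OF s(2)]]) (rule that)
  have lim: "(\<lambda>n. measure (sample n) {S \<in> space (sample n). (\<Sum>i<n. vote s x (S i)) \<le> 0}) \<longlonglongrightarrow> 0"
    by (rule weighted_vote_consistent[OF prob_D vote_measurable cBM(2,3,1)])
  show ?thesis
  proof (rule tendsto_sandwich[OF always_eventually _ tendsto_const lim])
    show "\<forall>\<^sub>F n in sequentially. measure (sample n) (error_event \<phi> n D \<eta> x \<epsilon>)
        \<le> measure (sample n) {S \<in> space (sample n). (\<Sum>i<n. vote s x (S i)) \<le> 0}"
    proof (rule eventually_sequentiallyI[of 1])
      fix n :: nat assume n: "1 \<le> n"
      interpret P: prob_space "sample n" by (rule prob_space_sample_law[OF prob_D])
      have v: "(\<Sum>i<n. vote s x (S i)) = s * score n S x" for S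
        by (simp add: vote_def sum_distrib_left)
      show "measure (sample n) (error_event \<phi> n D \<eta> x \<epsilon>)
        \<le> measure (sample n) {S \<in> space (sample n). (\<Sum>i<n. vote s x (S i)) \<le> 0}"
      proof (rule P.finite_measure_mono_AE)
        have "AE S in sample n. S \<in> error_event \<phi> n D \<eta> x \<epsilon> \<longrightarrow>
           sgn (score n S x) \<in> {-1, 1} - {s}"
          using AE_correct[of n x \<epsilon>] n x \<epsilon> bayes_labels_eq(2)[OF x s] by simp
        then show "AE S in sample n. S \<in> error_event \<phi> n D \<eta> x \<epsilon> \<longrightarrow> S \<in> {S \<in> space (sample n). (\<Sum>i<n. vote s x (S i)) \<le> 0}"
          using AE_space
        proof eventually_elim
          case (elim S)
          show ?case
          proof
            assume "S \<in> error_event \<phi> n D \<eta> x \<epsilon>"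
            then have "sgn (score n S x) \<in> {-1, 1} - {s}" using elim by blast
            then have "s * score n S x \<le> 0"
              using s(1) by (auto simp: sgn_if split: if_splits)
            then show "S \<in> {S \<in> space (sample n). (\<Sum>i<n. vote s x (S i)) \<le> 0}" using elim(2) by (simp add: v)
          qed
        qed
        show "{S \<in> space (sample n). (\<Sum>i<n. vote s x (S i)) \<le> 0} \<in> sets (sample n)" by measurable
      qed
    qed
  qed simp
qed

theorem AE_consistent:
  "AE x in marginal D. \<forall>\<epsilon>>0.
     (\<forall>n. error_event \<phi> n D \<eta> x \<epsilon> \<in> sets (sample n)) \<and>
     (\<lambda>n. measure (sample n) (error_event \<phi> n D \<eta> x \<epsilon>)) \<longlonglongrightarrow> 0"
  using AE_regular_point
proof (rule AE_mp, intro AE_I2 impI)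
  fix x assume x: "x \<in> orth \<and> (\<forall>s. 0 < s * margin x \<longrightarrow> regular_point s x)"
  then show "\<forall>\<epsilon>>0. (\<forall>n. error_event \<phi> n D \<eta> x \<epsilon> \<in> sets (sample n)) \<and>
     (\<lambda>n. measure (sample n) (error_event \<phi> n D \<eta> x \<epsilon>)) \<longlonglongrightarrow> 0"
    using error_event_sets error_tendsto_zero by blast
qed

end

theorem corollary1:
  fixes d :: nat
    and D :: "((real ^ 'n) \<times> real) measure"
    and f :: "real ^ 'n \<Rightarrow> ennreal"
    and \<eta> :: "real \<Rightarrow> real ^ 'n \<Rightarrow> real"
  assumes "1 \<le> d"
    and "CARD('n) = d + 1"
    and "prob_space D"
    and "sets D = sets (restrict_space borel (orthant_sphere \<times> {-1, 1}))"
    and "distributed D (restrict_space sphere_surface orthant_sphere) fst f"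
    and "is_label_prob D \<eta>"
  shows "AE x in marginal D. \<forall>\<epsilon>>0.
           (\<forall>n. error_event (bayes_act d) n D \<eta> x \<epsilon> \<in> sets (sample_law n D)) \<and>
           (\<lambda>n. measure (sample_law n D) (error_event (bayes_act d) n D \<eta> x \<epsilon>)) \<longlonglongrightarrow> 0"
proof -
  obtain F q F' \<Phi> a b C \<theta> where F: "depth_map F q F' \<Phi> a b (real d / 2) C \<theta>"
    "\<And>z. z \<in> {-1..1} \<Longrightarrow> dual_act (bayes_act d) z = F z"
    "\<And>z. z \<in> {-1..1} \<Longrightarrow> dual_act_deriv (bayes_act d) z = F' z"
    "F \<in> borel_measurable borel" "F' \<in> borel_measurable borel"
    using bayes_depth_map[OF assms(1)] by blast
  interpret deep_sphere F q F' \<Phi> a b "real d / 2" C \<theta> "bayes_act d" D f \<eta>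
    by (intro deep_sphere.intro deep_ntk.intro deep_ntk_axioms.intro sphere_law.intro deep_sphere_axioms.intro F)
      (use assms in auto)
  show ?thesis by (rule AE_consistent)
qed

end
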